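(* Let $\varepsilon>0$ be any constant, and let $p=p(n)$ satisfy $$(\log\log n)^{1/3}(\log n)^2 n^{-1/3} \ll p \le 1-\varepsilon.$$ Let $G\in\mathcal{G}(n,p)$ and set $b=1/(1-p)$. Then, asymptotically almost surely, $$\chi_P(G)\sim \frac{n}{2\log_b(np)} \sim \chi(G).$$
   Context: $\mathcal{G}(n,p)$ is the binomial random graph on vertex set $\{1,\dots,n\}$ in which each of the $\binom n2$ pairs is an edge independently with probability $p$. An event holds asymptotically almost surely (a.a.s.) if its probability tends to $1$ as $n\to\infty$. $f\ll g$ means $f/g\to0$; $f\sim g$ means $f/g\to 1$ as $n\to\infty$. All logarithms are natural; $\log_b$ denotes logarithm to base $b$. $\chi(G)$ is the chromatic number. $\chi_P(G)$, the paintability (on-line choice number), is defined via the following game between Mr. Paint and Mrs. Correct on $G$, where each vertex initially has the same number of erasers: in each round Mr. Paint selects a subset of the (remaining) vertices and paints them with a new colour (never used before); Mrs. Correct then erases the colour from some of these vertices so that no two adjacent vertices keep the same colour, each erasure at a vertex using up one eraser at that vertex (she cannot erase at a vertex with no erasers left). Vertices whose colour is not erased are permanently coloured and removed. Mrs. Correct wins if all vertices become permanently coloured; Mr. Paint wins if at some point he presents two adjacent vertices neither of which has any eraser left. $G$ is $k$-paintable if Mrs. Correct has a winning strategy when each vertex initially has $k-1$ erasers; $\chi_P(G)$ is the least such $k$. *)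

theory Defs
  imports "HOL-Probability.Probability" "HOL-Library.Landau_Symbols"
begin

text \<open>A graph is given by a vertex set and a set of two-element sets of vertices.\<close>

definition vertex_pairs :: "nat \<Rightarrow> nat set set" where
  "vertex_pairs n = {e. e \<subseteq> {1..n} \<and> card e = 2}"

definition Gnp :: "nat \<Rightarrow> real \<Rightarrow> nat set set pmf" where
  "Gnp n p = map_pmf (\<lambda>\<omega>. {e \<in> vertex_pairs n. \<omega> e})
     (Pi_pmf (vertex_pairs n) False (\<lambda>_. bernoulli_pmf p))"

definition aas :: "(nat \<Rightarrow> real) \<Rightarrow> (nat \<Rightarrow> nat set set \<Rightarrow> bool) \<Rightarrow> bool" where
  "aas p Q \<longleftrightarrow> (\<lambda>n. measure_pmf.prob (Gnp n (p n)) {E. Q n E}) \<longlonglongrightarrow> 1"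

text \<open>``A.a.s. \<open>X \<sim> Y\<close>'' for graph parameters: the ratio tends to 1 in probability.\<close>

definition aas_sim ::
    "(nat \<Rightarrow> real) \<Rightarrow> (nat \<Rightarrow> nat set set \<Rightarrow> real) \<Rightarrow> (nat \<Rightarrow> nat set set \<Rightarrow> real) \<Rightarrow> bool" where
  "aas_sim p X Y \<longleftrightarrow> (\<forall>\<delta>>0. aas p (\<lambda>n E. \<bar>X n E / Y n E - 1\<bar> \<le> \<delta>))"

definition independent_in :: "'a set set \<Rightarrow> 'a set \<Rightarrow> bool" where
  "independent_in E I \<longleftrightarrow> (\<forall>u\<in>I. \<forall>v\<in>I. {u, v} \<notin> E)"

definition proper_colouring :: "'a set \<Rightarrow> 'a set set \<Rightarrow> ('a \<Rightarrow> nat) \<Rightarrow> bool" where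
  "proper_colouring V E c \<longleftrightarrow> (\<forall>u\<in>V. \<forall>v\<in>V. {u, v} \<in> E \<longrightarrow> c u \<noteq> c v)"

definition chromatic_number :: "'a set \<Rightarrow> 'a set set \<Rightarrow> nat" where
  "chromatic_number V E = (LEAST k. \<exists>c. c ` V \<subseteq> {..<k} \<and> proper_colouring V E c)"

text \<open>
  A legal reply of Mrs. Correct to the painted set \<open>S\<close>, when \<open>r v\<close> erasers are left at \<open>v\<close>,
  is given by the set \<open>K\<close> of vertices that keep their colour.
\<close>

definition legal_reply :: "'a set set \<Rightarrow> ('a \<Rightarrow> nat) \<Rightarrow> 'a set \<Rightarrow> 'a set \<Rightarrow> bool" where
  "legal_reply E r S K \<longleftrightarrow> K \<subseteq> S \<and> independent_in E K \<and> (\<forall>v\<in>S - K. r v > 0)"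

definition use_erasers :: "'a set \<Rightarrow> ('a \<Rightarrow> nat) \<Rightarrow> 'a \<Rightarrow> nat" where
  "use_erasers X r = (\<lambda>v. if v \<in> X then r v - 1 else r v)"

text \<open>
  The positions (remaining vertices \<open>U\<close>, erasers \<open>r\<close>) from which Mrs. Correct has a winning
  strategy; \<open>U = {}\<close> is the base case, where the premise is vacuous. Mr. Paint has to paint a
  nonempty set, as he could otherwise stall forever. Every round then colours a vertex or uses
  up an eraser, so on finite graphs every play is finite.
\<close>

inductive correct_wins :: "'a set set \<Rightarrow> 'a set \<Rightarrow> ('a \<Rightarrow> nat) \<Rightarrow> bool" for E where
  "(\<And>S. S \<subseteq> U \<Longrightarrow> S \<noteq> {} \<Longrightarrow>
      \<exists>K. legal_reply E r S K \<and> correct_wins E (U - K) (use_erasers (S - K) r))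
   \<Longrightarrow> correct_wins E U r"

definition paintable :: "'a set \<Rightarrow> 'a set set \<Rightarrow> nat \<Rightarrow> bool" where
  "paintable V E k \<longleftrightarrow> k \<ge> 1 \<and> correct_wins E V (\<lambda>_. k - 1)"

definition paintability :: "'a set \<Rightarrow> 'a set set \<Rightarrow> nat" where
  "paintability V E = (LEAST k. paintable V E k)"

text \<open>
  Mrs. Correct is stuck exactly when two adjacent vertices without erasers have been presented,
  which is the winning condition of Mr. Paint.
\<close>

lemma no_legal_reply_iff:
  "(\<nexists>K. legal_reply E r S K) \<longleftrightarrow> (\<exists>u\<in>S. \<exists>v\<in>S. {u, v} \<in> E \<and> r u = 0 \<and> r v = 0)"
proof
  assume "\<nexists>K. legal_reply E r S K"
  then have "\<not> legal_reply E r S {v \<in> S. r v = 0}" by blast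
  then show "\<exists>u\<in>S. \<exists>v\<in>S. {u, v} \<in> E \<and> r u = 0 \<and> r v = 0"
    unfolding legal_reply_def independent_in_def by fastforce
next
  assume "\<exists>u\<in>S. \<exists>v\<in>S. {u, v} \<in> E \<and> r u = 0 \<and> r v = 0"
  then show "\<nexists>K. legal_reply E r S K"
    unfolding legal_reply_def independent_in_def by (metis DiffI less_numeral_extra(3))
qed

lemma correct_wins_if_many_erasers:
  assumes "finite U" "\<And>v. {v} \<notin> E" "\<And>v. v \<in> U \<Longrightarrow> card U \<le> Suc (r v)"
  shows "correct_wins E U r"
  using assms(1,3)
proof (induction "card U" arbitrary: U r rule: less_induct)
  case less
  show ?case
  proof (rule correct_wins.intros)
    fix S assume S: "S \<subseteq> U" "S \<noteq> {}"
    then obtain w where w: "w \<in> S" by blast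
    have r_pos: "r v > 0" if "v \<in> S - {w}" for v
    proof -
      have "{v, w} \<subseteq> U" "v \<noteq> w" using that S w by auto
      then have "2 \<le> card U" using card_mono[OF less.prems(1), of "{v, w}"] by simp
      then show ?thesis using less.prems(2)[of v] \<open>{v, w} \<subseteq> U\<close> by simp
    qed
    have "legal_reply E r S {w}"
      using w r_pos assms(2) by (auto simp: legal_reply_def independent_in_def)
    moreover have card_less: "card (U - {w}) < card U"
      using w S less.prems(1) by (meson card_Diff1_less subsetD)
    have "correct_wins E (U - {w}) (use_erasers (S - {w}) r)"
    proof (rule less.hyps[OF card_less])
      show "finite (U - {w})" using less.prems(1) by simp
      show "card (U - {w}) \<le> Suc (use_erasers (S - {w}) r v)" if "v \<in> U - {w}" for v
        using less.prems(2)[of v] that card_less by (auto simp: use_erasers_def)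
    qed
    ultimately show "\<exists>K. legal_reply E r S K \<and> correct_wins E (U - K) (use_erasers (S - K) r)"
      by blast
  qed
qed

lemma paintable_card:
  assumes "finite V" "V \<noteq> {}" "\<And>v. {v} \<notin> E"
  shows "paintable V E (card V)"
  using assms by (auto simp: paintable_def Suc_le_eq card_gt_0_iff
      intro!: correct_wins_if_many_erasers)

end

theory Submission
  imports Defs "HOL-Real_Asymp.Real_Asymp"
begin

text \<open>
  Write \<open>b = 1 / (1 - p)\<close> and \<open>l = log b (n p)\<close>. Independent sets have at most \<open>(2 + o(1)) l\<close>
  vertices by the first moment method, which bounds the chromatic number from below; the paintability
  is at least the chromatic number. For the upper bound put \<open>m = n / (K (ln n)^2)\<close>. Almost surely every
  \<open>m\<close>-set contains an independent set of \<open>k = (2 - o(1)) l\<close> vertices, and every set of at most \<open>m\<close>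
  vertices spans a graph of degeneracy at most \<open>D = 2 p m + 6 ln n\<close>. If Mr. Paint presents at least
  \<open>m\<close> vertices, Mrs. Correct keeps an independent \<open>k\<close>-set, which happens at most \<open>n / k\<close> times.
  Otherwise she colours the presented set with \<open>D + 1\<close> colours and keeps the class that is heaviest
  for weights growing by the factor \<open>1 + 1 / (D + 1)\<close> with each eraser spent in such rounds; the total
  weight never increases, so each vertex spends \<open>O(D ln n) = o(n / k)\<close> erasers there.

  The statement about \<open>m\<close>-sets survives the union bound because the number \<open>X\<close> of independent
  \<open>k\<close>-subsets of an \<open>m\<close>-set vanishes with probability at most \<open>exp (- c m^2 / (p k^4))\<close>. This follows
  from an entropy argument for the random graph conditioned on \<open>X = 0\<close>: conditioning changes the mean
  of \<open>X\<close> from \<open>E X\<close> to \<open>0\<close>, and by positive correlation the price per edge is controlled by the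
  unconditioned second moment of the loss in \<open>X\<close> caused by that edge.
\<close>

section \<open>Entropy and random subsets\<close>

text \<open>The size \<open>m\<close> and the threshold for \<open>p\<close> are forced from two
  sides. Rounds with few painted vertices cost a vertex about \<open>p m ln n\<close> erasers. This
  has to be small against \<open>n / k\<close>, which is at least \<open>n p / (2 ln n)\<close>
  because \<open>k <= 2 ln n / p\<close>, so \<open>m\<close> is a small multiple of
  \<open>n / (ln n)^2\<close>. On the other side there are \<open>exp (O (m ln ln n))\<close> sets
  of size \<open>m\<close>, and with \<open>k\<close> of order \<open>ln n / p\<close> the exponent
  \<open>m^2 / (p k^4)\<close> beats this once \<open>n p^3\<close> exceeds a constant times
  \<open>(ln n)^6 ln ln n\<close>: this is the assumed lower bound on \<open>p\<close>, cubed. An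
  exponent \<open>m^2 / k^4\<close> would stop at \<open>n powr (-1/4)\<close>, up to logarithms.

  The obstacle in the entropy argument is an edge whose mean effect on \<open>X\<close> is too large
  for a second-order bound on the exponential moment. Such an edge is charged to its own presence in
  the conditioned graph, and the number of edges present there is again controlled by
  entropy.\<close>

lemma ln_le_if_le_exp: "0 < x \<Longrightarrow> x \<le> exp y \<Longrightarrow> ln x \<le> (y::real)"
  by (metis exp_le_cancel_iff exp_ln)

section \<open>Entropy inequalities for a single biased coin\<close>

text \<open>Gibbs variational inequality, unnormalised: \<open>q1\<close> and \<open>q0\<close> are
  the values of a density relative to the coin, the right side is its entropy, and
  \<open>h1\<close>, \<open>h0\<close> are an arbitrary tilt. Zero densities are harmless, since the
  logarithm of each density carries that density as a factor.\<close>

lemma gibbs_two_point: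
  fixes p q0 q1 h0 h1 :: real
  assumes p: "0 \<le> p" "p \<le> 1" and q: "0 \<le> q0" "0 \<le> q1"
  defines "q \<equiv> p * q1 + (1 - p) * q0"
  shows "p * q1 * h1 + (1 - p) * q0 * h0 - q * ln (p * exp h1 + (1 - p) * exp h0)
       \<le> p * q1 * ln q1 + (1 - p) * q0 * ln q0 - q * ln q"
proof (cases "q = 0")
  case True
  have z: "p * q1 = 0" "(1 - p) * q0 = 0"
    using True p q unfolding q_def
    by (smt (verit) mult_nonneg_nonneg)+
  show ?thesis unfolding z True by simp
next
  case False
  define Z where "Z = p * exp h1 + (1 - p) * exp h0"
  have qpos: "q > 0" using False p q unfolding q_def
    by (smt (verit) mult_nonneg_nonneg)
  have Zpos: "Z > 0"
    unfolding Z_def using p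
    by (smt (verit) exp_gt_zero mult_nonneg_nonneg mult_pos_pos)
  \<comment> \<open>This is \<open>ln y <= y - 1\<close> for \<open>y = q * exp h / (Z * x)\<close>,
    the tilted density over the given one. Averaged over the coin the left sides cancel, because the
    tilted density has total mass \<open>q\<close>.\<close>
  have key: "x - q * exp h / Z \<le> x * (ln x + ln Z - ln q - h)" if "0 \<le> x" for x h :: real
  proof (cases "x = 0")
    case True then show ?thesis using qpos Zpos by simp
  next
    case False
    then have x: "x > 0" using that by simp
    have "ln (q * exp h / (Z * x)) \<le> q * exp h / (Z * x) - 1"
      using qpos Zpos x by (intro ln_le_minus_one) simp
    moreover have "ln (q * exp h / (Z * x)) = ln q + h - ln Z - ln x"
      using qpos Zpos x by (simp add: ln_div ln_mult)
    ultimately have "1 - q * exp h / (Z * x) \<le> ln x + ln Z - ln q - h" by simp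
    then have "x * (1 - q * exp h / (Z * x)) \<le> x * (ln x + ln Z - ln q - h)"
      using x by (intro mult_left_mono) auto
    then show ?thesis using x by (simp add: algebra_simps)
  qed
  have "p * (q1 - q * exp h1 / Z) + (1 - p) * (q0 - q * exp h0 / Z)
     \<le> p * (q1 * (ln q1 + ln Z - ln q - h1)) + (1 - p) * (q0 * (ln q0 + ln Z - ln q - h0))"
    using p q by (intro add_mono mult_left_mono key) auto
  moreover have "p * (q1 - q * exp h1 / Z) + (1 - p) * (q0 - q * exp h0 / Z)
      = (p * q1 + (1 - p) * q0) - q * ((p * exp h1 + (1 - p) * exp h0) / Z)"
    by (simp add: algebra_simps add_divide_distrib diff_divide_distrib)
  moreover have "\<dots> = q - q * (Z / Z)" by (simp add: q_def Z_def)
  ultimately have "0 \<le> p * (q1 * (ln q1 + ln Z - ln q - h1)) + (1 - p) * (q0 * (ln q0 + ln Z - ln q - h0))"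
    using Zpos by simp
  also have "\<dots> = p * q1 * ln q1 + (1 - p) * q0 * ln q0 - q * ln q
      - (p * q1 * h1 + (1 - p) * q0 * h0 - q * ln Z)"
    unfolding q_def by (simp add: algebra_simps)
  finally show ?thesis unfolding Z_def by simp
qed

text \<open>The exponent has the order of the variance of the coin, at most \<open>p\<close>, and
  not a constant as in Hoeffding's bound; this is the source of the factor \<open>p\<close> gained
  later. The price is the restriction \<open>x \<le> 1\<close>. Both exponentials are expanded to
  second order and the linear terms cancel.\<close>

lemma bernoulli_mgf_le:
  fixes p x :: real
  assumes p: "0 \<le> p" "p \<le> 1" and x: "0 \<le> x" "x \<le> 1"
  shows "p * exp (x * (1 - p)) + (1 - p) * exp (- (x * p)) \<le> exp (x\<^sup>2 * p)"
proof -
  have 1: "exp (x * (1 - p)) \<le> 1 + x * (1 - p) + (x * (1 - p))\<^sup>2"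
    using p x by (intro exp_bound) (auto intro: mult_le_one)
  have 2: "exp (- y) \<le> 1 - y + y\<^sup>2" if "0 \<le> y" for y :: real
  proof -
    \<comment> \<open>Comparing after multiplication by \<open>1 + y\<close> reduces the claim to
      \<open>(1 - y + y^2) (1 + y) = 1 + y^3\<close>.\<close>
    have "exp (- y) * (1 + y) \<le> exp (- y) * exp y"
      by (intro mult_left_mono) auto
    also have "\<dots> = 1" by (simp add: exp_minus)
    also have "\<dots> \<le> 1 + y ^ 3" using that by simp
    also have "\<dots> = (1 - y + y\<^sup>2) * (1 + y)" by (simp add: algebra_simps power2_eq_square power3_eq_cube)
    finally show ?thesis using that by (simp add: mult_le_cancel_right)
  qed
  have "p * exp (x * (1 - p)) + (1 - p) * exp (- (x * p))
     \<le> p * (1 + x * (1 - p) + (x * (1 - p))\<^sup>2) + (1 - p) * (1 - x * p + (x * p)\<^sup>2)"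
    using p x 1 2[of "x * p"] by (intro add_mono mult_left_mono) auto
  also have "\<dots> = 1 + x\<^sup>2 * p * (1 - p)" by (simp add: algebra_simps power2_eq_square)
  also have "\<dots> \<le> 1 + x\<^sup>2 * p"
    using p x by (simp add: mult_left_le)
  also have "\<dots> \<le> exp (x\<^sup>2 * p)" by (rule exp_ge_add_one_self)
  finally show ?thesis .
qed

text \<open>The factor 2 comes from \<open>exp 1 \<le> 3\<close>. It reappears in
  \<open>expected_card_le\<close> and in the Chernoff bound for dense vertex sets.\<close>

lemma bernoulli_exp_le:
  fixes p :: real
  assumes "0 \<le> p"
  shows "p * exp 1 + (1 - p) \<le> exp (2 * p)"
proof -
  have "p * exp 1 + (1 - p) \<le> 1 + 2 * p"
    using assms exp_le mult_left_mono[of "exp 1" 3 p] by (simp add: algebra_simps)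
  also have "\<dots> \<le> exp (2 * p)" by (rule exp_ge_add_one_self)
  finally show ?thesis .
qed

text \<open>The entropy released by one coordinate: \<open>a\<close> stands for the mean decrement
  of the functional there and \<open>A\<close> for its second moment. Up to the threshold
  \<open>L\<close> the gain is obtained by tilting; beyond it the term with \<open>A / L\<close>
  swallows the gain.\<close>

lemma entropy_two_point:
  fixes p q0 q1 a A L l :: real
  assumes p: "0 \<le> p" "p \<le> 1" and q: "0 \<le> q0" "q0 \<le> q1"
    and a: "0 \<le> a" "a\<^sup>2 \<le> A" and L: "0 < L" "0 \<le> l" "l * L \<le> 1"
  defines "q \<equiv> p * q1 + (1 - p) * q0"
  shows "l * (p * (1 - p) * a * (q1 - q0) - A / L * (p * q1)) - l\<^sup>2 * p * q * A
       \<le> p * q1 * ln q1 + (1 - p) * q0 * ln q0 - q * ln q"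
proof -
  have q1: "0 \<le> q1" and A0: "0 \<le> A" using q a by (auto intro: order_trans[of _ "a\<^sup>2"])
  have q0: "0 \<le> q" unfolding q_def using p q q1 by simp
  show ?thesis
  proof (cases "a \<le> L")
    case True
    \<comment> \<open>The tilt is \<open>l * a\<close> times the centred coin;
      \<open>l * L \<le> 1\<close> keeps it in the range of \<open>bernoulli_mgf_le\<close>.\<close>
    have la: "l * a \<le> 1" using True L by (meson mult_left_mono order_trans)
    have "p * exp (l * a * (1 - p)) + (1 - p) * exp (- (l * a * p)) \<le> exp ((l * a)\<^sup>2 * p)"
      using p L a la by (intro bernoulli_mgf_le) auto
    moreover have "0 < p * exp (l * a * (1 - p)) + (1 - p) * exp (- (l * a * p))"
      using p by (smt (verit) exp_gt_zero mult_nonneg_nonneg mult_pos_pos)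
    ultimately have "ln (p * exp (l * a * (1 - p)) + (1 - p) * exp (- (l * a * p))) \<le> (l * a)\<^sup>2 * p"
      by (simp add: ln_le_if_le_exp)
    also have "\<dots> \<le> l\<^sup>2 * p * A"
      using mult_left_mono[OF a(2), of "l\<^sup>2 * p"] p by (simp add: power_mult_distrib mult_ac)
    finally have lnle: "q * ln (p * exp (l * a * (1 - p)) + (1 - p) * exp (- (l * a * p))) \<le> q * (l\<^sup>2 * p * A)"
      using q0 by (rule mult_left_mono)
    have "l * (p * (1 - p) * a * (q1 - q0) - A / L * (p * q1)) \<le> l * (p * (1 - p) * a * (q1 - q0))"
      using L p q1 A0 by (intro mult_left_mono) auto
    also have "\<dots> = p * q1 * (l * a * (1 - p)) + (1 - p) * q0 * (- (l * a * p))"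
      by (simp add: algebra_simps)
    finally show ?thesis
      using gibbs_two_point[OF p q(1) q1, of "l * a * (1 - p)" "- (l * a * p)"] lnle
      unfolding q_def[symmetric] by (simp add: algebra_simps)
  next
    case False
    \<comment> \<open>No tilt is used here: the gain is at most \<open>a * (p * q1)\<close>, and
      \<open>a > L\<close> yields \<open>a \<le> A / L\<close>. So the left side is nonpositive,
      while entropy is nonnegative by the Gibbs inequality with zero tilt.\<close>
    have "p * (1 - p) * a * (q1 - q0) \<le> p * 1 * a * q1"
      using p q q1 a by (intro mult_mono) (auto intro: mult_nonneg_nonneg)
    also have "\<dots> = a * (p * q1)" by simp
    also have "\<dots> \<le> A / L * (p * q1)"
    proof (intro mult_right_mono)
      have "a * L \<le> a * a" using False a by (intro mult_left_mono) auto
      then show "a \<le> A / L" using L a by (simp add: field_simps power2_eq_square)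
    qed (use p q1 in auto)
    finally have "l * (p * (1 - p) * a * (q1 - q0) - A / L * (p * q1)) \<le> 0"
      using L by (simp add: mult_nonneg_nonpos)
    moreover have "0 \<le> l\<^sup>2 * p * q * A" using p q0 A0 by simp
    moreover have "0 \<le> p * q1 * ln q1 + (1 - p) * q0 * ln q0 - q * ln q"
      using gibbs_two_point[OF p q(1) q1, of 0 0] unfolding q_def by simp
    ultimately show ?thesis by linarith
  qed
qed

section \<open>Expectations over a random subset of a finite set\<close>

text \<open>Expectation over a subset of \<open>A\<close> containing each element independently with
  probability \<open>p\<close>. As a finite sum it has no integrability conditions and admits
  induction over the coordinates by \<open>prodE_insert\<close>.\<close>

definition prodE :: "real \<Rightarrow> 'a set \<Rightarrow> ('a set \<Rightarrow> real) \<Rightarrow> real" where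
  "prodE p A f = (\<Sum>T\<in>Pow A. p ^ card T * (1 - p) ^ card (A - T) * f T)"

lemma prodE_empty [simp]: "prodE p {} f = f {}"
  by (simp add: prodE_def)

lemma prodE_insert:
  assumes "finite A" "e \<notin> A"
  shows "prodE p (insert e A) f = p * prodE p A (\<lambda>T. f (insert e T)) + (1 - p) * prodE p A f"
proof -
  have inj: "inj_on (insert e) (Pow A)"
    using assms by (auto simp: inj_on_def)
  have 1: "card (insert e T) = Suc (card T)" "A - insert e T = A - T"
      "card (insert e A - T) = Suc (card (A - T))" if "T \<in> Pow A" for T
  proof -
    have "finite T" "e \<notin> T" using that assms by (auto intro: finite_subset)
    then show "card (insert e T) = Suc (card T)" "A - insert e T = A - T"
      "card (insert e A - T) = Suc (card (A - T))"
      using assms by (auto simp: insert_Diff_if)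
  qed
  have "prodE p (insert e A) f = (\<Sum>T\<in>Pow A. p ^ card T * (1 - p) ^ card (insert e A - T) * f T)
     + (\<Sum>T\<in>insert e ` Pow A. p ^ card T * (1 - p) ^ card (insert e A - T) * f T)"
    unfolding prodE_def Pow_insert using assms by (intro sum.union_disjoint) auto
  also have "(\<Sum>T\<in>insert e ` Pow A. p ^ card T * (1 - p) ^ card (insert e A - T) * f T)
     = (\<Sum>T\<in>Pow A. p ^ card (insert e T) * (1 - p) ^ card (insert e A - insert e T) * f (insert e T))"
    by (subst sum.reindex[OF inj]) simp
  also have "\<dots> = p * prodE p A (\<lambda>T. f (insert e T))"
    unfolding prodE_def sum_distrib_left by (intro sum.cong refl) (simp add: 1 mult_ac)
  also have "(\<Sum>T\<in>Pow A. p ^ card T * (1 - p) ^ card (insert e A - T) * f T) = (1 - p) * prodE p A f"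
    unfolding prodE_def sum_distrib_left by (intro sum.cong refl) (simp add: 1 mult_ac)
  finally show ?thesis by simp
qed

lemma prodE_cong: "(\<And>T. T \<subseteq> A \<Longrightarrow> f T = g T) \<Longrightarrow> prodE p A f = prodE p A g"
  unfolding prodE_def by (intro sum.cong) auto

lemma prodE_add: "prodE p A (\<lambda>T. f T + g T) = prodE p A f + prodE p A g"
  unfolding prodE_def by (simp add: sum.distrib distrib_left)

lemma prodE_diff: "prodE p A (\<lambda>T. f T - g T) = prodE p A f - prodE p A g"
  unfolding prodE_def by (simp add: sum_subtractf right_diff_distrib)

lemma prodE_cmult: "prodE p A (\<lambda>T. c * f T) = c * prodE p A f"
  unfolding prodE_def by (simp add: sum_distrib_left mult_ac)

lemma prodE_sum: "prodE p A (\<lambda>T. \<Sum>i\<in>I. f i T) = (\<Sum>i\<in>I. prodE p A (f i))"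
  unfolding prodE_def by (simp add: sum_distrib_left) (rule sum.swap)

lemma prodE_mono:
  assumes "0 \<le> p" "p \<le> 1" "\<And>T. T \<subseteq> A \<Longrightarrow> f T \<le> g T"
  shows "prodE p A f \<le> prodE p A g"
  unfolding prodE_def using assms by (intro sum_mono mult_left_mono) auto

lemma prodE_const: "finite A \<Longrightarrow> prodE p A (\<lambda>_. c) = c"
  by (induction A rule: finite_induct) (auto simp: prodE_insert algebra_simps)

lemma prodE_nonneg:
  assumes "0 \<le> p" "p \<le> 1" "\<And>T. T \<subseteq> A \<Longrightarrow> 0 \<le> f T"
  shows "0 \<le> prodE p A f"
  unfolding prodE_def using assms by (intro sum_nonneg mult_nonneg_nonneg) auto

text \<open>Irrelevant coordinates average out one at a time. This localises an event about a vertex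
  set to the pairs inside that set.\<close>

lemma prodE_restrict:
  assumes "finite A" "B \<subseteq> A" "\<And>T. f T = f (T \<inter> B)"
  shows "prodE p A f = prodE p B f"
proof -
  have "prodE p (B \<union> C) f = prodE p B f" if "finite C" "C \<inter> B = {}" for C
    using that
  proof (induction C rule: finite_induct)
    case (insert e C)
    have "f (insert e T) = f T" for T
      using assms(3)[of T] assms(3)[of "insert e T"] insert.prems by auto
    then show ?case
      using insert assms finite_subset[OF assms(2,1)] by (simp add: prodE_insert algebra_simps)
  qed simp
  from this[of "A - B"] show ?thesis
    using assms by (simp add: Un_absorb1 Int_commute)
qed

lemma prodE_avoid:
  assumes "finite A" "F \<subseteq> A"
  shows "prodE p A (\<lambda>T. of_bool (F \<inter> T = {})) = (1 - p) ^ card F"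
proof -
  have "prodE p F (\<lambda>T. of_bool (F \<inter> T = {})) = (1 - p) ^ card F"
  proof -
    have "prodE p F (\<lambda>T. of_bool (F \<inter> T = {})) =
        (\<Sum>T\<in>Pow F. if T = {} then (1 - p) ^ card F else 0)"
      unfolding prodE_def by (intro sum.cong) auto
    then show ?thesis using finite_subset[OF assms(2,1)] by (simp add: sum.delta)
  qed
  moreover have "prodE p A (\<lambda>T. of_bool (F \<inter> T = {})) = prodE p F (\<lambda>T. of_bool (F \<inter> T = {}))"
    using assms by (intro prodE_restrict) (auto simp: Int_ac)
  ultimately show ?thesis by simp
qed

lemma prodE_square_le:
  assumes "finite A" "0 \<le> p" "p \<le> 1"
  shows "(prodE p A f)\<^sup>2 \<le> prodE p A (\<lambda>T. (f T)\<^sup>2)"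
proof -
  define c where "c = prodE p A f"
  have "0 \<le> prodE p A (\<lambda>T. (f T - c)\<^sup>2)"
    using assms by (intro prodE_nonneg) auto
  also have "prodE p A (\<lambda>T. (f T - c)\<^sup>2) = prodE p A (\<lambda>T. (f T)\<^sup>2 + (- 2 * c) * f T + c\<^sup>2)"
    by (simp add: power2_diff algebra_simps)
  also have "\<dots> = prodE p A (\<lambda>T. (f T)\<^sup>2) - 2 * c * c + c\<^sup>2"
    using assms prodE_cmult[of p A "- 2 * c" f] unfolding prodE_add by (simp add: prodE_const c_def)
  finally show ?thesis unfolding c_def by (simp add: power2_eq_square)
qed

section \<open>Entropy bounds for decreasing functionals\<close>

text \<open>Minus the discrete derivative at \<open>e\<close>, written so that it does not depend on
  whether \<open>e\<close> lies in \<open>T\<close>. Antimonotonicity of all decrements says that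
  \<open>X\<close> is supermodular.\<close>

definition decrement :: "('a set \<Rightarrow> real) \<Rightarrow> 'a \<Rightarrow> 'a set \<Rightarrow> real" where
  "decrement X e T = X (T - {e}) - X (insert e T)"

lemma decrement_insert:
  assumes "d \<noteq> e"
  shows "decrement (\<lambda>T. X (insert e T)) d T = decrement X d (insert e T)"
proof -
  have "insert e T - {d} = insert e (T - {d})" using assms by auto
  then show ?thesis by (simp add: decrement_def insert_commute)
qed

lemma chebyshev_two_point:
  fixes p x0 x1 y0 y1 :: real
  assumes "0 \<le> p" "p \<le> 1" "x1 \<le> x0" "y0 \<le> y1"
  shows "p * (x1 * y1) + (1 - p) * (x0 * y0) \<le> (p * x1 + (1 - p) * x0) * (p * y1 + (1 - p) * y0)"
proof -
  have "0 \<le> p * (1 - p) * ((x0 - x1) * (y1 - y0))"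
    using assms by (intro mult_nonneg_nonneg) auto
  then show ?thesis by (simp add: algebra_simps)
qed

text \<open>
  Exposing one coordinate, the Gibbs inequality bounds the entropy it contributes, and positive
  correlation (in the form of Chebyshev's sum inequality) recombines the two branches. The term with
  \<open>1 / L\<close> pays for the coordinates whose mean decrement exceeds the threshold \<open>L\<close>.
\<close>

lemma entropy_lower_bound:
  fixes X g :: "'a set \<Rightarrow> real" and p l L :: real
  assumes "finite A" and p: "0 \<le> p" "p \<le> 1" and L: "0 < L" "0 \<le> l" "l * L \<le> 1"
    and "antimono X" "\<And>e. antimono (decrement X e)" "mono g" "\<And>T. g T \<in> {0, 1}"
  shows "l * (prodE p A X * prodE p A g - prodE p A (\<lambda>T. X T * g T)
             - 1 / L * (\<Sum>e\<in>A. prodE p A (\<lambda>T. (decrement X e T)\<^sup>2) * prodE p A (\<lambda>T. g T * of_bool (e \<in> T))))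
          - l\<^sup>2 * p * prodE p A g * (\<Sum>e\<in>A. prodE p A (\<lambda>T. (decrement X e T)\<^sup>2))
        \<le> - (prodE p A g * ln (prodE p A g))"
  using assms(1,7-)
proof (induction A arbitrary: X g rule: finite_induct)
  case empty
  \<comment> \<open>Without coordinates the mean of \<open>g\<close> is 0 or 1, so both sides
    vanish.\<close>
  have "g {} = 0 \<or> g {} = 1" using empty.prems(4) by auto
  then show ?case by auto
next
  case (insert e A)
  define X1 where "X1 = (\<lambda>T. X (insert e T))"
  define g1 where "g1 = (\<lambda>T. g (insert e T))"
  have X1: "antimono X1" unfolding X1_def by (rule antimonoI, rule antimonoD[OF insert.prems(1)]) auto
  have g1: "mono g1" unfolding g1_def by (rule monoI, rule monoD[OF insert.prems(3)]) auto
  have dX1: "antimono (decrement X1 d)" for d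
  proof (cases "d = e")
    case True
    then show ?thesis by (simp add: decrement_def X1_def antimono_def insert_Diff_if)
  next
    case False
    then show ?thesis
      unfolding X1_def
      by (intro antimonoI) (simp add: decrement_insert, intro antimonoD[OF insert.prems(2)[of d]], auto)
  qed
  have dX_nonneg: "0 \<le> decrement X d T" for d T
    using insert.prems(1) by (auto simp: decrement_def antimono_def intro: antimonoD)
  note IH0 = insert.IH[OF insert.prems]
  have "\<And>T. g1 T \<in> {0, 1}" using insert.prems(4) by (auto simp: g1_def)
  note IH1 = insert.IH[OF X1 dX1 g1 this]
  define q0 q1 \<mu>0 \<mu>1 where "q0 = prodE p A g" and "q1 = prodE p A g1"
    and "\<mu>0 = prodE p A X" and "\<mu>1 = prodE p A X1"
  define s0 s1 where "s0 = prodE p A (\<lambda>T. X T * g T)" and "s1 = prodE p A (\<lambda>T. X1 T * g1 T)"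
  define A0 A1 where "A0 = (\<lambda>d. prodE p A (\<lambda>T. (decrement X d T)\<^sup>2))"
    and "A1 = (\<lambda>d. prodE p A (\<lambda>T. (decrement X1 d T)\<^sup>2))"
  define r0 r1 where "r0 = (\<lambda>d. prodE p A (\<lambda>T. g T * of_bool (d \<in> T)))"
    and "r1 = (\<lambda>d. prodE p A (\<lambda>T. g1 T * of_bool (d \<in> T)))"
  define AA where "AA = (\<lambda>d. prodE p (insert e A) (\<lambda>T. (decrement X d T)\<^sup>2))"
  define rr where "rr = (\<lambda>d. prodE p (insert e A) (\<lambda>T. g T * of_bool (d \<in> T)))"
  define q where "q = p * q1 + (1 - p) * q0"
  have q_eq: "prodE p (insert e A) g = q"
    using insert.hyps by (simp add: prodE_insert q_def q0_def q1_def g1_def)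
  have mu_eq: "prodE p (insert e A) X = p * \<mu>1 + (1 - p) * \<mu>0"
    using insert.hyps by (simp add: prodE_insert \<mu>0_def \<mu>1_def X1_def)
  have s_eq: "prodE p (insert e A) (\<lambda>T. X T * g T) = p * s1 + (1 - p) * s0"
    using insert.hyps by (simp add: prodE_insert s0_def s1_def X1_def g1_def)
  have g_nonneg: "0 \<le> g T" for T using insert.prems(4)[of T] by auto
  have gg1: "g T \<le> g1 T" for T
    unfolding g1_def by (rule monoD[OF insert.prems(3)]) auto
  have q01: "0 \<le> q0" "q0 \<le> q1"
    using p g_nonneg gg1 by (auto simp: q0_def q1_def intro!: prodE_nonneg prodE_mono)
  have AA_eq: "AA d = p * A1 d + (1 - p) * A0 d" if "d \<in> A" for d
  proof -
    have "d \<noteq> e" using that insert.hyps by auto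
    then show ?thesis using insert.hyps
      by (simp add: AA_def prodE_insert A0_def A1_def X1_def decrement_insert)
  qed
  have rr_eq: "rr d = p * r1 d + (1 - p) * r0 d" if "d \<in> A" for d
  proof -
    have "d \<noteq> e" using that insert.hyps by auto
    then show ?thesis using insert.hyps
      by (simp add: rr_def prodE_insert r0_def r1_def g1_def)
  qed
  have A10: "A1 d \<le> A0 d" if "d \<in> A" for d
  proof -
    have de: "d \<noteq> e" using that insert.hyps by auto
    have "(decrement X1 d T)\<^sup>2 \<le> (decrement X d T)\<^sup>2" for T
    proof (rule power_mono)
      show "0 \<le> decrement X1 d T" using dX_nonneg[of d "insert e T"] de by (simp add: X1_def decrement_insert)
      show "decrement X1 d T \<le> decrement X d T"
        using antimonoD[OF insert.prems(2)[of d], of T "insert e T"] de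
        by (auto simp: X1_def decrement_insert)
    qed
    then show ?thesis unfolding A0_def A1_def using p by (intro prodE_mono) auto
  qed
  have r01: "r0 d \<le> r1 d" for d
    unfolding r0_def r1_def using p gg1 by (intro prodE_mono) auto
  have rre: "rr e = p * q1"
  proof -
    have "prodE p A (\<lambda>T. g T * of_bool (e \<in> T)) = prodE p A (\<lambda>_. 0)"
      using insert.hyps by (intro prodE_cong) auto
    then show ?thesis
      using insert.hyps by (simp add: rr_def prodE_insert q1_def g1_def prodE_const)
  qed
  \<comment> \<open>The difference of the branch means of \<open>X\<close> is the mean decrement at
    \<open>e\<close>, so its square is at most the second moment \<open>AA e\<close>.\<close>
  define a where "a = \<mu>0 - \<mu>1"
  have a_eq: "a = prodE p A (decrement X e)"
  proof -
    have "prodE p A (decrement X e) = prodE p A (\<lambda>T. X T - X1 T)"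
      using insert.hyps by (intro prodE_cong) (auto simp: decrement_def X1_def Diff_insert0 subset_iff intro!: arg_cong[of _ _ X])
    then show ?thesis by (simp add: a_def prodE_diff \<mu>0_def \<mu>1_def)
  qed
  have a0: "0 \<le> a" unfolding a_eq using p dX_nonneg by (intro prodE_nonneg) auto
  have aA: "a\<^sup>2 \<le> AA e"
  proof -
    have "a\<^sup>2 \<le> prodE p A (\<lambda>T. (decrement X e T)\<^sup>2)"
      unfolding a_eq using insert.hyps p by (intro prodE_square_le) auto
    also have "\<dots> = AA e"
    proof -
      have "prodE p A (\<lambda>T. (decrement X e (insert e T))\<^sup>2) = prodE p A (\<lambda>T. (decrement X e T)\<^sup>2)"
        by (intro prodE_cong) (simp add: decrement_def)
      then show ?thesis using insert.hyps by (simp add: AA_def prodE_insert algebra_simps)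
    qed
    finally show ?thesis .
  qed
  have two: "l * (p * (1 - p) * a * (q1 - q0) - AA e / L * (p * q1)) - l\<^sup>2 * p * q * AA e
       \<le> p * q1 * ln q1 + (1 - p) * q0 * ln q0 - q * ln q"
    unfolding q_def using p q01 a0 aA L by (intro entropy_two_point) auto
  have harris1: "p * (q1 * (\<Sum>d\<in>A. A1 d)) + (1 - p) * (q0 * (\<Sum>d\<in>A. A0 d)) \<le> q * (\<Sum>d\<in>A. AA d)"
  proof -
    have "p * (q1 * (\<Sum>d\<in>A. A1 d)) + (1 - p) * (q0 * (\<Sum>d\<in>A. A0 d))
        = (\<Sum>d\<in>A. p * (A1 d * q1) + (1 - p) * (A0 d * q0))"
      by (simp add: sum.distrib sum_distrib_left mult_ac)
    also have "\<dots> \<le> (\<Sum>d\<in>A. AA d * q)"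
      unfolding q_def using p q01 A10 by (intro sum_mono) (simp add: AA_eq chebyshev_two_point)
    finally show ?thesis by (simp add: sum_distrib_left mult_ac)
  qed
  have harris2: "p * (\<Sum>d\<in>A. A1 d * r1 d) + (1 - p) * (\<Sum>d\<in>A. A0 d * r0 d) \<le> (\<Sum>d\<in>A. AA d * rr d)"
  proof -
    have "p * (\<Sum>d\<in>A. A1 d * r1 d) + (1 - p) * (\<Sum>d\<in>A. A0 d * r0 d)
        = (\<Sum>d\<in>A. p * (A1 d * r1 d) + (1 - p) * (A0 d * r0 d))"
      by (simp add: sum.distrib sum_distrib_left)
    also have "\<dots> \<le> (\<Sum>d\<in>A. AA d * rr d)"
      using p r01 A10 by (intro sum_mono) (simp add: AA_eq rr_eq chebyshev_two_point)
    finally show ?thesis .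
  qed
  define R0 R1 S0 S1 RR SS where "R0 = (\<Sum>d\<in>A. A0 d * r0 d)" and "R1 = (\<Sum>d\<in>A. A1 d * r1 d)"
    and "S0 = (\<Sum>d\<in>A. A0 d)" and "S1 = (\<Sum>d\<in>A. A1 d)"
    and "RR = (\<Sum>d\<in>A. AA d * rr d)" and "SS = (\<Sum>d\<in>A. AA d)"
  have I0: "(1 - p) * (l * (\<mu>0 * q0 - s0 - 1 / L * R0) - l\<^sup>2 * p * q0 * S0) \<le> (1 - p) * (- (q0 * ln q0))"
    using IH0 p unfolding q0_def \<mu>0_def s0_def R0_def A0_def r0_def S0_def by (intro mult_left_mono) auto
  have I1: "p * (l * (\<mu>1 * q1 - s1 - 1 / L * R1) - l\<^sup>2 * p * q1 * S1) \<le> p * (- (q1 * ln q1))"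
    using IH1 p unfolding q1_def \<mu>1_def s1_def R1_def A1_def r1_def S1_def by (intro mult_left_mono) auto
  have H1: "l\<^sup>2 * p * (p * (q1 * S1) + (1 - p) * (q0 * S0)) \<le> l\<^sup>2 * p * (q * SS)"
    using harris1 p unfolding S0_def S1_def SS_def by (intro mult_left_mono) auto
  have H2: "l / L * (p * R1 + (1 - p) * R0) \<le> l / L * RR"
    using harris2 L unfolding R0_def R1_def RR_def by (intro mult_left_mono) auto
  \<comment> \<open>The product of the two averages exceeds the average of the branch products by
    the covariance term \<open>p * (1 - p) * a * (q1 - q0)\<close>. This is the gain that
    \<open>two\<close> pays for with the entropy of the coordinate \<open>e\<close>; the rest is the
    induction hypothesis in each branch.\<close>
  have "l * ((p * \<mu>1 + (1 - p) * \<mu>0) * q - (p * s1 + (1 - p) * s0) - 1 / L * (AA e * (p * q1) + RR))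
      - l\<^sup>2 * p * q * (AA e + SS)
    = (1 - p) * (l * (\<mu>0 * q0 - s0 - 1 / L * R0) - l\<^sup>2 * p * q0 * S0)
      + p * (l * (\<mu>1 * q1 - s1 - 1 / L * R1) - l\<^sup>2 * p * q1 * S1)
      + (l * (p * (1 - p) * a * (q1 - q0) - AA e / L * (p * q1)) - l\<^sup>2 * p * q * AA e)
      - (l / L * RR - l / L * (p * R1 + (1 - p) * R0))
      - (l\<^sup>2 * p * (q * SS) - l\<^sup>2 * p * (p * (q1 * S1) + (1 - p) * (q0 * S0)))"
    unfolding a_def q_def by (simp add: algebra_simps add_divide_distrib diff_divide_distrib)
  also have "\<dots> \<le> - (q * ln q)"
    using I0 I1 two H1 H2 by (simp add: algebra_simps)
  finally have fin: "l * ((p * \<mu>1 + (1 - p) * \<mu>0) * q - (p * s1 + (1 - p) * s0) - 1 / L * (AA e * (p * q1) + RR))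
      - l\<^sup>2 * p * q * (AA e + SS) \<le> - (q * ln q)" .
  show ?case
    unfolding q_eq mu_eq s_eq AA_def[symmetric, THEN fun_cong] rr_def[symmetric, THEN fun_cong]
    using fin insert.hyps rre unfolding RR_def SS_def by simp
qed

text \<open>Dividing by the probability of \<open>g\<close> shows the content: conditioning on an
  event of probability \<open>q\<close> raises the expected size of the random set to at most twice
  \<open>p * card A\<close> plus \<open>ln (1 / q)\<close>. The induction uses the Gibbs inequality
  with tilt 1 on the presence of each element.\<close>

lemma expected_card_le:
  fixes g :: "'a set \<Rightarrow> real"
  assumes "finite A" and p: "0 \<le> p" "p \<le> 1" and "\<And>T. g T \<in> {0, 1}"
  shows "prodE p A (\<lambda>T. g T * card T) - 2 * p * card A * prodE p A g \<le> - (prodE p A g * ln (prodE p A g))"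
  using assms(1,4)
proof (induction A arbitrary: g rule: finite_induct)
  case empty
  have "g {} = 0 \<or> g {} = 1" using empty.prems by auto
  then show ?case by auto
next
  case (insert e A)
  define g1 where "g1 = (\<lambda>T. g (insert e T))"
  define q0 q1 where "q0 = prodE p A g" and "q1 = prodE p A g1"
  define s0 s1 where "s0 = prodE p A (\<lambda>T. g T * card T)" and "s1 = prodE p A (\<lambda>T. g1 T * card T)"
  define q where "q = p * q1 + (1 - p) * q0"
  have g0: "0 \<le> g T" "0 \<le> g1 T" for T
    using insert.prems[of T] insert.prems[of "insert e T"] by (auto simp: g1_def)
  have q0: "0 \<le> q0" "0 \<le> q1" using p g0 by (auto simp: q0_def q1_def intro!: prodE_nonneg)
  have qn: "0 \<le> q" using p q0 by (simp add: q_def)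
  have IH0: "s0 - 2 * p * card A * q0 \<le> - (q0 * ln q0)"
    using insert.IH[OF insert.prems] by (simp add: s0_def q0_def)
  have IH1: "s1 - 2 * p * card A * q1 \<le> - (q1 * ln q1)"
    using insert.IH[of g1] insert.prems by (simp add: s1_def q1_def g1_def)
  have "prodE p A (\<lambda>T. g (insert e T) * card (insert e T)) = prodE p A (\<lambda>T. g1 T * card T + g1 T)"
  proof (rule prodE_cong)
    fix T assume "T \<subseteq> A"
    then have "finite T" "e \<notin> T" using insert.hyps by (auto intro: finite_subset)
    then show "g (insert e T) * card (insert e T) = g1 T * card T + g1 T"
      by (simp add: g1_def algebra_simps)
  qed
  then have s_eq: "prodE p (insert e A) (\<lambda>T. g T * card T) = p * (s1 + q1) + (1 - p) * s0"
    using insert.hyps by (simp add: prodE_insert prodE_add s0_def s1_def q1_def)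
  have q_eq: "prodE p (insert e A) g = q"
    using insert.hyps by (simp add: prodE_insert q_def q0_def q1_def g1_def)
  have "ln (p * exp 1 + (1 - p) * exp 0) \<le> 2 * p"
    using p bernoulli_exp_le[OF p(1)] by (intro ln_le_if_le_exp) (smt (verit) exp_gt_zero mult_nonneg_nonneg mult_pos_pos, simp)
  then have "q * ln (p * exp 1 + (1 - p) * exp 0) \<le> q * (2 * p)"
    using qn by (rule mult_left_mono)
  with gibbs_two_point[OF p q0, of 1 0]
  have ent: "p * q1 - q * (2 * p) \<le> p * q1 * ln q1 + (1 - p) * q0 * ln q0 - q * ln q"
    unfolding q_def by simp
  have "p * (s1 - 2 * p * card A * q1) \<le> p * (- (q1 * ln q1))"
       "(1 - p) * (s0 - 2 * p * card A * q0) \<le> (1 - p) * (- (q0 * ln q0))"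
    using IH0 IH1 p by (intro mult_left_mono; simp)+
  with ent show ?case
    unfolding s_eq q_eq using insert.hyps by (simp add: q_def algebra_simps)
qed

text \<open>
  A variant of Janson's inequality. The gain over the usual form is the factor \<open>p\<close> in the
  denominator, which is what admits \<open>p\<close> down to about \<open>n powr (-1/3)\<close>.
\<close>

lemma vanishing_probability_le:
  fixes X :: "'a set \<Rightarrow> real" and p a :: real
  assumes "finite A" and p: "0 < p" "p \<le> 1"
    and X: "antimono X" "\<And>e. antimono (decrement X e)" "\<And>T. 0 \<le> X T"
    and a: "\<And>e. e \<in> A \<Longrightarrow> prodE p A (\<lambda>T. (decrement X e T)\<^sup>2) \<le> a"
    and pos: "A \<noteq> {}" "0 < a" "0 < prodE p A X"
  shows "prodE p A (\<lambda>T. of_bool (X T = 0))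
       \<le> exp (- min (p * card A) ((prodE p A X)\<^sup>2 / (18 * p * card A * a)))"
proof -
  define g :: "'a set \<Rightarrow> real" where "g = (\<lambda>T. of_bool (X T = 0))"
  define \<mu> where "\<mu> = prodE p A X"
  define q where "q = prodE p A g"
  define V where "V = p * card A * a"
  have V: "V > 0" unfolding V_def using assms by (simp add: card_gt_0_iff)
  have \<mu>: "\<mu> > 0" using pos by (simp add: \<mu>_def)
  have p0: "0 \<le> p" using p by simp
  show ?thesis
  \<comment> \<open>If \<open>q\<close> is already below \<open>exp (- (p * card A))\<close>, the
    first branch of the minimum suffices. Otherwise \<open>ln (1 / q)\<close> is at most
    \<open>p * card A\<close>, and the conditioned set has expected size at most
    \<open>3 * p * card A\<close>.\<close>
  proof (cases "q \<le> exp (- (p * card A))")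
    case True
    also have "exp (- (p * card A)) \<le> exp (- min (p * card A) (\<mu>\<^sup>2 / (18 * p * card A * a)))" by simp
    finally show ?thesis by (simp add: q_def g_def \<mu>_def)
  next
    case False
    then have q: "q > 0" by (meson exp_gt_zero less_trans not_le)
    have "- (p * card A) < ln q" using False q by (metis exp_less_cancel_iff exp_ln not_le)
    then have qln: "- (q * ln q) \<le> q * (p * card A)"
      using q mult_left_mono[of "- ln q" "p * card A" q] by simp
    have g01: "g T \<in> {0, 1}" for T by (auto simp: g_def)
    have g: "mono g"
    proof (rule monoI)
      fix S T :: "'a set" assume "S \<subseteq> T"
      then have "X T \<le> X S" by (rule antimonoD[OF X(1)])
      then show "g S \<le> g T" using X(3)[of T] by (auto simp: g_def)
    qed
    have sumr: "(\<Sum>e\<in>A. prodE p A (\<lambda>T. g T * of_bool (e \<in> T))) = prodE p A (\<lambda>T. g T * card T)"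
    proof -
      have "(\<Sum>e\<in>A. of_bool (e \<in> T)) = real (card T)" if "T \<subseteq> A" for T
        using that \<open>finite A\<close> by (simp add: of_bool_def sum.If_cases Int_absorb1)
      then have "prodE p A (\<lambda>T. \<Sum>e\<in>A. g T * of_bool (e \<in> T)) = prodE p A (\<lambda>T. g T * card T)"
        by (intro prodE_cong) (simp add: sum_distrib_left[symmetric])
      then show ?thesis by (simp add: prodE_sum)
    qed
    have "prodE p A (\<lambda>T. g T * card T) \<le> 3 * p * card A * q"
      using expected_card_le[where g = g, OF \<open>finite A\<close> p0 p(2) g01] qln unfolding q_def by (simp add: algebra_simps)
    have r: "(\<Sum>e\<in>A. prodE p A (\<lambda>T. (decrement X e T)\<^sup>2) * prodE p A (\<lambda>T. g T * of_bool (e \<in> T))) \<le> 3 * V * q"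
    proof -
      have "(\<Sum>e\<in>A. prodE p A (\<lambda>T. (decrement X e T)\<^sup>2) * prodE p A (\<lambda>T. g T * of_bool (e \<in> T)))
          \<le> (\<Sum>e\<in>A. a * prodE p A (\<lambda>T. g T * of_bool (e \<in> T)))"
        using a p by (intro sum_mono mult_right_mono prodE_nonneg) (auto simp: g_def)
      also have "\<dots> = a * prodE p A (\<lambda>T. g T * card T)"
        unfolding sumr[symmetric] by (simp add: sum_distrib_left)
      also have "\<dots> \<le> a * (3 * p * card A * q)"
        using \<open>prodE p A (\<lambda>T. g T * card T) \<le> 3 * p * card A * q\<close> pos by (intro mult_left_mono) auto
      finally show ?thesis by (simp add: V_def mult_ac)
    qed
    have s: "(\<Sum>e\<in>A. prodE p A (\<lambda>T. (decrement X e T)\<^sup>2)) \<le> card A * a"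
      using sum_bounded_above[of A "\<lambda>e. prodE p A (\<lambda>T. (decrement X e T)\<^sup>2)" a] a by simp
    \<comment> \<open>With this threshold the charge \<open>3 * V * q / L\<close> is half of
      \<open>\<mu> * q\<close>. Taking \<open>l = 1 / L\<close>, the remaining gain is
      \<open>q\<close> times
      \<open>\<mu>^2 / (12 V) - \<mu>^2 / (36 V) = \<mu>^2 / (18 V)\<close>.\<close>
    define L where "L = 6 * V / \<mu>"
    define l where "l = \<mu> / (6 * V)"
    have L: "0 < L" "0 \<le> l" "l * L \<le> 1" using V \<mu> by (auto simp: L_def l_def)
    have "prodE p A (\<lambda>T. X T * g T) = 0"
    proof -
      have "prodE p A (\<lambda>T. X T * g T) = prodE p A (\<lambda>_. 0)" by (rule prodE_cong) (auto simp: g_def)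
      then show ?thesis using \<open>finite A\<close> by (simp add: prodE_const)
    qed
    then have main: "l * (\<mu> * q - 1 / L * (\<Sum>e\<in>A. prodE p A (\<lambda>T. (decrement X e T)\<^sup>2) * prodE p A (\<lambda>T. g T * of_bool (e \<in> T))))
          - l\<^sup>2 * p * q * (\<Sum>e\<in>A. prodE p A (\<lambda>T. (decrement X e T)\<^sup>2)) \<le> - (q * ln q)"
      using entropy_lower_bound[OF \<open>finite A\<close> p0 p(2) L X(1,2) g g01] by (simp add: \<mu>_def q_def)
    have "l * (\<mu> * q - 1 / L * (3 * V * q)) - l\<^sup>2 * p * q * (card A * a)
       \<le> l * (\<mu> * q - 1 / L * (\<Sum>e\<in>A. prodE p A (\<lambda>T. (decrement X e T)\<^sup>2) * prodE p A (\<lambda>T. g T * of_bool (e \<in> T))))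
          - l\<^sup>2 * p * q * (\<Sum>e\<in>A. prodE p A (\<lambda>T. (decrement X e T)\<^sup>2))"
      using r s L q p \<mu> by (intro diff_mono mult_left_mono) auto
    also note main
    finally have "l * (\<mu> * q - 1 / L * (3 * V * q)) - l\<^sup>2 * q * V \<le> - (q * ln q)"
      by (simp add: V_def mult_ac)
    moreover have "l * (\<mu> * q - 1 / L * (3 * V * q)) - l\<^sup>2 * q * V = q * (\<mu>\<^sup>2 / (18 * V))"
      using V \<mu> unfolding l_def L_def by (simp add: field_simps power2_eq_square)
    ultimately have "q * (\<mu>\<^sup>2 / (18 * V)) \<le> q * (- ln q)" by simp
    then have "\<mu>\<^sup>2 / (18 * V) \<le> - ln q" using q by (simp only: mult_le_cancel_left_pos)
    then have "q \<le> exp (- (\<mu>\<^sup>2 / (18 * V)))"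
      using q by (metis exp_le_cancel_iff exp_ln le_minus_iff)
    also have "\<dots> \<le> exp (- min (p * card A) (\<mu>\<^sup>2 / (18 * p * card A * a)))"
      by (simp add: V_def mult_ac)
    finally show ?thesis by (simp add: q_def g_def \<mu>_def)
  qed
qed

section \<open>Independent sets in random graphs\<close>

definition pairs :: "'a set \<Rightarrow> 'a set set" where
  "pairs S = {e. e \<subseteq> S \<and> card e = 2}"

lemma finite_pairs: "finite S \<Longrightarrow> finite (pairs S)"
  unfolding pairs_def by simp

lemma card_pairs: "finite S \<Longrightarrow> card (pairs S) = card S choose 2"
  unfolding pairs_def by (rule n_subsets)

lemma pairs_Int: "pairs I \<inter> pairs J = pairs (I \<inter> J)"
  by (auto simp: pairs_def)

lemma pairs_mono: "I \<subseteq> S \<Longrightarrow> pairs I \<subseteq> pairs S"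
  by (auto simp: pairs_def)

section \<open>Counting subsets by size and overlap\<close>

lemma card_supersets:
  assumes "finite S" "B \<subseteq> S" "card B \<le> k"
  shows "card {J. B \<subseteq> J \<and> J \<subseteq> S \<and> card J = k} = (card S - card B) choose (k - card B)"
proof -
  have fB: "finite B" using assms finite_subset by auto
  have "bij_betw (\<lambda>J. J - B) {J. B \<subseteq> J \<and> J \<subseteq> S \<and> card J = k} {C. C \<subseteq> S - B \<and> card C = k - card B}"
  proof (rule bij_betw_byWitness[where f' = "\<lambda>C. C \<union> B"])
    show "(\<lambda>J. J - B) ` {J. B \<subseteq> J \<and> J \<subseteq> S \<and> card J = k} \<subseteq> {C. C \<subseteq> S - B \<and> card C = k - card B}"
      using fB by (auto simp: card_Diff_subset)
    show "(\<lambda>C. C \<union> B) ` {C. C \<subseteq> S - B \<and> card C = k - card B} \<subseteq> {J. B \<subseteq> J \<and> J \<subseteq> S \<and> card J = k}"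
    proof safe
      fix C assume C: "C \<subseteq> S - B" "card C = k - card B"
      have "finite C" using C assms by (meson finite_Diff finite_subset)
      then show "card (C \<union> B) = k" using C fB assms by (subst card_Un_disjoint) auto
    qed (use assms in auto)
  qed auto
  then have "card {J. B \<subseteq> J \<and> J \<subseteq> S \<and> card J = k} = card {C. C \<subseteq> S - B \<and> card C = k - card B}"
    by (rule bij_betw_same_card)
  also have "\<dots> = card (S - B) choose (k - card B)" using assms by (intro n_subsets) auto
  finally show ?thesis using assms fB by (simp add: card_Diff_subset)
qed

lemma sum_over_card:
  fixes f :: "nat \<Rightarrow> real"
  assumes "finite S"
  shows "(\<Sum>C\<in>Pow S. f (card C)) = (\<Sum>i\<le>card S. (card S choose i) * f i)"
proof -
  have "(\<Sum>C\<in>Pow S. f (card C)) = (\<Sum>i\<le>card S. \<Sum>C\<in>{C\<in>Pow S. card C = i}. f (card C))"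
    using assms by (intro sum.group[symmetric]) (auto intro: card_mono)
  also have "\<dots> = (\<Sum>i\<le>card S. (card S choose i) * f i)"
  proof (rule sum.cong)
    fix i
    have "(\<Sum>C\<in>{C\<in>Pow S. card C = i}. f (card C)) = card {C. C \<subseteq> S \<and> card C = i} * f i" by simp
    then show "(\<Sum>C\<in>{C\<in>Pow S. card C = i}. f (card C)) = (card S choose i) * f i"
      using assms by (simp add: n_subsets)
  qed simp
  finally show ?thesis .
qed

lemma sum_over_interval_card:
  fixes f :: "nat \<Rightarrow> real"
  assumes "finite I" "e \<subseteq> I"
  shows "(\<Sum>B\<in>{B. e \<subseteq> B \<and> B \<subseteq> I}. f (card B))
       = (\<Sum>i\<le>card I - card e. ((card I - card e) choose i) * f (i + card e))"
proof -
  have fe: "finite e" using assms finite_subset by auto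
  have "(\<Sum>C\<in>Pow (I - e). f (card C + card e)) = (\<Sum>B\<in>{B. e \<subseteq> B \<and> B \<subseteq> I}. f (card B))"
  proof (rule sum.reindex_bij_witness[where i = "\<lambda>B. B - e" and j = "\<lambda>C. C \<union> e"])
    fix C assume "C \<in> Pow (I - e)"
    then have C: "C \<subseteq> I - e" by simp
    then have "finite C" using assms by (meson finite_Diff finite_subset)
    then show "f (card (C \<union> e)) = f (card C + card e)" using C fe by (subst card_Un_disjoint) auto
  qed (use assms in auto)
  also have "(\<Sum>C\<in>Pow (I - e). f (card C + card e))
      = (\<Sum>i\<le>card (I - e). (card (I - e) choose i) * f (i + card e))"
    using assms by (intro sum_over_card[where f = "\<lambda>i. f (i + card e)"]) auto
  finally show ?thesis using assms fe by (simp add: card_Diff_subset)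
qed

text \<open>The quotient of the binomials is the chance that a uniform \<open>k\<close>-subset of an
  \<open>m\<close>-set contains \<open>j\<close> given points; each further point contributes a
  factor \<open>(k - j) / (m - j)\<close>, at most \<open>k / m\<close>.\<close>

lemma choose_diff_le:
  assumes "k \<le> m" "j \<le> k"
  shows "real ((m - j) choose (k - j)) \<le> real (m choose k) * (real k / real m) ^ j"
  using assms(2)
proof (induction j)
  case (Suc j)
  then have j: "j < k" "j < m" using assms by auto
  have "Suc (k - Suc j) * ((m - j) choose Suc (k - Suc j)) = (m - j) * ((m - j - 1) choose (k - Suc j))"
    by (rule binomial_absorption)
  moreover have "Suc (k - Suc j) = k - j" "m - j - 1 = m - Suc j" using j by auto
  ultimately have "(k - j) * ((m - j) choose (k - j)) = (m - j) * ((m - Suc j) choose (k - Suc j))"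
    by simp
  then have "real (k - j) * real ((m - j) choose (k - j)) = real (m - j) * real ((m - Suc j) choose (k - Suc j))"
    by (metis of_nat_mult)
  then have "real ((m - Suc j) choose (k - Suc j)) = real ((m - j) choose (k - j)) * (real (k - j) / real (m - j))"
    using j by (simp add: field_simps)
  also have "\<dots> \<le> (real (m choose k) * (real k / real m) ^ j) * (real k / real m)"
  proof (rule mult_mono)
    have "real j * real k \<le> real j * real m" using assms by (intro mult_left_mono) auto
    then show "real (k - j) / real (m - j) \<le> real k / real m"
      using j by (simp add: field_simps of_nat_diff)
  qed (use Suc in auto)
  finally show ?case by (simp add: mult_ac)
qed simp

section \<open>Moments of the number of independent sets\<close>

definition indep_count :: "'a set \<Rightarrow> nat \<Rightarrow> 'a set set \<Rightarrow> real" where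
  "indep_count S k T = (\<Sum>I | I \<subseteq> S \<and> card I = k. of_bool (pairs I \<inter> T = {}))"

lemma antimono_indep_count: "antimono (indep_count S k)"
  unfolding indep_count_def by (intro antimonoI sum_mono) auto

lemma indep_count_nonneg: "0 \<le> indep_count S k T"
  unfolding indep_count_def by (intro sum_nonneg) auto

lemma indep_count_eq_0_iff:
  assumes "finite S"
  shows "indep_count S k T = 0 \<longleftrightarrow> (\<forall>I. I \<subseteq> S \<longrightarrow> card I = k \<longrightarrow> pairs I \<inter> T \<noteq> {})"
  unfolding indep_count_def using assms by (subst sum_nonneg_eq_0_iff) auto

text \<open>Adding \<open>e\<close> can only spoil the \<open>k\<close>-sets through
  \<open>e\<close>, and it spoils those whose other pairs all avoid \<open>T\<close>. As a sum of
  avoidance indicators the decrement is again antimonotone, and its second moment can be expanded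
  over two sets through \<open>e\<close>.\<close>

lemma decrement_indep_count:
  assumes "finite S"
  shows "decrement (indep_count S k) e T
       = (\<Sum>I | I \<subseteq> S \<and> card I = k \<and> e \<in> pairs I. of_bool ((pairs I - {e}) \<inter> T = {}))"
proof -
  have "decrement (indep_count S k) e T
     = (\<Sum>I | I \<subseteq> S \<and> card I = k. if e \<in> pairs I then of_bool ((pairs I - {e}) \<inter> T = {}) else 0)"
    unfolding decrement_def indep_count_def sum_subtractf[symmetric]
    by (intro sum.cong refl) (auto simp: of_bool_def)
  also have "\<dots> = (\<Sum>I \<in> {I \<in> {I. I \<subseteq> S \<and> card I = k}. e \<in> pairs I}. of_bool ((pairs I - {e}) \<inter> T = {}))"
    using assms by (intro sum.inter_filter[symmetric]) auto
  finally show ?thesis by (simp add: conj_assoc)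
qed

lemma antimono_decrement_indep_count:
  assumes "finite S"
  shows "antimono (decrement (indep_count S k) e)"
proof (rule antimonoI)
  fix T U :: "'a set set" assume "T \<subseteq> U"
  then have "of_bool ((pairs I - {e}) \<inter> U = {}) \<le> (of_bool ((pairs I - {e}) \<inter> T = {}) :: real)" for I
    by (simp add: of_bool_def) blast
  then show "decrement (indep_count S k) e U \<le> decrement (indep_count S k) e T"
    unfolding decrement_indep_count[OF assms] by (intro sum_mono)
qed

lemma prodE_indep_count:
  fixes p :: real
  assumes "finite S"
  shows "prodE p (pairs S) (indep_count S k) = (card S choose k) * (1 - p) ^ (k choose 2)"
proof -
  have "prodE p (pairs S) (indep_count S k) = (\<Sum>I | I \<subseteq> S \<and> card I = k. (1 - p) ^ (k choose 2))"
    unfolding indep_count_def prodE_sum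
  proof (rule sum.cong)
    fix I assume "I \<in> {I. I \<subseteq> S \<and> card I = k}"
    then have I: "I \<subseteq> S" "card I = k" "finite I" using assms finite_subset by auto
    show "prodE p (pairs S) (\<lambda>T. of_bool (pairs I \<inter> T = {})) = (1 - p) ^ (k choose 2)"
      using I assms by (simp add: prodE_avoid finite_pairs pairs_mono card_pairs)
  qed simp
  then show ?thesis using assms by (simp add: n_subsets)
qed

text \<open>Two \<open>k\<close>-sets \<open>I\<close>, \<open>J\<close> through \<open>e\<close>
  together have \<open>2 * (k choose 2)\<close> pairs minus those inside
  \<open>I \<inter> J\<close>, and \<open>e\<close> itself is exempt from avoidance. The index
  \<open>i\<close> stands for the number of common vertices outside \<open>e\<close>.\<close>

lemma prodE_decrement_indep_count:
  fixes p :: real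
  assumes S: "finite S" and e: "e \<in> pairs S" and p: "0 < p" "p < 1" and k: "2 \<le> k"
  shows "prodE p (pairs S) (\<lambda>T. (decrement (indep_count S k) e T)\<^sup>2)
    \<le> ((card S - 2) choose (k - 2)) * (1 - p) ^ (2 * (k choose 2)) *
      (\<Sum>i\<le>k - 2. ((k - 2) choose i) * (((card S - (i + 2)) choose (k - (i + 2))) * (1 / (1 - p)) ^ (((i + 2) choose 2) + 1)))"
proof -
  define F where "F = {I. I \<subseteq> S \<and> card I = k \<and> e \<in> pairs I}"
  define \<beta> where "\<beta> = 1 / (1 - p)"
  \<comment> \<open>Correction for \<open>j\<close> common vertices relative to two disjoint
    requirements: \<open>j choose 2\<close> shared pairs, and one more for \<open>e\<close>.\<close>
  define h where "h = (\<lambda>j. \<beta> ^ ((j choose 2) + 1))"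
  have \<beta>: "\<beta> > 0" using p by (simp add: \<beta>_def)
  have h0: "0 \<le> h j" for j unfolding h_def using \<beta> by simp
  have ce: "card e = 2" "e \<subseteq> S" "finite e" using e S by (auto simp: pairs_def finite_subset)
  have F_alt: "F = {I. e \<subseteq> I \<and> I \<subseteq> S \<and> card I = k}" using ce by (auto simp: F_def pairs_def)
  have finF: "finite F" using S by (simp add: F_def)
  have cardF: "card F = (card S - 2) choose (k - 2)"
    unfolding F_alt using card_supersets[OF S ce(2), of k] k ce by simp
  have pr: "prodE p (pairs S) (\<lambda>T. of_bool ((pairs I - {e}) \<inter> T = {}) * of_bool ((pairs J - {e}) \<inter> T = {}))
      = (1 - p) ^ (2 * (k choose 2)) * h (card (I \<inter> J))" if IJ: "I \<in> F" "J \<in> F" for I J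
  proof -
    have I: "I \<subseteq> S" "card I = k" "e \<in> pairs I" "finite I" and J: "J \<subseteq> S" "card J = k" "e \<in> pairs J" "finite J"
      using IJ S by (auto simp: F_def finite_subset)
    have "prodE p (pairs S) (\<lambda>T. of_bool ((pairs I - {e}) \<inter> T = {}) * of_bool ((pairs J - {e}) \<inter> T = {}))
      = prodE p (pairs S) (\<lambda>T. of_bool ((pairs I \<union> pairs J - {e}) \<inter> T = {}))"
      by (intro prodE_cong) (auto simp: of_bool_def)
    also have "\<dots> = (1 - p) ^ card (pairs I \<union> pairs J - {e})"
      using S I J pairs_mono[of I S] pairs_mono[of J S] by (intro prodE_avoid finite_pairs) auto
    finally have 1: "prodE p (pairs S) (\<lambda>T. of_bool ((pairs I - {e}) \<inter> T = {}) * of_bool ((pairs J - {e}) \<inter> T = {}))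
      = (1 - p) ^ card (pairs I \<union> pairs J - {e})" .
    have "card (pairs I) + card (pairs J) = card (pairs I \<union> pairs J) + card (pairs I \<inter> pairs J)"
      using I J by (intro card_Un_Int finite_pairs)
    then have "2 * (k choose 2) = card (pairs I \<union> pairs J) + (card (I \<inter> J) choose 2)"
      using I J by (simp add: pairs_Int card_pairs)
    moreover have "card (pairs I \<union> pairs J) = Suc (card (pairs I \<union> pairs J - {e}))"
      using I J by (intro card.remove) (auto simp: finite_pairs)
    ultimately have "2 * (k choose 2) = card (pairs I \<union> pairs J - {e}) + ((card (I \<inter> J) choose 2) + 1)"
      by simp
    then have "(1 - p) ^ (2 * (k choose 2)) * h (card (I \<inter> J))
        = (1 - p) ^ card (pairs I \<union> pairs J - {e}) * ((1 - p) * \<beta>) ^ ((card (I \<inter> J) choose 2) + 1)"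
      unfolding h_def by (simp only: power_add power_mult_distrib mult_ac)
    also have "(1 - p) * \<beta> = 1" using p by (simp add: \<beta>_def)
    finally show ?thesis using 1 by simp
  qed
  have inner: "(\<Sum>J\<in>F. h (card (I \<inter> J)))
      \<le> (\<Sum>i\<le>k - 2. ((k - 2) choose i) * (((card S - (i + 2)) choose (k - (i + 2))) * h (i + 2)))"
    if IF: "I \<in> F" for I
  proof -
    have I: "I \<subseteq> S" "card I = k" "e \<subseteq> I" "finite I" using IF S by (auto simp: F_alt finite_subset)
    define \<B> where "\<B> = {B. e \<subseteq> B \<and> B \<subseteq> I}"
    have finB: "finite \<B>" using I by (simp add: \<B>_def)
    \<comment> \<open>Summing over all \<open>B \<subseteq> I \<inter> J\<close> that contain
      \<open>e\<close>, and not only over \<open>B = I \<inter> J\<close>, overcounts but leaves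
      plain binomial coefficients.\<close>
    have "(\<Sum>J\<in>F. h (card (I \<inter> J))) \<le> (\<Sum>J\<in>F. \<Sum>B\<in>\<B>. of_bool (B \<subseteq> J) * h (card B))"
    proof (rule sum_mono)
      fix J assume "J \<in> F"
      then have "I \<inter> J \<in> \<B>" using I by (auto simp: \<B>_def F_alt)
      then have "of_bool (I \<inter> J \<subseteq> J) * h (card (I \<inter> J)) \<le> (\<Sum>B\<in>\<B>. of_bool (B \<subseteq> J) * h (card B))"
        using finB h0 by (intro member_le_sum) auto
      then show "h (card (I \<inter> J)) \<le> (\<Sum>B\<in>\<B>. of_bool (B \<subseteq> J) * h (card B))" by simp
    qed
    also have "\<dots> = (\<Sum>B\<in>\<B>. \<Sum>J\<in>F. of_bool (B \<subseteq> J) * h (card B))" by (rule sum.swap)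
    also have "\<dots> = (\<Sum>B\<in>\<B>. ((card S - card B) choose (k - card B)) * h (card B))"
    proof (rule sum.cong)
      fix B assume "B \<in> \<B>"
      then have B: "e \<subseteq> B" "B \<subseteq> I" by (auto simp: \<B>_def)
      have "(\<Sum>J\<in>F. of_bool (B \<subseteq> J) * h (card B)) = card {J\<in>F. B \<subseteq> J} * h (card B)"
        using finF by (simp add: sum_distrib_right[symmetric] of_bool_def sum.If_cases Int_def)
      also have "{J\<in>F. B \<subseteq> J} = {J. B \<subseteq> J \<and> J \<subseteq> S \<and> card J = k}" using B by (auto simp: F_alt)
      also have "card \<dots> = (card S - card B) choose (k - card B)"
        using S I B card_mono[OF I(4) B(2)] by (intro card_supersets) auto
      finally show "(\<Sum>J\<in>F. of_bool (B \<subseteq> J) * h (card B)) = ((card S - card B) choose (k - card B)) * h (card B)" .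
    qed simp
    also have "\<dots> = (\<Sum>i\<le>card I - card e. ((card I - card e) choose i) *
        (((card S - (i + card e)) choose (k - (i + card e))) * h (i + card e)))"
      unfolding \<B>_def using I by (intro sum_over_interval_card[where f = "\<lambda>j. ((card S - j) choose (k - j)) * h j"]) auto
    finally show ?thesis using I ce by simp
  qed
  have "prodE p (pairs S) (\<lambda>T. (decrement (indep_count S k) e T)\<^sup>2)
      = (\<Sum>I\<in>F. \<Sum>J\<in>F. prodE p (pairs S) (\<lambda>T. of_bool ((pairs I - {e}) \<inter> T = {}) * of_bool ((pairs J - {e}) \<inter> T = {})))"
    unfolding decrement_indep_count[OF S] F_def[symmetric] power2_eq_square sum_product prodE_sum ..
  also have "\<dots> = (\<Sum>I\<in>F. (1 - p) ^ (2 * (k choose 2)) * (\<Sum>J\<in>F. h (card (I \<inter> J))))"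
    by (intro sum.cong refl) (simp add: pr sum_distrib_left)
  also have "\<dots> \<le> (\<Sum>I\<in>F. (1 - p) ^ (2 * (k choose 2)) *
      (\<Sum>i\<le>k - 2. ((k - 2) choose i) * (((card S - (i + 2)) choose (k - (i + 2))) * h (i + 2))))"
    using p inner by (intro sum_mono mult_left_mono) auto
  also have "\<dots> = ((card S - 2) choose (k - 2)) * (1 - p) ^ (2 * (k choose 2)) *
      (\<Sum>i\<le>k - 2. ((k - 2) choose i) * (((card S - (i + 2)) choose (k - (i + 2))) * h (i + 2)))"
    by (simp add: cardF)
  finally show ?thesis unfolding h_def \<beta>_def .
qed

lemma choose_2_real: "2 * real (k choose 2) = real k * (real k - 1)"
proof (cases k)
  case (Suc j)
  have "even (k * (k - 1))" using Suc by simp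
  then have "2 * (k choose 2) = k * (k - 1)" unfolding choose_two by (rule dvd_mult_div_cancel)
  then have "real (2 * (k choose 2)) = real (k * (k - 1))" by (rule arg_cong)
  then show ?thesis using Suc by (simp only: of_nat_mult of_nat_numeral diff_Suc_1) simp
qed simp

lemma choose_2_le: "2 * real (k choose 2) \<le> (real k)\<^sup>2"
  unfolding choose_2_real by (simp add: power2_eq_square algebra_simps)

lemma choose_2_shift: "((i + 2) choose 2) + 1 = i * (i + 3) div 2 + 2"
proof -
  have "(i + 2) choose 2 = (i + 2) * (i + 1) div 2" by (simp add: choose_two)
  also have "(i + 2) * (i + 1) = i * (i + 3) + 2" by (simp add: algebra_simps)
  finally show ?thesis by simp
qed

text \<open>The hypothesis \<open>small\<close> makes the overlap sum geometric, so its order is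
  that of the term for sets meeting in \<open>e\<close> only. The squared mean over the second
  moment then collapses to \<open>m^2 / (p k^4)\<close> up to the factor
  \<open>(1 - p)^2 / 18\<close>.\<close>

lemma no_independent_set_probability_le:
  fixes p :: real
  assumes S: "finite S" "card S = m" and k: "2 \<le> k" "k \<le> m" and p: "0 < p" "p < 1"
    and small: "\<And>i. 1 \<le> i \<Longrightarrow> i \<le> k - 2 \<Longrightarrow>
      real ((k - 2) choose i) * (real k / real m) ^ i * (1 / (1 - p)) ^ (i * (i + 3) div 2) \<le> (1/2) ^ i"
  shows "prodE p (pairs S) (\<lambda>T. of_bool (\<forall>I. I \<subseteq> S \<longrightarrow> card I = k \<longrightarrow> pairs I \<inter> T \<noteq> {}))
    \<le> exp (- min (p * (m choose 2)) (real m ^ 2 * (1 - p) ^ 2 / (18 * p * real k ^ 4)))"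
proof -
  define \<beta> where "\<beta> = 1 / (1 - p)"
  define Y where "Y = (\<Sum>i\<le>k - 2. ((k - 2) choose i) * (((m - (i + 2)) choose (k - (i + 2))) * \<beta> ^ (((i + 2) choose 2) + 1)))"
  define a where "a = ((m - 2) choose (k - 2)) * (1 - p) ^ (2 * (k choose 2)) * Y"
  have \<beta>: "\<beta> > 0" using p by (simp add: \<beta>_def)
  have Y0: "Y > 0"
  proof -
    have "0 < ((k - 2) choose 0) * (((m - (0 + 2)) choose (k - (0 + 2))) * \<beta> ^ (((0 + 2) choose 2) + 1))"
      using \<beta> k by simp
    also have "\<dots> \<le> Y" unfolding Y_def using \<beta>
      by (intro member_le_sum[where f = "\<lambda>i. ((k - 2) choose i) * (((m - (i + 2)) choose (k - (i + 2))) * \<beta> ^ (((i + 2) choose 2) + 1))"]) auto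
    finally show ?thesis .
  qed
  have a0: "a > 0" using Y0 p k by (simp add: a_def)
  have N0: "m choose 2 > 0" using k by simp
  have "prodE p (pairs S) (\<lambda>T. of_bool (indep_count S k T = 0))
      \<le> exp (- min (p * card (pairs S)) ((prodE p (pairs S) (indep_count S k))\<^sup>2 / (18 * p * card (pairs S) * a)))"
  proof (rule vanishing_probability_le)
    show "prodE p (pairs S) (\<lambda>T. (decrement (indep_count S k) e T)\<^sup>2) \<le> a" if "e \<in> pairs S" for e
      using prodE_decrement_indep_count[OF S(1) that p k(1)] by (simp add: a_def Y_def \<beta>_def S)
    show "pairs S \<noteq> {}" using N0 S card_pairs[OF S(1)] by force
    show "0 < prodE p (pairs S) (indep_count S k)" using p k S by (simp add: prodE_indep_count)
  qed (use S p a0 in \<open>auto simp: finite_pairs antimono_indep_count antimono_decrement_indep_count indep_count_nonneg\<close>)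
  also have "(prodE p (pairs S) (indep_count S k))\<^sup>2 / (18 * p * card (pairs S) * a)
      = (m choose k) / (18 * p * (k choose 2) * Y)"
  proof -
    \<comment> \<open>Double counting of the \<open>k\<close>-sets with a marked pair; it cancels
      one factor \<open>m choose k\<close> of the squared mean.\<close>
    have "(m choose k) * (k choose 2) = (m choose 2) * ((m - 2) choose (k - 2))"
      using k by (intro choose_mult) auto
    then have *: "real (m choose k) * real (k choose 2) = real (m choose 2) * real ((m - 2) choose (k - 2))"
      by (metis of_nat_mult)
    have pw: "((1 - p) ^ (k choose 2))\<^sup>2 = (1 - p) ^ (2 * (k choose 2))"
      by (simp add: power_mult[symmetric] mult.commute)
    have "(prodE p (pairs S) (indep_count S k))\<^sup>2 / (18 * p * card (pairs S) * a)
       = (real (m choose k) ^ 2 * (1 - p) ^ (2 * (k choose 2))) / (18 * p * Y * (1 - p) ^ (2 * (k choose 2)) * (real (m choose 2) * real ((m - 2) choose (k - 2))))"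
      using S by (simp add: prodE_indep_count card_pairs power_mult_distrib pw a_def mult_ac)
    also have "\<dots> = (real (m choose k) ^ 2 * (1 - p) ^ (2 * (k choose 2))) / (18 * p * Y * (1 - p) ^ (2 * (k choose 2)) * (real (m choose k) * real (k choose 2)))"
      by (simp only: *)
    also have "\<dots> = (m choose k) / (18 * p * (k choose 2) * Y)"
      using p k Y0 by (simp add: field_simps power2_eq_square)
    finally show ?thesis .
  qed
  also have "exp (- min (p * card (pairs S)) ((m choose k) / (18 * p * (k choose 2) * Y)))
      \<le> exp (- min (p * (m choose 2)) (real m ^ 2 * (1 - p) ^ 2 / (18 * p * real k ^ 4)))"
  proof -
    \<comment> \<open>The factor in front is the term \<open>i = 0\<close> after
      \<open>choose_diff_le\<close>; the final 2 is the geometric series of ratio 1/2.\<close>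
    have Yle: "Y \<le> real (m choose k) * (real k / real m)\<^sup>2 * \<beta>\<^sup>2 * 2"
    proof -
      have "Y \<le> (\<Sum>i\<le>k - 2. real (m choose k) * (real k / real m)\<^sup>2 * \<beta>\<^sup>2 * (1/2) ^ i)"
        unfolding Y_def
      proof (rule sum_mono)
        fix i assume "i \<in> {..k - 2}"
        then have i: "i \<le> k - 2" "i + 2 \<le> k" using k by auto
        have "real ((k - 2) choose i) * (real ((m - (i + 2)) choose (k - (i + 2))) * \<beta> ^ (((i + 2) choose 2) + 1))
          \<le> real ((k - 2) choose i) * ((real (m choose k) * (real k / real m) ^ (i + 2)) * \<beta> ^ (((i + 2) choose 2) + 1))"
          using \<beta> k i by (intro mult_left_mono mult_right_mono choose_diff_le) auto
        also have "\<dots> = real (m choose k) * (real k / real m)\<^sup>2 * \<beta>\<^sup>2 *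
            (real ((k - 2) choose i) * (real k / real m) ^ i * \<beta> ^ (i * (i + 3) div 2))"
          unfolding choose_2_shift by (simp only: power_add mult_ac)
        also have "\<dots> \<le> real (m choose k) * (real k / real m)\<^sup>2 * \<beta>\<^sup>2 * (1/2) ^ i"
        proof (rule mult_left_mono)
          show "real ((k - 2) choose i) * (real k / real m) ^ i * \<beta> ^ (i * (i + 3) div 2) \<le> (1/2) ^ i"
            using small[of i] i unfolding \<beta>_def by (cases "i = 0") auto
        qed simp
        finally show "real ((k - 2) choose i) * (real ((m - (i + 2)) choose (k - (i + 2))) * \<beta> ^ (((i + 2) choose 2) + 1))
          \<le> real (m choose k) * (real k / real m)\<^sup>2 * \<beta>\<^sup>2 * (1/2) ^ i" .
      qed
      also have "\<dots> = real (m choose k) * (real k / real m)\<^sup>2 * \<beta>\<^sup>2 * (\<Sum>i\<le>k - 2. (1/2) ^ i)"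
        by (simp add: sum_distrib_left)
      also have "\<dots> \<le> real (m choose k) * (real k / real m)\<^sup>2 * \<beta>\<^sup>2 * 2"
      proof (rule mult_left_mono)
        have "(\<Sum>i\<le>k - 2. (1/2) ^ i) \<le> (\<Sum>i. (1/2) ^ i :: real)"
          by (intro sum_le_suminf summable_geometric) auto
        then show "(\<Sum>i\<le>k - 2. (1/2) ^ i) \<le> (2::real)" by (simp add: suminf_geometric)
      qed simp
      finally show ?thesis .
    qed
    have c2: "real (k choose 2) \<le> real k ^ 2 / 2" using choose_2_le[of k] by simp
    have "real (k choose 2) * Y \<le> (real k ^ 2 / 2) * (real (m choose k) * (real k / real m)\<^sup>2 * \<beta>\<^sup>2 * 2)"
      using c2 Yle Y0 by (intro mult_mono) auto
    also have "\<dots> = real (m choose k) * real k ^ 4 * \<beta>\<^sup>2 / real m ^ 2"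
      by (simp add: field_simps power_divide)
    finally have Z: "real (k choose 2) * Y \<le> real (m choose k) * real k ^ 4 * \<beta>\<^sup>2 / real m ^ 2" .
    have kc: "real (k choose 2) > 0" using k by simp
    have "real m ^ 2 * (1 - p) ^ 2 / (18 * p * real k ^ 4)
       = (m choose k) / (18 * p * (real (m choose k) * real k ^ 4 * \<beta>\<^sup>2 / real m ^ 2))"
      using k p by (simp add: \<beta>_def field_simps)
    also have "\<dots> \<le> (m choose k) / (18 * p * (real (k choose 2) * Y))"
      using Z p kc Y0 less_le_trans[OF mult_pos_pos[OF kc Y0] Z]
      by (intro divide_left_mono mult_left_mono mult_pos_pos) auto
    finally have "real m ^ 2 * (1 - p) ^ 2 / (18 * p * real k ^ 4) \<le> (m choose k) / (18 * p * (k choose 2) * Y)"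
      by (simp add: mult_ac)
    then show ?thesis using S by (simp add: card_pairs min.coboundedI2 min_le_iff_disj)
  qed
  finally show ?thesis unfolding indep_count_eq_0_iff[OF S(1)] .
qed

section \<open>The painting game\<close>

lemma independent_in_iff:
  assumes "E \<subseteq> pairs V"
  shows "independent_in E I \<longleftrightarrow> pairs I \<inter> E = {}"
proof
  assume I: "independent_in E I"
  show "pairs I \<inter> E = {}"
  proof (rule ccontr)
    assume "pairs I \<inter> E \<noteq> {}"
    then obtain e where e: "e \<in> pairs I" "e \<in> E" by auto
    then obtain u v where "e = {u, v}" by (auto simp: pairs_def card_2_iff)
    then show False using I e by (auto simp: independent_in_def pairs_def)
  qed
next
  assume I: "pairs I \<inter> E = {}"
  show "independent_in E I"
    unfolding independent_in_def
  proof (intro ballI notI)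
    fix u v assume "u \<in> I" "v \<in> I" "{u, v} \<in> E"
    then have "{u, v} \<in> pairs I \<inter> E" using assms by (auto simp: pairs_def)
    then show False using I by simp
  qed
qed

lemma no_loops: "E \<subseteq> pairs V \<Longrightarrow> {v} \<notin> E"
  by (auto simp: pairs_def)

section \<open>Chromatic number and paintability\<close>

lemma colouring_exists:
  assumes "finite V" "E \<subseteq> pairs V"
  shows "\<exists>c. c ` V \<subseteq> {..<card V} \<and> proper_colouring V E c"
proof -
  obtain c where c: "bij_betw c V {..<card V}"
    using ex_bij_betw_finite_nat[OF assms(1)] by (auto simp: atLeast0LessThan)
  have "proper_colouring V E c"
    unfolding proper_colouring_def
  proof (intro ballI impI notI)
    fix u v assume "u \<in> V" "v \<in> V" "{u, v} \<in> E" "c u = c v"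
    then have "u = v" using c by (auto simp: bij_betw_def inj_on_def)
    then show False using \<open>{u, v} \<in> E\<close> no_loops[OF assms(2), of v] by simp
  qed
  then show ?thesis using c by (auto simp: bij_betw_def)
qed

text \<open>Mr. Paint forces a colouring by painting all remaining vertices in every round.\<close>

lemma correct_wins_imp_colouring:
  assumes "correct_wins E U r" "\<forall>v\<in>U. r v \<le> j"
  shows "\<exists>c. c ` U \<subseteq> {..j} \<and> proper_colouring U E c"
  using assms
proof (induction arbitrary: j rule: correct_wins.induct)
  case (1 U r)
  show ?case
  proof (cases "U = {}")
    case True
    then show ?thesis by (auto simp: proper_colouring_def)
  next
    case False
    then obtain K where K: "legal_reply E r U K"
      and IH: "\<And>j. \<forall>v\<in>U - K. use_erasers (U - K) r v \<le> j \<Longrightarrow>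
          \<exists>c. c ` (U - K) \<subseteq> {..j} \<and> proper_colouring (U - K) E c"
      using "1.IH"[of U] by blast
    have KU: "K \<subseteq> U" and ind: "independent_in E K" and pos: "\<forall>v\<in>U - K. r v > 0"
      using K by (auto simp: legal_reply_def)
    show ?thesis
    proof (cases "U - K = {}")
      case True
      then have "U = K" using KU by auto
      then have "(\<lambda>_. 0) ` U \<subseteq> {..j} \<and> proper_colouring U E (\<lambda>_. 0)"
        using ind by (auto simp: proper_colouring_def independent_in_def)
      then show ?thesis by blast
    next
      case False
      then obtain w where "w \<in> U - K" by auto
      then have j: "j \<ge> 1" using pos "1.prems" by force
      have "\<forall>v\<in>U - K. use_erasers (U - K) r v \<le> j - 1"
        using "1.prems" by (auto simp: use_erasers_def intro: diff_le_mono)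
      then obtain c where c: "c ` (U - K) \<subseteq> {..j - 1}" "proper_colouring (U - K) E c"
        using IH by blast
      \<comment> \<open>The kept set receives the top colour \<open>j\<close>. Every other vertex
        has spent an eraser, so the induction hypothesis colours the rest with at most
        \<open>j - 1\<close>.\<close>
      define d where "d = (\<lambda>v. if v \<in> K then j else c v)"
      have less: "c v < j" if "v \<in> U - K" for v
      proof -
        have "c v \<le> j - 1" using c(1) that by auto
        then show ?thesis using j by simp
      qed
      then have "d ` U \<subseteq> {..j}" by (auto simp: d_def intro: less_imp_le)
      moreover have "proper_colouring U E d"
        unfolding proper_colouring_def
      proof (intro ballI impI)
        fix u v assume uv: "u \<in> U" "v \<in> U" "{u, v} \<in> E"
        have "\<not> (u \<in> K \<and> v \<in> K)" using ind uv by (auto simp: independent_in_def)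
        moreover have "c u \<noteq> c v" if "u \<notin> K" "v \<notin> K"
          using that c(2) uv by (auto simp: proper_colouring_def)
        ultimately show "d u \<noteq> d v" using less[of u] less[of v] uv by (auto simp: d_def)
      qed
      ultimately show ?thesis by blast
    qed
  qed
qed

lemma chromatic_number_le_paintability:
  assumes "finite V" "V \<noteq> {}" "E \<subseteq> pairs V"
  shows "chromatic_number V E \<le> paintability V E"
proof -
  have "paintable V E (card V)" using assms no_loops[OF assms(3)] by (intro paintable_card)
  then have P: "paintable V E (paintability V E)" unfolding paintability_def by (rule LeastI)
  then obtain c where "c ` V \<subseteq> {..paintability V E - 1}" "proper_colouring V E c"
    using correct_wins_imp_colouring[of E V "\<lambda>_. paintability V E - 1" "paintability V E - 1"]
    by (auto simp: paintable_def)
  moreover have "{..paintability V E - 1} = {..<paintability V E}"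
    using P by (auto simp: paintable_def)
  ultimately show ?thesis unfolding chromatic_number_def by (intro Least_le) auto
qed

text \<open>A colour class with \<open>k\<close> or more vertices would contain an independent set
  of size exactly \<open>k\<close>.\<close>

lemma card_le_chromatic_number:
  assumes "finite V" "E \<subseteq> pairs V"
    and no_indep: "\<And>I. I \<subseteq> V \<Longrightarrow> card I = k \<Longrightarrow> \<not> independent_in E I"
  shows "card V \<le> chromatic_number V E * (k - 1)"
proof -
  obtain c where c: "c ` V \<subseteq> {..<chromatic_number V E}" "proper_colouring V E c"
    using LeastI_ex[of "\<lambda>k. \<exists>c. c ` V \<subseteq> {..<k} \<and> proper_colouring V E c"] colouring_exists[OF assms(1,2)]
    unfolding chromatic_number_def by blast
  have "card {v \<in> V. c v = j} \<le> k - 1" for j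
  proof (rule ccontr)
    assume "\<not> card {v \<in> V. c v = j} \<le> k - 1"
    then have "k \<le> card {v \<in> V. c v = j}" by simp
    then obtain I where I: "I \<subseteq> {v \<in> V. c v = j}" "card I = k"
      using obtain_subset_with_card_n by metis
    then have "independent_in E I"
      using c(2) unfolding independent_in_def proper_colouring_def by blast
    then show False using no_indep I by blast
  qed
  then have "(\<Sum>j<chromatic_number V E. card {v \<in> V. c v = j}) \<le> (\<Sum>j<chromatic_number V E. k - 1)"
    by (intro sum_mono)
  moreover have "(\<Sum>j<chromatic_number V E. card {v \<in> V. c v = j}) = card V"
    using sum.group[of V "{..<chromatic_number V E}" c "\<lambda>_. 1::nat"] assms c by simp
  ultimately show ?thesis by simp
qed

section \<open>Colouring sparse graphs\<close>

lemma sum_degrees: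
  assumes "finite U" "E \<subseteq> pairs V"
  shows "(\<Sum>v\<in>U. card {w \<in> U. {v, w} \<in> E}) = 2 * card (E \<inter> pairs U)"
proof -
  have fin: "finite (E \<inter> pairs U)" using assms finite_pairs by auto
  have "card {w \<in> U. {v, w} \<in> E} = (\<Sum>e\<in>E \<inter> pairs U. of_bool (v \<in> e))" if v: "v \<in> U" for v
  proof -
    have "bij_betw (\<lambda>w. {v, w}) {w \<in> U. {v, w} \<in> E} {e \<in> E \<inter> pairs U. v \<in> e}"
    proof (rule bij_betw_imageI)
      show "inj_on (\<lambda>w. {v, w}) {w \<in> U. {v, w} \<in> E}"
        by (auto simp: inj_on_def doubleton_eq_iff)
      show "(\<lambda>w. {v, w}) ` {w \<in> U. {v, w} \<in> E} = {e \<in> E \<inter> pairs U. v \<in> e}"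
      proof (intro equalityI subsetI)
        fix e assume "e \<in> (\<lambda>w. {v, w}) ` {w \<in> U. {v, w} \<in> E}"
        then show "e \<in> {e \<in> E \<inter> pairs U. v \<in> e}" using v assms(2) by (auto simp: pairs_def)
      next
        fix e assume e: "e \<in> {e \<in> E \<inter> pairs U. v \<in> e}"
        then obtain x y where "e = {x, y}" by (auto simp: pairs_def card_2_iff)
        then obtain w where w: "e = {v, w}" using e by auto
        then have "w \<in> U" "{v, w} \<in> E" using e by (auto simp: pairs_def)
        then show "e \<in> (\<lambda>w. {v, w}) ` {w \<in> U. {v, w} \<in> E}" using w by blast
      qed
    qed
    then have "card {w \<in> U. {v, w} \<in> E} = card {e \<in> E \<inter> pairs U. v \<in> e}" by (rule bij_betw_same_card)
    then show ?thesis using fin by (simp add: of_bool_def sum.If_cases Int_def)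
  qed
  then have "(\<Sum>v\<in>U. card {w \<in> U. {v, w} \<in> E}) = (\<Sum>v\<in>U. \<Sum>e\<in>E \<inter> pairs U. of_bool (v \<in> e))"
    by simp
  also have "\<dots> = (\<Sum>e\<in>E \<inter> pairs U. \<Sum>v\<in>U. of_bool (v \<in> e))" by (rule sum.swap)
  also have "\<dots> = (\<Sum>e\<in>E \<inter> pairs U. 2)"
  proof (rule sum.cong)
    fix e assume "e \<in> E \<inter> pairs U"
    then have "e \<subseteq> U" "card e = 2" by (auto simp: pairs_def)
    then show "(\<Sum>v\<in>U. of_bool (v \<in> e)) = (2::nat)"
      using assms(1) by (simp add: of_bool_def sum.If_cases Int_absorb1)
  qed simp
  finally show ?thesis by simp
qed

text \<open>By averaging, sparsity gives a vertex of degree at most \<open>D\<close>. Deleting it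
  preserves sparsity, and among \<open>D + 1\<close> colours one remains free for it.\<close>

lemma degenerate_colouring:
  assumes "finite U" "E \<subseteq> pairs V"
    and sparse: "\<And>W. W \<subseteq> U \<Longrightarrow> 2 * card (E \<inter> pairs W) \<le> D * card W"
  shows "\<exists>c. c ` U \<subseteq> {..<Suc D} \<and> proper_colouring U E c"
  using assms(1,3)
proof (induction "card U" arbitrary: U)
  case 0
  then show ?case by (auto simp: proper_colouring_def)
next
  case (Suc n)
  obtain v where v: "v \<in> U" "card {w \<in> U. {v, w} \<in> E} \<le> D"
  proof (rule ccontr)
    assume "\<not> thesis"
    then have "\<And>v. v \<in> U \<Longrightarrow> Suc D \<le> card {w \<in> U. {v, w} \<in> E}" using that by force
    then have "(\<Sum>v\<in>U. Suc D) \<le> (\<Sum>v\<in>U. card {w \<in> U. {v, w} \<in> E})" by (rule sum_mono)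
    then have "card U * Suc D \<le> D * card U"
      using Suc.prems(2)[of U] sum_degrees[OF Suc.prems(1) assms(2)] by (simp add: mult.commute)
    then show False using Suc.hyps(2) by simp
  qed
  have "\<exists>c. c ` (U - {v}) \<subseteq> {..<Suc D} \<and> proper_colouring (U - {v}) E c"
    using Suc.hyps(2) Suc.prems v by (intro Suc.hyps(1)) auto
  then obtain c where c: "c ` (U - {v}) \<subseteq> {..<Suc D}" "proper_colouring (U - {v}) E c" by blast
  have "card (c ` {w \<in> U. {v, w} \<in> E}) < card {..<Suc D}"
    using v Suc.prems(1) card_image_le[of "{w \<in> U. {v, w} \<in> E}" c] by simp
  moreover have "finite (c ` {w \<in> U. {v, w} \<in> E})" using Suc.prems(1) by simp
  ultimately have "\<not> {..<Suc D} \<subseteq> c ` {w \<in> U. {v, w} \<in> E}"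
    by (meson card_mono leD)
  then obtain j where j: "j < Suc D" "j \<notin> c ` {w \<in> U. {v, w} \<in> E}" by blast
  have vv: "{v} \<notin> E" using no_loops[OF assms(2)] .
  have "(c(v := j)) ` U \<subseteq> {..<Suc D}" using c(1) j by auto
  moreover have "proper_colouring U E (c(v := j))"
    unfolding proper_colouring_def
  proof (intro ballI impI)
    fix x y assume xy: "x \<in> U" "y \<in> U" "{x, y} \<in> E"
    consider "x = v" "y = v" | "x = v" "y \<noteq> v" | "x \<noteq> v" "y = v" | "x \<noteq> v" "y \<noteq> v" by blast
    then show "(c(v := j)) x \<noteq> (c(v := j)) y"
    proof cases
      case 1 then show ?thesis using vv xy by simp
    next
      case 2 then show ?thesis using j(2) xy by auto
    next
      case 3 then show ?thesis using j(2) xy by (auto simp: insert_commute)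
    next
      case 4 then show ?thesis using c(2) xy by (auto simp: proper_colouring_def)
    qed
  qed
  ultimately show ?case by blast
qed

section \<open>The weighted strategy of Mrs. Correct\<close>

lemma heavy_colour_class:
  fixes w :: "'a \<Rightarrow> real" and d :: nat
  assumes "finite S" "c ` S \<subseteq> {..<d}" "0 < d"
  obtains j where "(\<Sum>v\<in>S. w v) \<le> d * (\<Sum>v\<in>{v \<in> S. c v = j}. w v)"
proof (rule ccontr)
  assume "\<not> thesis"
  then have *: "d * (\<Sum>v\<in>{v \<in> S. c v = j}. w v) < (\<Sum>v\<in>S. w v)" for j
    using that by (meson not_le)
  have "d * (\<Sum>v\<in>S. w v) = (\<Sum>j<d. d * (\<Sum>v\<in>{v \<in> S. c v = j}. w v))"
    using sum.group[OF assms(1) finite_lessThan assms(2), of w] by (simp add: sum_distrib_left[symmetric])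
  also have "\<dots> < (\<Sum>j<d. (\<Sum>v\<in>S. w v))"
    using * assms by (intro sum_strict_mono) auto
  finally show False by simp
qed

text \<open>
  The exponent \<open>c v\<close> counts the erasers spent at \<open>v\<close> in rounds with a small painted set; keeping
  the heaviest colour class in such a round does not increase the total weight.
\<close>

lemma correct_wins_by_weights:
  assumes V: "finite V" "E \<subseteq> pairs V" and k: "1 \<le> k"
    and big: "\<And>S. S \<subseteq> V \<Longrightarrow> card S = m \<Longrightarrow> \<exists>K. K \<subseteq> S \<and> card K = k \<and> independent_in E K"
    and sparse: "\<And>W. W \<subseteq> V \<Longrightarrow> card W \<le> m \<Longrightarrow> 2 * card (E \<inter> pairs W) \<le> D * card W"
    and B: "\<And>x. (1 + 1 / real (Suc D)) ^ x \<le> real (card V) \<Longrightarrow> x \<le> B"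
    and "U \<subseteq> V" "(\<Sum>v\<in>U. (1 + 1 / real (Suc D)) ^ c v) \<le> card V"
    and "\<And>v. v \<in> U \<Longrightarrow> card U div k + B \<le> r v + c v"
  shows "correct_wins E U r"
  using assms(7-)
proof (induction "card U" arbitrary: U r c rule: less_induct)
  case less
  define w where "w = (\<lambda>c (v::'a). (1 + 1 / real (Suc D)) ^ c v)"
  have w0: "0 < w c v" for c v by (simp add: w_def add_pos_nonneg)
  have finU: "finite U" using less.prems V finite_subset by auto
  \<comment> \<open>A single weight never exceeds the total weight, so the bound on the total bounds
    every exponent.\<close>
  have c_le: "c' v \<le> B" if "v \<in> U'" "(\<Sum>v\<in>U'. w c' v) \<le> card V" "finite U'" for c' U' v
  proof (rule B)
    have "w c' v \<le> (\<Sum>v\<in>U'. w c' v)" using that w0 by (intro member_le_sum) (auto intro: less_imp_le)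
    then show "(1 + 1 / real (Suc D)) ^ c' v \<le> real (card V)" using that by (simp add: w_def)
  qed
  show ?case
  proof (rule correct_wins.intros)
    fix S assume S: "S \<subseteq> U" "S \<noteq> {}"
    have finS: "finite S" using S finU finite_subset by auto
    show "\<exists>K. legal_reply E r S K \<and> correct_wins E (U - K) (use_erasers (S - K) r)"
    proof (cases "m \<le> card S")
      case True
      then obtain S' where S': "S' \<subseteq> S" "card S' = m" using obtain_subset_with_card_n by metis
      then obtain K where K: "K \<subseteq> S'" "card K = k" "independent_in E K"
        using big[of S'] S less.prems by blast
      have KU: "K \<subseteq> U" using K S' S by auto
      then have finK: "finite K" using finU finite_subset by auto
      have cardU: "k \<le> card U" using card_mono[OF finU KU] K by simp
      have card': "card (U - K) = card U - k" using K KU finK by (simp add: card_Diff_subset)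
      \<comment> \<open>Removing exactly \<open>k\<close> vertices lowers the quotient by one, which
        pays for the eraser spent by each vertex of \<open>S - K\<close> in this round.\<close>
      have div': "card U div k = Suc (card (U - K) div k)"
        using cardU k card' by (simp add: le_div_geq)
      have "legal_reply E r S K"
        unfolding legal_reply_def
      proof (intro conjI ballI)
        fix v assume "v \<in> S - K"
        then have "v \<in> U" using S by auto
        then show "0 < r v"
          using less.prems(3)[of v] c_le[of v U c] less.prems(2) finU div' by (simp add: w_def)
      qed (use K S' in auto)
      moreover have "correct_wins E (U - K) (use_erasers (S - K) r)"
      proof (rule less.hyps)
        show "card (U - K) < card U" using card' cardU k by simp
        show "(\<Sum>v\<in>U - K. (1 + 1 / real (Suc D)) ^ c v) \<le> card V"
        proof -
          have "(\<Sum>v\<in>U - K. w c v) \<le> (\<Sum>v\<in>U. w c v)"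
            using finU w0 by (intro sum_mono2) (auto intro: less_imp_le)
          then show ?thesis using less.prems(2) by (simp add: w_def)
        qed
        show "card (U - K) div k + B \<le> use_erasers (S - K) r v + c v" if "v \<in> U - K" for v
          using less.prems(3)[of v] that div' by (auto simp: use_erasers_def)
      qed (use less.prems in auto)
      ultimately show ?thesis by blast
    next
      case False
      have "\<exists>col. col ` S \<subseteq> {..<Suc D} \<and> proper_colouring S E col"
      proof (rule degenerate_colouring[OF finS V(2)])
        fix W assume W: "W \<subseteq> S"
        then have "card W \<le> m" using False card_mono[OF finS W] by simp
        then show "2 * card (E \<inter> pairs W) \<le> D * card W"
          using W S less.prems by (intro sparse) auto
      qed
      then obtain col where col: "col ` S \<subseteq> {..<Suc D}" "proper_colouring S E col" by blast
      obtain j where j: "(\<Sum>v\<in>S. w c v) \<le> real (Suc D) * (\<Sum>v\<in>{v \<in> S. col v = j}. w c v)"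
        using heavy_colour_class[OF finS col(1) zero_less_Suc, of "w c"] by blast
      define K where "K = {v \<in> S. col v = j}"
      have KS: "K \<subseteq> S" by (auto simp: K_def)
      have "0 < (\<Sum>v\<in>S. w c v)" using S finS w0 by (intro sum_pos) auto
      \<comment> \<open>Positive weight rules out an empty class, so the round shrinks
        \<open>U\<close> and the induction applies.\<close>
      then have Kne: "K \<noteq> {}" using j unfolding K_def[symmetric] by auto
      have ind: "independent_in E K"
        using col(2) unfolding independent_in_def proper_colouring_def K_def by blast
      define c' where "c' = (\<lambda>v. if v \<in> S - K then Suc (c v) else c v)"
      have weight: "(\<Sum>v\<in>U - K. w c' v) \<le> card V"
      proof -
        define d where "d = real (Suc D)"
        have d: "d > 0" by (simp add: d_def)
        have "(\<Sum>v\<in>S - K. w c' v) = (1 + 1 / d) * (\<Sum>v\<in>S - K. w c v)"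
          unfolding sum_distrib_left by (intro sum.cong) (auto simp: w_def c'_def d_def)
        also have "(\<Sum>v\<in>S - K. w c v) = (\<Sum>v\<in>S. w c v) - (\<Sum>v\<in>K. w c v)"
          using finS KS by (rule sum_diff)
        also have "(1 + 1 / d) * ((\<Sum>v\<in>S. w c v) - (\<Sum>v\<in>K. w c v))
            \<le> (1 + 1 / d) * ((\<Sum>v\<in>S. w c v) - (\<Sum>v\<in>S. w c v) / d)"
          using j d unfolding K_def[symmetric] d_def[symmetric]
          by (intro mult_left_mono diff_left_mono) (auto simp: field_simps)
        \<comment> \<open>Removing a share of at least \<open>1 / d\<close> outweighs the growth of
          the others, as \<open>(1 + 1 / d) (1 - 1 / d) = 1 - 1 / d^2\<close>.\<close>
        also have "\<dots> = (\<Sum>v\<in>S. w c v) - (\<Sum>v\<in>S. w c v) / d\<^sup>2"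
          using d by (simp add: field_simps power2_eq_square)
        also have "\<dots> \<le> (\<Sum>v\<in>S. w c v)"
          using \<open>0 < (\<Sum>v\<in>S. w c v)\<close> by simp
        finally have 1: "(\<Sum>v\<in>S - K. w c' v) \<le> (\<Sum>v\<in>S. w c v)" .
        have "U - K = (U - S) \<union> (S - K)" using S KS by auto
        moreover have "(\<Sum>v\<in>(U - S) \<union> (S - K). w c' v) = (\<Sum>v\<in>U - S. w c' v) + (\<Sum>v\<in>S - K. w c' v)"
          using finU finS by (intro sum.union_disjoint) auto
        ultimately have "(\<Sum>v\<in>U - K. w c' v) = (\<Sum>v\<in>U - S. w c' v) + (\<Sum>v\<in>S - K. w c' v)"
          by simp
        also have "(\<Sum>v\<in>U - S. w c' v) = (\<Sum>v\<in>U - S. w c v)"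
          by (intro sum.cong) (auto simp: w_def c'_def)
        also have "\<dots> + (\<Sum>v\<in>S - K. w c' v) \<le> (\<Sum>v\<in>U - S. w c v) + (\<Sum>v\<in>S. w c v)"
          using 1 by simp
        also have "\<dots> = (\<Sum>v\<in>U. w c v)" using sum.subset_diff[OF S(1) finU, of "w c"] by simp
        finally show ?thesis using less.prems(2) by (simp add: w_def)
      qed
      have "legal_reply E r S K"
        unfolding legal_reply_def
      proof (intro conjI ballI)
        fix v assume v: "v \<in> S - K"
        then have vU: "v \<in> U - K" using S by auto
        \<comment> \<open>The weight bound after the move is used to show that the move is legal:
          the increased exponent is still at most \<open>B\<close>, so at least one eraser was
          left.\<close>
        have "c' v \<le> B" using c_le[OF vU weight] finU by simp
        then have "Suc (c v) \<le> B" using v by (simp add: c'_def)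
        then show "0 < r v" using less.prems(3)[of v] vU by simp
      qed (use KS ind in auto)
      moreover have "correct_wins E (U - K) (use_erasers (S - K) r)"
      proof (rule less.hyps[where c = c'])
        show card_less: "card (U - K) < card U"
          using Kne KS S finU by (intro psubset_card_mono) auto
        show "(\<Sum>v\<in>U - K. (1 + 1 / real (Suc D)) ^ c' v) \<le> card V"
          using weight by (simp add: w_def)
        show "card (U - K) div k + B \<le> use_erasers (S - K) r v + c' v" if "v \<in> U - K" for v
        proof -
          have "card (U - K) div k \<le> card U div k" using card_less by (intro div_le_mono) simp
          then show ?thesis
            using less.prems(3)[of v] that by (auto simp: use_erasers_def c'_def)
        qed
      qed (use less.prems in auto)
      ultimately show ?thesis by blast
    qed
  qed
qed

text \<open>The start has all exponents 0 and total weight \<open>card V\<close>. An exponent then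
  stays below \<open>ln (card V) / ln (1 + 1 / (D + 1))\<close>, and
  \<open>ln (1 + 1 / d) >= 1 / (d + 1)\<close> turns this into the factor
  \<open>D + 2\<close>.\<close>

lemma paintability_le:
  assumes V: "finite V" "E \<subseteq> pairs V" and k: "1 \<le> k"
    and big: "\<And>S. S \<subseteq> V \<Longrightarrow> card S = m \<Longrightarrow> \<exists>K. K \<subseteq> S \<and> card K = k \<and> independent_in E K"
    and sparse: "\<And>W. W \<subseteq> V \<Longrightarrow> card W \<le> m \<Longrightarrow> 2 * card (E \<inter> pairs W) \<le> D * card W"
    and n: "1 \<le> card V"
  shows "paintability V E \<le> real (card V) / k + (real D + 2) * ln (card V) + 1"
proof -
  define B where "B = nat \<lfloor>(real D + 2) * ln (card V)\<rfloor>"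
  have "paintable V E (card V div k + B + 1)"
    unfolding paintable_def
  proof
    have "correct_wins E V (\<lambda>_. card V div k + B)"
    proof (rule correct_wins_by_weights[where c = "\<lambda>_. 0", OF V k big sparse])
      fix x assume x: "(1 + 1 / real (Suc D)) ^ x \<le> real (card V)"
      have "ln ((1 + 1 / real (Suc D)) ^ x) \<le> ln (card V)"
        using x by (intro ln_mono) (auto intro!: zero_less_power add_pos_nonneg)
      then have 1: "x * ln (1 + 1 / real (Suc D)) \<le> ln (card V)"
        by (subst (asm) ln_realpow) (auto intro: add_pos_nonneg)
      have "1 - (real D + 1) / (real D + 2) \<le> - ln ((real D + 1) / (real D + 2))"
        using ln_le_minus_one[of "(real D + 1) / (real D + 2)"] by simp
      moreover have "- ln ((real D + 1) / (real D + 2)) = ln (1 + 1 / real (Suc D))"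
        by (simp add: ln_inverse[symmetric] field_simps)
      moreover have "1 - (real D + 1) / (real D + 2) = 1 / (real D + 2)" by (simp add: field_simps)
      ultimately have "1 / (real D + 2) \<le> ln (1 + 1 / real (Suc D))" by simp
      then have "x * (1 / (real D + 2)) \<le> x * ln (1 + 1 / real (Suc D))" by (intro mult_left_mono) auto
      with 1 have "x * (1 / (real D + 2)) \<le> ln (card V)" by simp
      then have "x \<le> (real D + 2) * ln (card V)" by (simp add: field_simps)
      then show "x \<le> B" unfolding B_def by (simp add: le_nat_floor)
    qed auto
    then show "correct_wins E V (\<lambda>_. card V div k + B + 1 - 1)" by simp
  qed simp
  then have "paintability V E \<le> card V div k + B + 1" unfolding paintability_def by (rule Least_le)
  then have "real (paintability V E) \<le> real (card V div k) + real B + 1" by linarith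
  moreover have "real (card V div k) \<le> real (card V) / k" by (rule of_nat_div_le_of_nat)
  moreover have "real B \<le> (real D + 2) * ln (card V)" unfolding B_def using n by (simp add: of_nat_floor)
  ultimately show ?thesis by linarith
qed

section \<open>Failure probabilities\<close>

lemma vertex_pairs_eq: "vertex_pairs n = pairs {1..n}"
  by (simp add: vertex_pairs_def pairs_def)

text \<open>The bridge from the probability space to the finite sums used everywhere else.\<close>

lemma prob_Gnp:
  fixes p :: real
  assumes p: "0 \<le> p" "p \<le> 1"
  shows "measure_pmf.prob (Gnp n p) {E. Q E} = prodE p (pairs {1..n}) (\<lambda>T. of_bool (Q T))"
proof -
  define A where "A = pairs {1..n}"
  define M where "M = Pi_pmf A False (\<lambda>_. bernoulli_pmf p)"
  have finA: "finite A" unfolding A_def by (simp add: finite_pairs)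
  have G: "Gnp n p = map_pmf (\<lambda>\<omega>. {e \<in> A. \<omega> e}) M"
    by (simp add: Gnp_def A_def M_def vertex_pairs_eq)
  have pmf: "pmf (Gnp n p) T = p ^ card T * (1 - p) ^ card (A - T)" if T: "T \<subseteq> A" for T
  proof -
    have "pmf (Gnp n p) T = measure_pmf.prob M ((\<lambda>\<omega>. {e \<in> A. \<omega> e}) -` {T})"
      unfolding G by (rule pmf_map)
    \<comment> \<open>The preimage also contains functions that hold somewhere outside
      \<open>A\<close>; the default value \<open>False\<close> of \<open>Pi_pmf\<close> gives them
      probability 0.\<close>
    also have "\<dots> = measure_pmf.prob M {\<lambda>e. e \<in> T}"
    proof (rule measure_prob_cong_0)
      fix \<omega> assume *: "\<omega> \<in> (\<lambda>\<omega>. {e \<in> A. \<omega> e}) -` {T} - {\<lambda>e. e \<in> T}"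
      have "\<exists>x. x \<notin> A \<and> \<omega> x"
      proof (rule ccontr)
        assume "\<nexists>x. x \<notin> A \<and> \<omega> x"
        then have "\<omega> = (\<lambda>e. e \<in> T)" using * T by auto
        then show False using * by simp
      qed
      then show "pmf M \<omega> = 0" unfolding M_def using finA by (subst pmf_Pi) auto
    qed (use T in auto)
    also have "\<dots> = pmf M (\<lambda>e. e \<in> T)" by (simp add: measure_pmf_single)
    also have "\<dots> = (\<Prod>e\<in>A. pmf (bernoulli_pmf p) (e \<in> T))"
      unfolding M_def using finA T by (subst pmf_Pi') auto
    also have "\<dots> = (\<Prod>e\<in>A. if e \<in> T then p else 1 - p)" using p by (intro prod.cong) auto
    also have "\<dots> = p ^ card T * (1 - p) ^ card (A - T)"
      using finA T by (simp add: prod.If_cases Int_absorb1 Diff_eq)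
    finally show ?thesis .
  qed
  have "measure_pmf.prob (Gnp n p) {E. Q E} = measure_pmf.prob (Gnp n p) {E \<in> Pow A. Q E}"
    by (rule measure_pmf.finite_measure_eq_AE) (auto simp: AE_measure_pmf_iff G)
  also have "\<dots> = (\<Sum>T\<in>{T \<in> Pow A. Q T}. pmf (Gnp n p) T)"
    using finA by (intro measure_measure_pmf_finite) auto
  also have "\<dots> = (\<Sum>T\<in>Pow A. if Q T then pmf (Gnp n p) T else 0)"
    using finA by (intro sum.inter_filter) auto
  also have "\<dots> = prodE p A (\<lambda>T. of_bool (Q T))"
    unfolding prodE_def by (intro sum.cong) (auto simp: pmf)
  finally show ?thesis unfolding A_def .
qed

section \<open>Union bounds for the bad events\<close>

lemma prodE_union_bound:
  fixes p :: real
  assumes "0 \<le> p" "p \<le> 1" "finite I"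
  shows "prodE p A (\<lambda>T. of_bool (\<exists>i\<in>I. Q i T)) \<le> (\<Sum>i\<in>I. prodE p A (\<lambda>T. of_bool (Q i T)))"
proof -
  have "of_bool (\<exists>i\<in>I. Q i T) \<le> (\<Sum>i\<in>I. of_bool (Q i T) :: real)" for T
  proof (cases "\<exists>i\<in>I. Q i T")
    case True
    then obtain i where "i \<in> I" "Q i T" by auto
    then show ?thesis
      using member_le_sum[of i I "\<lambda>i. of_bool (Q i T) :: real"] assms(3) by auto
  qed (auto intro: sum_nonneg)
  then show ?thesis unfolding prodE_sum[symmetric] using assms by (intro prodE_mono) auto
qed

lemma prodE_exp_card:
  fixes p :: real
  assumes "finite A" "0 \<le> p" "p \<le> 1"
  shows "prodE p A (\<lambda>T. exp (card T)) \<le> exp (2 * p * card A)"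
  using assms(1)
proof (induction A rule: finite_induct)
  case (insert e A)
  have "prodE p A (\<lambda>T. exp (card (insert e T))) = prodE p A (\<lambda>T. exp 1 * exp (card T))"
  proof (rule prodE_cong)
    fix T assume "T \<subseteq> A"
    then have "finite T" "e \<notin> T" using insert.hyps by (auto intro: finite_subset)
    then show "exp (real (card (insert e T))) = exp 1 * exp (real (card T))"
      by (simp add: exp_add)
  qed
  then have "prodE p (insert e A) (\<lambda>T. exp (card T)) = (p * exp 1 + (1 - p)) * prodE p A (\<lambda>T. exp (card T))"
    using insert.hyps by (simp add: prodE_insert prodE_cmult algebra_simps)
  also have "\<dots> \<le> exp (2 * p) * exp (2 * p * card A)"
    using insert assms by (intro mult_mono bernoulli_exp_le) (auto intro: prodE_nonneg)
  also have "\<dots> = exp (2 * p * card (insert e A))"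
    using insert.hyps by (simp add: exp_add[symmetric] algebra_simps)
  finally show ?case .
qed simp

text \<open>Chernoff's method with parameter 1: Markov's inequality for \<open>exp (card T)\<close>,
  whose mean is at most \<open>exp (p * (card W)^2)\<close>.\<close>

lemma dense_set_probability_le:
  fixes p :: real
  assumes V: "finite V" "W \<subseteq> V" and p: "0 \<le> p" "p \<le> 1"
  shows "prodE p (pairs V) (\<lambda>T. of_bool (D * card W < 2 * card (T \<inter> pairs W)))
    \<le> exp (card W * (p * card W - D / 2))"
proof -
  have finW: "finite W" using V finite_subset by auto
  have "prodE p (pairs V) (\<lambda>T. of_bool (D * card W < 2 * card (T \<inter> pairs W)))
      = prodE p (pairs W) (\<lambda>T. of_bool (D * card W < 2 * card (T \<inter> pairs W)))"
    using V by (intro prodE_restrict finite_pairs pairs_mono) (auto simp: Int_assoc)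
  also have "\<dots> \<le> prodE p (pairs W) (\<lambda>T. exp (- (real (D * card W) / 2)) * exp (card T))"
  proof (intro prodE_mono p)
    fix T assume T: "T \<subseteq> pairs W"
    show "of_bool (D * card W < 2 * card (T \<inter> pairs W)) \<le> exp (- (real (D * card W) / 2)) * exp (real (card T))"
    proof (cases "D * card W < 2 * card (T \<inter> pairs W)")
      case True
      then have "D * card W < 2 * card T" using T by (simp add: Int_absorb2)
      then have "real (D * card W) < real (2 * card T)" by (simp only: of_nat_less_iff)
      then show ?thesis unfolding exp_add[symmetric] by simp
    qed simp
  qed
  also have "\<dots> = exp (- (real (D * card W) / 2)) * prodE p (pairs W) (\<lambda>T. exp (card T))"
    by (rule prodE_cmult)
  also have "\<dots> \<le> exp (- (real (D * card W) / 2)) * exp (2 * p * card (pairs W))"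
    using finW p by (intro mult_left_mono prodE_exp_card finite_pairs) auto
  also have "\<dots> \<le> exp (card W * (p * card W - D / 2))"
  proof -
    have "p * (2 * real (card W choose 2)) \<le> p * (real (card W))\<^sup>2"
      using p by (intro mult_left_mono choose_2_le)
    then show ?thesis
      using finW by (simp add: card_pairs exp_add[symmetric] algebra_simps power2_eq_square)
  qed
  finally show ?thesis .
qed

text \<open>Half of \<open>6 * ln n\<close> leaves a factor \<open>n^-3\<close> per vertex of
  \<open>W\<close>, enough to beat the choice of \<open>W\<close> for all sizes
  simultaneously.\<close>

lemma sparse_failure_probability_le:
  fixes p :: real and V :: "'a set"
  assumes V: "finite V" "card V = n" and p: "0 \<le> p" "p \<le> 1" and n: "1 \<le> n"
    and D: "2 * p * m + 6 * ln n \<le> real D"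
  shows "prodE p (pairs V) (\<lambda>T. of_bool (\<exists>W. W \<subseteq> V \<and> card W \<le> m \<and> D * card W < 2 * card (T \<inter> pairs W)))
    \<le> 2 / real n"
proof -
  define \<W> where "\<W> = {W. W \<subseteq> V \<and> card W \<le> m \<and> W \<noteq> {}}"
  have fin: "finite \<W>" unfolding \<W>_def using V by simp
  have "(\<exists>W. W \<subseteq> V \<and> card W \<le> m \<and> D * card W < 2 * card (T \<inter> pairs W))
     \<longleftrightarrow> (\<exists>W\<in>\<W>. D * card W < 2 * card (T \<inter> pairs W))" for T
  proof -
    have "pairs ({} :: 'a set) = {}" by (auto simp: pairs_def)
    then have "W \<noteq> {}" if "D * card W < 2 * card (T \<inter> pairs W)" for W
      using that by auto
    then show ?thesis unfolding \<W>_def by blast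
  qed
  then have "prodE p (pairs V) (\<lambda>T. of_bool (\<exists>W. W \<subseteq> V \<and> card W \<le> m \<and> D * card W < 2 * card (T \<inter> pairs W)))
      \<le> (\<Sum>W\<in>\<W>. prodE p (pairs V) (\<lambda>T. of_bool (D * card W < 2 * card (T \<inter> pairs W))))"
    using prodE_union_bound[OF p fin] by simp
  also have "\<dots> \<le> (\<Sum>W\<in>\<W>. (1 / real n ^ 3) ^ card W)"
  proof (rule sum_mono)
    fix W assume "W \<in> \<W>"
    then have W: "W \<subseteq> V" "card W \<le> m" by (auto simp: \<W>_def)
    have "p * card W \<le> p * m" using W p by (intro mult_left_mono) auto
    then have "card W * (p * card W - D / 2) \<le> card W * (- (3 * ln n))"
      using D by (intro mult_left_mono) auto
    then have "exp (card W * (p * card W - D / 2)) \<le> exp (card W * (- (3 * ln n)))" by simp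
    also have "\<dots> = exp (- (3 * ln n)) ^ card W" by (rule exp_of_nat_mult)
    also have "exp (- (3 * ln n)) = 1 / real n ^ 3"
      using n exp_of_nat_mult[of 3 "ln n"] by (simp add: exp_minus field_simps)
    finally show "prodE p (pairs V) (\<lambda>T. of_bool (D * card W < 2 * card (T \<inter> pairs W))) \<le> (1 / real n ^ 3) ^ card W"
      using dense_set_probability_le[OF V(1) W(1) p, of D] by simp
  qed
  \<comment> \<open>Dropping the size restriction and adding the empty set completes the sum to
    \<open>(1 + n^-3)^n\<close>; the empty set contributes the 1 that is subtracted.\<close>
  also have "\<dots> \<le> (\<Sum>W\<in>Pow V - {{}}. (1 / real n ^ 3) ^ card W)"
    using V by (intro sum_mono2) (auto simp: \<W>_def)
  also have "\<dots> = (\<Sum>W\<in>Pow V. (1 / real n ^ 3) ^ card W) - 1"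
    using V by (subst sum_diff1) auto
  also have "(\<Sum>W\<in>Pow V. (1 / real n ^ 3) ^ card W) = (\<Sum>i\<le>n. (n choose i) * (1 / real n ^ 3) ^ i)"
    using sum_over_card[OF V(1), of "\<lambda>i. (1 / real n ^ 3) ^ i"] V by simp
  also have "\<dots> = (1 / real n ^ 3 + 1) ^ n"
    by (subst binomial_ring) simp
  also have "\<dots> \<le> 1 + 2 / n"
  proof -
    have "(1 / real n ^ 3 + 1) ^ n \<le> exp (1 / real n ^ 3) ^ n"
      using exp_ge_add_one_self[of "1 / real n ^ 3"] by (intro power_mono) (auto simp: add.commute)
    also have "\<dots> = exp (1 / real n ^ 2)"
      unfolding exp_of_nat_mult[symmetric] using n by (simp add: power2_eq_square power3_eq_cube)
    also have "\<dots> \<le> 1 + 1 / real n ^ 2 + (1 / real n ^ 2)\<^sup>2"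
      using n by (intro exp_bound) (auto simp: field_simps)
    also have "\<dots> \<le> 1 + 2 / n"
    proof -
      define y where "y = 1 / real n"
      have y: "0 \<le> y" "y \<le> 1" using n by (auto simp: y_def)
      have "y\<^sup>2 \<le> y" "(y\<^sup>2)\<^sup>2 \<le> y\<^sup>2" using y by (auto simp: power2_eq_square mult_left_le mult_le_one)
      then show ?thesis by (simp add: y_def power_one_over)
    qed
    finally show ?thesis .
  qed
  finally show ?thesis by simp
qed

lemma uncovered_probability_le:
  fixes p :: real
  assumes V: "finite V" "card V = n" and p: "0 < p" "p < 1" and k: "2 \<le> k" "k \<le> m"
    and small: "\<And>i. 1 \<le> i \<Longrightarrow> i \<le> k - 2 \<Longrightarrow>
      real ((k - 2) choose i) * (real k / real m) ^ i * (1 / (1 - p)) ^ (i * (i + 3) div 2) \<le> (1/2) ^ i"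
  shows "prodE p (pairs V) (\<lambda>T. of_bool (\<exists>S. S \<subseteq> V \<and> card S = m \<and> (\<forall>I. I \<subseteq> S \<longrightarrow> card I = k \<longrightarrow> pairs I \<inter> T \<noteq> {})))
    \<le> (n choose m) * exp (- min (p * (m choose 2)) (real m ^ 2 * (1 - p) ^ 2 / (18 * p * real k ^ 4)))"
proof -
  define \<S> where "\<S> = {S. S \<subseteq> V \<and> card S = m}"
  have fin: "finite \<S>" unfolding \<S>_def using V by simp
  have p': "0 \<le> p" "p \<le> 1" using p by auto
  have "prodE p (pairs V) (\<lambda>T. of_bool (\<exists>S. S \<subseteq> V \<and> card S = m \<and> (\<forall>I. I \<subseteq> S \<longrightarrow> card I = k \<longrightarrow> pairs I \<inter> T \<noteq> {})))
     = prodE p (pairs V) (\<lambda>T. of_bool (\<exists>S\<in>\<S>. (\<forall>I. I \<subseteq> S \<longrightarrow> card I = k \<longrightarrow> pairs I \<inter> T \<noteq> {})))"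
    unfolding \<S>_def by (simp add: Bex_def conj_assoc)
  also have "\<dots> \<le> (\<Sum>S\<in>\<S>. prodE p (pairs V) (\<lambda>T. of_bool (\<forall>I. I \<subseteq> S \<longrightarrow> card I = k \<longrightarrow> pairs I \<inter> T \<noteq> {})))"
    by (rule prodE_union_bound[OF p' fin])
  also have "\<dots> \<le> (\<Sum>S\<in>\<S>. exp (- min (p * (m choose 2)) (real m ^ 2 * (1 - p) ^ 2 / (18 * p * real k ^ 4))))"
  proof (rule sum_mono)
    fix S assume "S \<in> \<S>"
    then have S: "S \<subseteq> V" "card S = m" "finite S" using V finite_subset by (auto simp: \<S>_def)
    have "pairs I \<inter> (T \<inter> pairs S) = pairs I \<inter> T" if "I \<subseteq> S" for I T
      using pairs_mono[OF that] by blast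
    then have "(\<forall>I. I \<subseteq> S \<longrightarrow> card I = k \<longrightarrow> pairs I \<inter> T \<noteq> {})
      \<longleftrightarrow> (\<forall>I. I \<subseteq> S \<longrightarrow> card I = k \<longrightarrow> pairs I \<inter> (T \<inter> pairs S) \<noteq> {})" for T
      by (simp cong: imp_cong)
    then have "prodE p (pairs V) (\<lambda>T. of_bool (\<forall>I. I \<subseteq> S \<longrightarrow> card I = k \<longrightarrow> pairs I \<inter> T \<noteq> {}))
      = prodE p (pairs S) (\<lambda>T. of_bool (\<forall>I. I \<subseteq> S \<longrightarrow> card I = k \<longrightarrow> pairs I \<inter> T \<noteq> {}))"
      using V S by (intro prodE_restrict finite_pairs pairs_mono) (simp_all only:)
    also have "\<dots> \<le> exp (- min (p * (m choose 2)) (real m ^ 2 * (1 - p) ^ 2 / (18 * p * real k ^ 4)))"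
      using S k p small by (intro no_independent_set_probability_le)
    finally show "prodE p (pairs V) (\<lambda>T. of_bool (\<forall>I. I \<subseteq> S \<longrightarrow> card I = k \<longrightarrow> pairs I \<inter> T \<noteq> {}))
      \<le> exp (- min (p * (m choose 2)) (real m ^ 2 * (1 - p) ^ 2 / (18 * p * real k ^ 4)))" .
  qed
  finally show ?thesis using V by (simp add: \<S>_def n_subsets)
qed

lemma large_independent_set_probability_le:
  fixes p :: real
  assumes V: "finite V" "card V = n" and p: "0 \<le> p" "p \<le> 1"
  shows "prodE p (pairs V) (\<lambda>T. of_bool (\<exists>I. I \<subseteq> V \<and> card I = k \<and> pairs I \<inter> T = {}))
    \<le> (n choose k) * (1 - p) ^ (k choose 2)"
proof -
  define \<I> where "\<I> = {I. I \<subseteq> V \<and> card I = k}"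
  have fin: "finite \<I>" unfolding \<I>_def using V by simp
  have "prodE p (pairs V) (\<lambda>T. of_bool (\<exists>I. I \<subseteq> V \<and> card I = k \<and> pairs I \<inter> T = {}))
     = prodE p (pairs V) (\<lambda>T. of_bool (\<exists>I\<in>\<I>. pairs I \<inter> T = {}))"
    unfolding \<I>_def by (simp add: Bex_def conj_assoc)
  also have "\<dots> \<le> (\<Sum>I\<in>\<I>. prodE p (pairs V) (\<lambda>T. of_bool (pairs I \<inter> T = {})))"
    by (rule prodE_union_bound[OF p fin])
  also have "\<dots> = prodE p (pairs V) (indep_count V k)"
    unfolding indep_count_def prodE_sum \<I>_def ..
  finally show ?thesis using V by (simp add: prodE_indep_count)
qed

lemma power_div_fact_le_exp:
  fixes x :: real
  assumes "0 \<le> x"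
  shows "x ^ k / fact k \<le> exp x"
proof -
  have "(\<Sum>i\<in>{k}. x ^ i /\<^sub>R fact i) \<le> (\<Sum>i. x ^ i /\<^sub>R fact i)"
    using assms by (intro sum_le_suminf summable_exp_generic) auto
  then show ?thesis by (simp add: exp_def field_simps)
qed

lemma choose_le_exp_power:
  assumes "1 \<le> k"
  shows "real (n choose k) \<le> (exp 1 * real n / real k) ^ k"
proof -
  have "(n choose k) * fact k \<le> n ^ k" by (rule binomial_fact_pow)
  then have "real ((n choose k) * fact k) \<le> real (n ^ k)" by (rule of_nat_mono)
  then have 1: "real (n choose k) * fact k \<le> real n ^ k" by simp
  have "real k ^ k / fact k \<le> exp (real k * 1)" using power_div_fact_le_exp[of "real k" k] by simp
  then have 2: "real k ^ k \<le> exp 1 ^ k * fact k" unfolding exp_of_nat_mult by (simp add: field_simps)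
  have "real (n choose k) * real k ^ k \<le> real (n choose k) * (exp 1 ^ k * fact k)"
    using 2 by (intro mult_left_mono) auto
  also have "\<dots> \<le> exp 1 ^ k * real n ^ k"
    using mult_left_mono[OF 1, of "exp 1 ^ k"] by (simp add: mult_ac)
  finally show ?thesis using assms by (simp add: power_divide power_mult_distrib field_simps)
qed

section \<open>Asymptotics\<close>

text \<open>\<open>- ln (1 - p)\<close> is \<open>ln b\<close>. It is comparable with
  \<open>p\<close> up to the constant \<open>1 / \<epsilon>\<close>, which allows sparse and
  constant \<open>p\<close> to be treated together.\<close>

lemma neg_ln_one_minus_bounds:
  fixes p \<epsilon> :: real
  assumes "0 < \<epsilon>" "0 < p" "p \<le> 1 - \<epsilon>"
  shows "p \<le> - ln (1 - p)" "- ln (1 - p) \<le> - ln \<epsilon>" "- ln (1 - p) \<le> p / \<epsilon>" "0 < - ln (1 - p)"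
proof -
  show 1: "p \<le> - ln (1 - p)" using ln_le_minus_one[of "1 - p"] assms by simp
  show "- ln (1 - p) \<le> - ln \<epsilon>" using assms by simp
  have "- ln (1 - p) = ln (1 / (1 - p))" using assms by (simp add: ln_div)
  also have "\<dots> \<le> 1 / (1 - p) - 1" using assms by (intro ln_le_minus_one) auto
  also have "\<dots> = p / (1 - p)" using assms by (simp add: field_simps)
  also have "\<dots> \<le> p / \<epsilon>" using assms by (intro divide_left_mono) auto
  finally show "- ln (1 - p) \<le> p / \<epsilon>" .
  show "0 < - ln (1 - p)" using 1 assms by linarith
qed

lemma two_thirds_powr_le:
  fixes p x :: real
  assumes "0 < x" "x powr (-1/3) \<le> p"
  shows "x powr (2/3) \<le> x * p"
proof -
  have "x powr (2/3) = x powr 1 * x powr (-1/3)" by (subst powr_add[symmetric]) simp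
  also have "\<dots> \<le> x * p" using assms by simp
  finally show ?thesis .
qed

lemma inverse_le_third_powr:
  fixes p x :: real
  assumes "0 < x" "0 < p" "x powr (-1/3) \<le> p"
  shows "1 / p \<le> x powr (1/3)"
proof -
  have "1 / p \<le> 1 / x powr (-1/3)" using assms by (intro divide_left_mono) auto
  then show ?thesis by (simp add: powr_minus_divide)
qed

lemma even_times_add_3: "2 * (i * (i + 3) div 2) = i * (i + 3)" for i :: nat
proof -
  have "even (i * (i + 3))" by simp
  then show ?thesis by simp
qed

text \<open>Each term is bounded by an \<open>i\<close>-th power, in two regimes. For small overlaps
  \<open>k^2 / m\<close> is \<open>n powr (-1/3)\<close> up to logarithms, against a factor
  \<open>b powr ((i + 3) / 2)\<close> of at most \<open>n powr (1/4)\<close> up to a constant. For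
  large overlaps \<open>k / m\<close> is \<open>1 / (n p)\<close> up to logarithms and the opposing
  factor is about \<open>(n p) powr (1 - \<delta>/2)\<close>: the slack \<delta> in \<open>k\<close>
  decides.\<close>

lemma overlap_terms_small:
  fixes p \<epsilon> \<delta> K :: real and n m k :: nat
  assumes \<epsilon>: "0 < \<epsilon>" and p: "0 < p" "p \<le> 1 - \<epsilon>" and plow: "real n powr (-1/3) \<le> p"
    and n: "1 \<le> n" and \<delta>: "0 < \<delta>" "\<delta> < 1" and K: "0 < K" and L: "1 \<le> ln n"
    and m: "n / (K * (ln n)\<^sup>2) \<le> m"
    and k: "k \<le> (2 - \<delta>) * (ln (n * p) / (- ln (1 - p)))" and x: "1 \<le> ln (n * p)"
    and a2: "4 * K / \<epsilon>\<^sup>2 * (ln n) ^ 4 * real n powr (-1/12) \<le> 1/2"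
    and a3: "32 * K / \<epsilon> * (ln n) ^ 3 * real n powr (- \<delta>/3) \<le> 1/2"
    and i: "1 \<le> i" "i \<le> k - 2"
  shows "real ((k - 2) choose i) * (real k / real m) ^ i * (1 / (1 - p)) ^ (i * (i + 3) div 2) \<le> (1/2) ^ i"
proof -
  define lb where "lb = - ln (1 - p)"
  define L where "L = ln n"
  note lbb = neg_ln_one_minus_bounds[OF \<epsilon> p, folded lb_def]
  have p1: "p < 1" using p \<epsilon> by simp
  have n0: "0 < real n" using n by simp
  have L0: "0 < L" "1 \<le> L" using L by (auto simp: L_def)
  have xL: "ln (n * p) \<le> L" using p1 p n0 by (simp add: L_def)
  have m0: "0 < real m"
    using m n0 K L0 unfolding L_def[symmetric] by (smt (verit) divide_pos_pos mult_pos_pos zero_less_power)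
  have klb: "lb * k \<le> (2 - \<delta>) * ln (n * p)"
    using k lbb by (simp add: lb_def[symmetric] field_simps)
  have k2: "k \<le> 2 * L / p"
  proof -
    have "real k * p \<le> lb * k" using mult_right_mono[OF lbb(1), of "real k"] by (simp add: mult.commute)
    also have "\<dots> \<le> (2 - \<delta>) * ln (n * p)" by (rule klb)
    also have "\<dots> \<le> 2 * L" using \<delta> x xL L0 by (intro mult_mono) auto
    finally show ?thesis using p by (simp add: field_simps)
  qed
  have im: "1 / m \<le> K * L\<^sup>2 / n"
    using m m0 n0 K L0 by (simp add: L_def[symmetric] field_simps)
  have b0: "exp lb = 1 / (1 - p)" using p1 by (simp add: lb_def exp_minus field_simps)
  have be: "exp lb \<le> 1 / \<epsilon>" unfolding b0 using p \<epsilon> by (intro divide_left_mono) auto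
  have \<epsilon>1: "\<epsilon> < 1" using p by simp
  define h where "h = exp (lb * (real i + 3) / 2)"
  have "(1 / (1 - p)) ^ (i * (i + 3) div 2) = exp (real (i * (i + 3) div 2) * lb)"
    unfolding b0[symmetric] exp_of_nat_mult ..
  also have "real (i * (i + 3) div 2) = i * (real i + 3) / 2"
  proof -
    have "real (2 * (i * (i + 3) div 2)) = real (i * (i + 3))" by (simp only: even_times_add_3)
    then have "2 * real (i * (i + 3) div 2) = real i * (real i + 3)"
      by (simp only: of_nat_mult of_nat_add of_nat_numeral)
    then show ?thesis by linarith
  qed
  also have "exp (i * (real i + 3) / 2 * lb) = exp (real i * (lb * (real i + 3) / 2))"
    by (simp add: mult_ac)
  also have "\<dots> = h ^ i" unfolding h_def by (rule exp_of_nat_mult)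
  finally have pw: "(1 / (1 - p)) ^ (i * (i + 3) div 2) = h ^ i" .
  have h0: "0 < h" by (simp add: h_def)
  have ik: "i + 2 \<le> k" using i by simp
  have pinv: "1 / p \<le> real n powr (1/3)" using plow n0 p by (intro inverse_le_third_powr) auto
  show ?thesis
  proof (cases "4 * i \<le> k")
    case True
    have "(k - 2) choose i \<le> (k - 2) ^ i" using i by (intro binomial_le_pow) auto
    also have "\<dots> \<le> k ^ i" by (intro power_mono) auto
    finally have "real ((k - 2) choose i) \<le> real (k ^ i)" by (rule of_nat_mono)
    then have "real ((k - 2) choose i) * (real k / real m) ^ i * h ^ i \<le> real k ^ i * (real k / real m) ^ i * h ^ i"
      using h0 by (intro mult_right_mono) auto
    also have "\<dots> = (real k * (real k / real m) * h) ^ i" by (simp only: power_mult_distrib)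
    also have "\<dots> \<le> (1/2) ^ i"
    proof (intro power_mono)
      have "lb * i \<le> lb * (k / 4)" using True lbb by (intro mult_left_mono) auto
      also have "\<dots> \<le> (2 - \<delta>) * ln (n * p) / 4" using klb by simp
      also have "\<dots> \<le> 2 * L / 4" using \<delta> x xL L0 by (intro divide_right_mono mult_mono) auto
      finally have "lb * (real i + 3) / 2 \<le> L / 4 + 2 * lb" using lbb by (simp add: algebra_simps)
      then have "h \<le> exp (L / 4 + 2 * lb)" by (simp add: h_def)
      also have "\<dots> = real n powr (1/4) * (exp lb)\<^sup>2"
        using n0 by (simp add: exp_add powr_def L_def exp_double[symmetric] )
      also have "\<dots> \<le> real n powr (1/4) * (1 / \<epsilon>)\<^sup>2"
        using be by (intro mult_left_mono power_mono) auto
      finally have hle: "h \<le> real n powr (1/4) * (1 / \<epsilon>)\<^sup>2" .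
      have "real k * (real k / real m) = (real k)\<^sup>2 * (1 / m)" by (simp add: power2_eq_square)
      also have "\<dots> \<le> (2 * L / p)\<^sup>2 * (K * L\<^sup>2 / n)"
        using k2 im m0 by (intro mult_mono power_mono) auto
      also have "\<dots> = (1 / p)\<^sup>2 * (4 * K * L ^ 4 / n)" by (simp add: power_divide power_mult_distrib field_simps)
      also have "\<dots> \<le> (real n powr (1/3))\<^sup>2 * (4 * K * L ^ 4 / n)"
        using pinv p K L0 n0 by (intro mult_right_mono power_mono) auto
      also have "\<dots> = 4 * K * L ^ 4 * real n powr (-1/3)"
      proof -
        have "(real n powr (1/3))\<^sup>2 / n = real n powr (2/3) / real n powr 1"
          using n0 by (simp add: powr_power)
        also have "\<dots> = real n powr (-1/3)" by (subst powr_diff[symmetric]) simp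
        finally have "(real n powr (1/3))\<^sup>2 / n = real n powr (-1/3)" .
        then show ?thesis by (metis (no_types, lifting) mult.commute times_divide_eq_right)
      qed
      finally have kkm: "real k * (real k / real m) \<le> 4 * K * L ^ 4 * real n powr (-1/3)" .
      have "real k * (real k / real m) * h \<le> (4 * K * L ^ 4 * real n powr (-1/3)) * (real n powr (1/4) * (1 / \<epsilon>)\<^sup>2)"
        by (rule mult_mono[OF kkm hle]) (use h0 K L0 in auto)
      also have "\<dots> = 4 * K / \<epsilon>\<^sup>2 * L ^ 4 * (real n powr (-1/3) * real n powr (1/4))"
        by (simp add: power_divide field_simps)
      also have "real n powr (-1/3) * real n powr (1/4) = real n powr (-1/12)"
        by (subst powr_add[symmetric]) simp
      finally show "real k * (real k / real m) * h \<le> 1/2" using a2 unfolding L_def by linarith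
    qed (use h0 in auto)
    finally show ?thesis unfolding pw .
  next
    case False
    \<comment> \<open>Here \<open>k < 4 i\<close>, so the crude bound by all subsets costs only
      \<open>16 ^ i\<close>.\<close>
    have "(k - 2) choose i \<le> 2 ^ (k - 2)" by (rule binomial_le_pow2)
    also have "\<dots> \<le> 2 ^ (4 * i)" using False by (intro power_increasing) auto
    also have "\<dots> = 16 ^ i" by (simp add: power_mult)
    finally have "real ((k - 2) choose i) \<le> real (16 ^ i)" by (rule of_nat_mono)
    then have "real ((k - 2) choose i) * (real k / real m) ^ i * h ^ i \<le> 16 ^ i * (real k / real m) ^ i * h ^ i"
      using h0 by (intro mult_right_mono) auto
    also have "\<dots> = (16 * (real k / real m) * h) ^ i" by (simp only: power_mult_distrib)
    also have "\<dots> \<le> (1/2) ^ i"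
    proof (intro power_mono)
      have "lb * (real i + 3) \<le> lb * (real k + 1)" using ik lbb by (intro mult_left_mono) auto
      also have "\<dots> \<le> (2 - \<delta>) * ln (n * p) + lb" using klb by (simp add: algebra_simps)
      finally have "lb * (real i + 3) / 2 \<le> ((2 - \<delta>) * ln (n * p) + lb) / 2" by simp
      also have "\<dots> \<le> (1 - \<delta>/2) * ln (n * p) + lb" using lbb by (simp add: field_simps)
      finally have "lb * (real i + 3) / 2 \<le> (1 - \<delta>/2) * ln (n * p) + lb" .
      then have "h \<le> exp ((1 - \<delta>/2) * ln (n * p) + lb)" by (simp add: h_def)
      also have "\<dots> = (real n * p) powr (1 - \<delta>/2) * exp lb"
        using n0 p by (simp add: exp_add powr_def)
      also have "\<dots> \<le> (real n * p) powr (1 - \<delta>/2) * (1 / \<epsilon>)"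
        using be by (intro mult_left_mono) auto
      also have "(real n * p) powr (1 - \<delta>/2) = real n * p * (real n * p) powr (- \<delta>/2)"
        using n0 p by (simp add: powr_diff powr_minus_divide)
      also have "(real n * p) powr (- \<delta>/2) \<le> (real n powr (2/3)) powr (- \<delta>/2)"
        using n0 \<delta> two_thirds_powr_le[OF n0 plow] by (intro powr_mono2') auto
      also have "(real n powr (2/3)) powr (- \<delta>/2) = real n powr (- \<delta>/3)" by (simp add: powr_powr)
      finally have hle: "h \<le> real n * p * real n powr (- \<delta>/3) * (1 / \<epsilon>)"
        using n0 p \<epsilon> by (simp add: mult_left_mono divide_right_mono)
      have "16 * (real k / real m) * h = 16 * (real k * (1 / m)) * h" by simp
      also have "\<dots> \<le> 16 * ((2 * L / p) * (K * L\<^sup>2 / n)) * (real n * p * real n powr (- \<delta>/3) * (1 / \<epsilon>))"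
        using k2 im m0 hle h0 K L0 p n0 by (intro mult_mono) auto
      also have "\<dots> = 32 * K / \<epsilon> * L ^ 3 * real n powr (- \<delta>/3)"
        using n0 p by (simp add: field_simps power2_eq_square power3_eq_cube)
      finally show "16 * (real k / real m) * h \<le> 1/2" using a3 unfolding L_def by linarith
    qed (use h0 in auto)
    finally show ?thesis unfolding pw .
  qed
qed

text \<open>The number of \<open>m\<close>-sets is at most \<open>exp (3 m ln ln n)\<close>, and
  each branch of the minimum is at least \<open>4 m ln ln n\<close>; the surplus
  \<open>exp (- m ln ln n)\<close> is at most \<open>1 / ln n\<close>.\<close>

lemma uncovered_probability_le_inverse_ln:
  fixes p \<epsilon> \<delta> K :: real and n m k :: nat
  assumes \<epsilon>: "0 < \<epsilon>" and p: "0 < p" "p \<le> 1 - \<epsilon>" and plow: "real n powr (-1/3) \<le> p"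
    and n: "1 \<le> n" and \<delta>: "0 < \<delta>" "\<delta> < 1" and K: "1 \<le> K" and L: "1 \<le> ln (ln n)"
    and m: "n / (K * (ln n)\<^sup>2) \<le> m"
    and k: "2 \<le> k" "k \<le> (2 - \<delta>) * (ln (n * p) / (- ln (1 - p)))" and x: "1 \<le> ln (n * p)"
    and a1: "2 * ln n * real n powr (1/3) \<le> n / (K * (ln n)\<^sup>2)"
    and a2: "4 * K / \<epsilon>\<^sup>2 * (ln n) ^ 4 * real n powr (-1/12) \<le> 1/2"
    and a3: "32 * K / \<epsilon> * (ln n) ^ 3 * real n powr (- \<delta>/3) \<le> 1/2"
    and a4: "1 + ln K \<le> ln (ln n)"
    and a5: "16 * K * (ln n)\<^sup>2 * ln (ln n) \<le> real n powr (2/3)"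
    and a6: "1152 * K / \<epsilon>\<^sup>2 * ((ln n) ^ 6 * ln (ln n)) \<le> n * p ^ 3"
  shows "(n choose m) * exp (- min (p * (m choose 2)) (real m ^ 2 * (1 - p) ^ 2 / (18 * p * real k ^ 4)))
           \<le> 1 / ln n"
    "k \<le> m"
proof -
  define lb where "lb = - ln (1 - p)"
  define L where "L = ln n"
  note lbb = neg_ln_one_minus_bounds[OF \<epsilon> p, folded lb_def]
  have p1: "p < 1" using p \<epsilon> by simp
  have n0: "0 < real n" using n by simp
  have L1: "1 \<le> L"
  proof (rule ccontr)
    assume "\<not> 1 \<le> L"
    moreover have "0 \<le> L" using n by (simp add: L_def)
    \<comment> \<open>The case \<open>L = 0\<close> is covered by \<open>ln 0 = 0\<close>.\<close>
    ultimately have "ln L \<le> 0" by (cases "L = 0") auto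
    then show False using L by (simp add: L_def)
  qed
  have xL: "ln (n * p) \<le> L" using p1 p n0 by (simp add: L_def)
  have klb: "lb * k \<le> (2 - \<delta>) * ln (n * p)"
    using k lbb by (simp add: lb_def[symmetric] field_simps)
  have k2: "k * p \<le> 2 * L"
  proof -
    have "real k * p \<le> lb * k" using mult_right_mono[OF lbb(1), of "real k"] by (simp add: mult.commute)
    also have "\<dots> \<le> (2 - \<delta>) * ln (n * p)" by (rule klb)
    also have "\<dots> \<le> 2 * L" using \<delta> x xL L1 by (intro mult_mono) auto
    finally show ?thesis .
  qed
  have pinv: "1 / p \<le> real n powr (1/3)" using plow n0 p by (intro inverse_le_third_powr) auto
  show km: "k \<le> m"
  proof -
    have "real k \<le> 2 * L * (1 / p)" using k2 p by (simp add: field_simps)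
    also have "\<dots> \<le> 2 * L * real n powr (1/3)" using pinv L1 by (intro mult_left_mono) auto
    also have "\<dots> \<le> m" using a1 m unfolding L_def by linarith
    finally show ?thesis by simp
  qed
  have m2: "2 \<le> real m" using k km by simp
  have lnL0: "1 \<le> ln L" using L by (simp add: L_def)
  have C: "real (n choose m) \<le> exp (m * (3 * ln L))"
  proof -
    have "real (n choose m) \<le> (exp 1 * real n / real m) ^ m" using m2 by (intro choose_le_exp_power) auto
    also have "\<dots> \<le> exp (3 * ln L) ^ m"
    proof (rule power_mono)
      have "real n / m \<le> K * L\<^sup>2" using m m2 K L1 n0 by (simp add: L_def[symmetric] field_simps)
      also have "\<dots> = exp (ln K + 2 * ln L)" using K L1 by (simp add: exp_add exp_double)
      finally have "exp 1 * (real n / m) \<le> exp 1 * exp (ln K + 2 * ln L)" by (intro mult_left_mono) auto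
      also have "\<dots> \<le> exp (3 * ln L)" unfolding exp_add[symmetric] using a4 by (simp add: L_def)
      finally show "exp 1 * real n / real m \<le> exp (3 * ln L)" by simp
    qed auto
    finally show ?thesis unfolding exp_of_nat_mult .
  qed
  have n23: "real n powr (2/3) \<le> real n * p" using plow n0 by (intro two_thirds_powr_le) auto
  have e1: "m * (4 * ln L) \<le> p * (m choose 2)"
  proof -
    have "16 * ln L * (K * L\<^sup>2) \<le> n * p" using a5 n23 by (simp add: L_def mult_ac)
    then have "16 * ln L \<le> p * (n / (K * L\<^sup>2))" using K L1 by (simp add: field_simps)
    also have "\<dots> \<le> p * m" using m p by (intro mult_left_mono) (auto simp: L_def)
    finally have "16 * ln L \<le> p * m" .
    moreover have "p * (real m / 2) \<le> p * (real m - 1)" using m2 p by (intro mult_left_mono) auto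
    ultimately have "8 * ln L \<le> p * (real m - 1)" by simp
    then have "m / 2 * (8 * ln L) \<le> m / 2 * (p * (real m - 1))" by (intro mult_left_mono) auto
    also have "\<dots> = p * (m choose 2)"
    proof -
      have "m / 2 * (p * (real m - 1)) = p * (m * (real m - 1)) / 2" by simp
      also have "\<dots> = p * (m choose 2)" unfolding choose_2_real[symmetric] by simp
      finally show ?thesis .
    qed
    finally show ?thesis by simp
  qed
  \<comment> \<open>Inserting \<open>k * p \<le> 2 * L\<close> turns \<open>m / (p k^4)\<close> into
    \<open>m p^3 / (16 L^4)\<close>, and \<open>m\<close> supplies \<open>n / (K L^2)\<close>: hence
    the cubic condition \<open>a6\<close> with constant \<open>1152 = 4 * 18 * 16\<close>.\<close>
  have e2: "m * (4 * ln L) \<le> real m ^ 2 * (1 - p) ^ 2 / (18 * p * real k ^ 4)"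
  proof -
    have k4: "(k * p) ^ 4 \<le> (2 * L) ^ 4" using k2 p by (intro power_mono) auto
    have "1152 * K / \<epsilon>\<^sup>2 * (L ^ 6 * ln L) \<le> n * p ^ 3" using a6 by (simp add: L_def)
    then have "4 * ln L * (288 * L ^ 4) \<le> n / (K * L\<^sup>2) * p ^ 3 * \<epsilon>\<^sup>2"
      using K L1 \<epsilon> by (simp add: field_simps power_add[symmetric] eval_nat_numeral)
    also have "\<dots> \<le> m * p ^ 3 * (1 - p)\<^sup>2"
      using m p \<epsilon> by (intro mult_mono power_mono) (auto simp: L_def)
    finally have "4 * ln L * (288 * L ^ 4) \<le> m * p ^ 3 * (1 - p)\<^sup>2" .
    moreover have "4 * ln L * (18 * (k * p) ^ 4) \<le> 4 * ln L * (288 * L ^ 4)"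
      using k4 lnL0 by (intro mult_left_mono) (auto simp: power_mult_distrib mult.commute)
    ultimately have "4 * ln L * (18 * (k * p) ^ 4) \<le> m * p ^ 3 * (1 - p)\<^sup>2" by linarith
    then have "p ^ 3 * (4 * ln L * (18 * p * k ^ 4)) \<le> p ^ 3 * (m * (1 - p)\<^sup>2)"
      by (simp add: power_mult_distrib field_simps eval_nat_numeral)
    then have "4 * ln L * (18 * p * k ^ 4) \<le> m * (1 - p)\<^sup>2"
      using p by (subst (asm) mult_le_cancel_left_pos) auto
    then have "m * (4 * ln L * (18 * p * k ^ 4)) \<le> m * (m * (1 - p)\<^sup>2)" by (intro mult_left_mono) auto
    moreover have "0 < 18 * p * real k ^ 4" using p k by simp
    ultimately show ?thesis by (simp add: pos_le_divide_eq power2_eq_square mult_ac)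
  qed
  have "(n choose m) * exp (- min (p * (m choose 2)) (real m ^ 2 * (1 - p) ^ 2 / (18 * p * real k ^ 4)))
      \<le> exp (m * (3 * ln L)) * exp (- (m * (4 * ln L)))"
    using C e1 e2 by (intro mult_mono) auto
  also have "\<dots> = exp (- (m * ln L))" by (simp add: exp_add[symmetric] algebra_simps)
  also have "\<dots> \<le> exp (- (1 * ln L))" using m2 lnL0 by (intro iffD2[OF exp_le_cancel_iff] le_imp_neg_le mult_right_mono) auto
  also have "\<dots> = 1 / L" using L1 by (simp add: exp_minus field_simps)
  finally show "(n choose m) * exp (- min (p * (m choose 2)) (real m ^ 2 * (1 - p) ^ 2 / (18 * p * real k ^ 4)))
           \<le> 1 / ln n" unfolding L_def .
qed

text \<open>Each vertex of an independent \<open>k\<close>-set contributes about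
  \<open>ln (n / k) - ln b * k / 2\<close> to the exponent. The first part is at most
  \<open>ln (n p) - ln \<epsilon>\<close>, the second at least
  \<open>(1 + \<delta>/2) ln (n p)\<close>.\<close>

lemma chromatic_lower_tail:
  fixes p \<epsilon> \<delta> :: real and n :: nat
  assumes \<epsilon>: "0 < \<epsilon>" and p: "0 < p" "p \<le> 1 - \<epsilon>" and \<delta>: "0 < \<delta>" and x: "1 \<le> ln (n * p)" "0 < n"
    and z: "1 - 2 * ln \<epsilon> \<le> \<delta>/2 * ln (n * p)"
  shows "prodE p (pairs {1..n}) (\<lambda>E. of_bool (\<not> real n \<le> chromatic_number {1..n} E * ((2 + \<delta>) * (ln (n * p) / (- ln (1 - p))))))
     \<le> exp (1 - 2 * ln \<epsilon> - \<delta>/2 * ln (n * p))"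
proof -
  define lb where "lb = - ln (1 - p)"
  define x where "x = real n * p"
  define l where "l = ln x / lb"
  define k where "k = nat \<lceil>(2 + \<delta>) * l\<rceil>"
  note lbb = neg_ln_one_minus_bounds[OF \<epsilon> p, folded lb_def]
  have p1: "p < 1" using p \<epsilon> by simp
  have x0: "0 < x" using p x by (simp add: x_def)
  have lx: "1 \<le> ln x" using x by (simp add: x_def)
  have l0: "0 < l" using lx lbb by (simp add: l_def)
  have kl: "(2 + \<delta>) * l \<le> k" unfolding k_def by (rule real_nat_ceiling_ge)
  have k0: "0 < real k" using kl l0 \<delta> by (smt (verit) mult_pos_pos)
  \<comment> \<open>Colour classes have at most \<open>k - 1\<close> vertices, so rounding
    \<open>k\<close> up loses nothing.\<close>
  have ku: "real k - 1 \<le> (2 + \<delta>) * l"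
  proof -
    have "0 < (2 + \<delta>) * l" using l0 \<delta> by simp
    then show ?thesis unfolding k_def by linarith
  qed
  have "prodE p (pairs {1..n}) (\<lambda>E. of_bool (\<not> real n \<le> chromatic_number {1..n} E * ((2 + \<delta>) * l)))
     \<le> prodE p (pairs {1..n}) (\<lambda>E. of_bool (\<exists>I. I \<subseteq> {1..n} \<and> card I = k \<and> pairs I \<inter> E = {}))"
  proof (intro prodE_mono)
    fix E assume E: "E \<subseteq> pairs {1..n}"
    show "of_bool (\<not> real n \<le> chromatic_number {1..n} E * ((2 + \<delta>) * l))
        \<le> (of_bool (\<exists>I. I \<subseteq> {1..n} \<and> card I = k \<and> pairs I \<inter> E = {}) :: real)"
    proof (cases "\<exists>I. I \<subseteq> {1..n} \<and> card I = k \<and> pairs I \<inter> E = {}")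
      case False
      then have "card {1..n} \<le> chromatic_number {1..n} E * (k - 1)"
        using E by (intro card_le_chromatic_number) (auto simp: independent_in_iff[OF E])
      then have "n \<le> chromatic_number {1..n} E * (k - 1)" by simp
      then have "real n \<le> real (chromatic_number {1..n} E * (k - 1))" by (rule of_nat_mono)
      also have "\<dots> = chromatic_number {1..n} E * (real k - 1)" using k0 by (simp add: of_nat_diff)
      also have "\<dots> \<le> chromatic_number {1..n} E * ((2 + \<delta>) * l)" using ku by (intro mult_left_mono) auto
      finally show ?thesis by simp
    qed simp
  qed (use p p1 in auto)
  also have "\<dots> \<le> (n choose k) * (1 - p) ^ (k choose 2)"
    using p p1 by (intro large_independent_set_probability_le) auto
  also have "\<dots> \<le> (exp 1 * real n / real k) ^ k * (1 - p) ^ (k choose 2)"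
    using k0 p1 by (intro mult_right_mono choose_le_exp_power) auto
  also have "\<dots> = exp (k * (1 + ln (n / k))) * exp (- (lb * (k choose 2)))"
  proof -
    have "exp 1 * real n / real k = exp (1 + ln (n / k))" using x k0 by (simp add: exp_add)
    moreover have "(1 - p) = exp (- lb)" using p1 by (simp add: lb_def)
    ultimately show ?thesis by (simp add: exp_of_nat_mult[symmetric] mult.commute)
  qed
  also have "\<dots> = exp (k * (1 + ln (n / k) - lb * (real k - 1) / 2))"
  proof -
    have "lb * (k choose 2) = k * (lb * (real k - 1) / 2)"
    proof -
      have "k * (lb * (real k - 1) / 2) = lb * (k * (real k - 1)) / 2" by simp
      also have "\<dots> = lb * (k choose 2)" unfolding choose_2_real[symmetric] by simp
      finally show ?thesis by (rule sym)
    qed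
    then show ?thesis by (simp add: exp_add[symmetric] algebra_simps)
  qed
  also have "\<dots> \<le> exp (k * (1 - 2 * ln \<epsilon> - \<delta>/2 * ln x))"
  proof -
    have "lb * ((2 + \<delta>) * l) \<le> lb * k" using kl lbb by (intro mult_left_mono) auto
    then have lbk: "(2 + \<delta>) * ln x \<le> lb * k" using lbb by (simp add: l_def)
    have "n / k \<le> x / \<epsilon>"
    proof -
      have "1 * 1 \<le> (2 + \<delta>) * ln x" using lx \<delta> by (intro mult_mono) auto
      then have "real n * 1 \<le> n * (lb * k)" using lbk by (intro mult_left_mono) auto
      then have "n / k \<le> n * lb" using k0 by (simp add: field_simps)
      also have "\<dots> \<le> n * (p / \<epsilon>)" using lbb by (intro mult_left_mono) auto
      finally show ?thesis by (simp add: x_def)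
    qed
    then have "ln (n / k) \<le> ln (x / \<epsilon>)" using x k0 by (intro ln_mono) auto
    also have "\<dots> = ln x - ln \<epsilon>" using x0 \<epsilon> by (simp add: ln_div)
    finally have 1: "ln (n / k) \<le> ln x - ln \<epsilon>" .
    have "1 + ln (n / k) - lb * (real k - 1) / 2 \<le> 1 - 2 * ln \<epsilon> - \<delta>/2 * ln x"
      using 1 lbk lbb \<epsilon> by (simp add: algebra_simps)
    then show ?thesis by (simp add: mult_left_mono)
  qed
  \<comment> \<open>By \<open>z\<close> the bracket is nonpositive, so the factor \<open>k\<close>
    may be lowered to 1.\<close>
  also have "\<dots> \<le> exp (1 * (1 - 2 * ln \<epsilon> - \<delta>/2 * ln x))"
    using z k0 by (intro iffD2[OF exp_le_cancel_iff] mult_right_mono_neg) (auto simp: x_def)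
  finally show ?thesis by (simp add: l_def lb_def x_def)
qed

text \<open>Outside the two bad events \<open>paintability_le\<close> applies; the 3 in
  \<open>R\<close> is its 2 plus the rounding of \<open>D\<close>.\<close>

lemma paintability_upper_tail:
  fixes p \<epsilon> \<delta> K R :: real and n m k :: nat
  assumes \<epsilon>: "0 < \<epsilon>" and p: "0 < p" "p \<le> 1 - \<epsilon>" and plow: "real n powr (-1/3) \<le> p"
    and n: "1 \<le> n" and \<delta>: "0 < \<delta>" "\<delta> < 1" and K: "1 \<le> K" and L: "1 \<le> ln n" "1 \<le> ln (ln n)"
    and m: "n / (K * (ln n)\<^sup>2) \<le> m"
    and k: "2 \<le> k" "k \<le> (2 - \<delta>) * (ln (n * p) / (- ln (1 - p)))" and x: "1 \<le> ln (n * p)"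
    and a1: "2 * ln n * real n powr (1/3) \<le> n / (K * (ln n)\<^sup>2)"
    and a2: "4 * K / \<epsilon>\<^sup>2 * (ln n) ^ 4 * real n powr (-1/12) \<le> 1/2"
    and a3: "32 * K / \<epsilon> * (ln n) ^ 3 * real n powr (- \<delta>/3) \<le> 1/2"
    and a4: "1 + ln K \<le> ln (ln n)"
    and a5: "16 * K * (ln n)\<^sup>2 * ln (ln n) \<le> real n powr (2/3)"
    and a6: "1152 * K / \<epsilon>\<^sup>2 * ((ln n) ^ 6 * ln (ln n)) \<le> n * p ^ 3"
    and R: "real n / k + (2 * p * m + 6 * ln n + 3) * ln n + 1 \<le> R"
  shows "prodE p (pairs {1..n}) (\<lambda>E. of_bool (\<not> paintability {1..n} E \<le> R)) \<le> 2 / n + 1 / ln n"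
proof -
  define D where "D = nat \<lceil>2 * p * m + 6 * ln n\<rceil>"
  have D: "2 * p * m + 6 * ln n \<le> D" unfolding D_def by (rule real_nat_ceiling_ge)
  have D': "D \<le> 2 * p * m + 6 * ln n + 1"
  proof -
    have "0 \<le> 2 * p * m + 6 * ln n" using p L by simp
    then show ?thesis unfolding D_def by linarith
  qed
  note unc = uncovered_probability_le_inverse_ln[OF \<epsilon> p plow n \<delta> K L(2) m k x a1 a2 a3 a4 a5 a6]
  have p1: "p < 1" using p \<epsilon> by simp
  define bad1 where "bad1 = (\<lambda>E. \<exists>W. W \<subseteq> {1..n} \<and> card W \<le> m \<and> D * card W < 2 * card (E \<inter> pairs W))"
  define bad2 where "bad2 = (\<lambda>E. \<exists>S. S \<subseteq> {1..n} \<and> card S = m \<and> (\<forall>I. I \<subseteq> S \<longrightarrow> card I = k \<longrightarrow> pairs I \<inter> E \<noteq> {}))"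
  have "prodE p (pairs {1..n}) (\<lambda>E. of_bool (\<not> paintability {1..n} E \<le> R))
     \<le> prodE p (pairs {1..n}) (\<lambda>E. of_bool (bad1 E) + of_bool (bad2 E))"
  proof (intro prodE_mono)
    fix E assume E: "E \<subseteq> pairs {1..n}"
    show "of_bool (\<not> paintability {1..n} E \<le> R) \<le> (of_bool (bad1 E) + of_bool (bad2 E) :: real)"
    proof (cases "bad1 E \<or> bad2 E")
      case False
      have "paintability {1..n} E \<le> real (card {1..n}) / k + (real D + 2) * ln (card {1..n}) + 1"
      proof (rule paintability_le)
        show "\<exists>K. K \<subseteq> S \<and> card K = k \<and> independent_in E K" if "S \<subseteq> {1..n}" "card S = m" for S
          using False that unfolding bad2_def independent_in_iff[OF E] by blast
        show "2 * card (E \<inter> pairs W) \<le> D * card W" if "W \<subseteq> {1..n}" "card W \<le> m" for W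
          using False that unfolding bad1_def by (meson not_le)
      qed (use E k n in auto)
      also have "\<dots> \<le> real n / k + (2 * p * m + 6 * ln n + 3) * ln n + 1"
        using D' L by (intro add_mono mult_right_mono) auto
      also have "\<dots> \<le> R" by (rule R)
      finally show ?thesis by simp
    qed auto
  qed (use p p1 in auto)
  also have "\<dots> = prodE p (pairs {1..n}) (\<lambda>E. of_bool (bad1 E)) + prodE p (pairs {1..n}) (\<lambda>E. of_bool (bad2 E))"
    by (rule prodE_add)
  also have "\<dots> \<le> 2 / n + 1 / ln n"
  proof (rule add_mono)
    show "prodE p (pairs {1..n}) (\<lambda>E. of_bool (bad1 E)) \<le> 2 / n"
      unfolding bad1_def using p p1 n D by (intro sparse_failure_probability_le) auto
    have "prodE p (pairs {1..n}) (\<lambda>E. of_bool (bad2 E))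
      \<le> (n choose m) * exp (- min (p * (m choose 2)) (real m ^ 2 * (1 - p) ^ 2 / (18 * p * real k ^ 4)))"
      unfolding bad2_def
    proof (rule uncovered_probability_le)
      show "real ((k - 2) choose i) * (real k / real m) ^ i * (1 / (1 - p)) ^ (i * (i + 3) div 2) \<le> (1/2) ^ i"
        if "1 \<le> i" "i \<le> k - 2" for i
        using K L by (intro overlap_terms_small[OF \<epsilon> p plow n \<delta> _ _ m k(2) x a2 a3 that]) auto
    qed (use p p1 k unc in auto)
    also note unc(1)
    finally show "prodE p (pairs {1..n}) (\<lambda>E. of_bool (bad2 E)) \<le> 1 / ln n" .
  qed
  finally show ?thesis .
qed

text \<open>The slack is split into halves: one pays for \<open>n / k\<close> in place of
  \<open>n / (2 * l)\<close>, with the lower bound on \<open>l\<close> absorbing the rounding of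
  \<open>k\<close>; the other pays for the small rounds.\<close>

lemma paintability_bound_le:
  fixes p \<epsilon> \<eta> :: real and n m k :: nat
  assumes \<epsilon>: "0 < \<epsilon>" and p: "0 < p" "p \<le> 1 - \<epsilon>" and \<eta>: "0 < \<eta>" "\<eta> < 1" and n: "1 \<le> n" and L: "1 \<le> ln n"
    and x: "1 \<le> ln (n * p)"
  defines "l \<equiv> ln (n * p) / (- ln (1 - p))"
  assumes l: "(2 + \<eta>) / \<eta> \<le> l" and k: "k = nat \<lfloor>(2 - \<eta>/4) * l\<rfloor>"
    and m: "m \<le> n / (16 / \<eta> * (ln n)\<^sup>2) + 1"
    and big: "96 / \<eta> * (ln n) ^ 3 \<le> n * p"
  shows "real n / k + (2 * p * m + 6 * ln n + 3) * ln n + 1 \<le> (1 + \<eta>) * (n / (2 * l))"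
proof -
  define L where "L = ln n"
  define t where "t = n / (2 * l)"
  note lbb = neg_ln_one_minus_bounds[OF \<epsilon> p]
  have p1: "p < 1" using p \<epsilon> by simp
  have n0: "0 < real n" using n by simp
  have L1: "1 \<le> L" using L by (simp add: L_def)
  have l0: "0 < l" unfolding l_def using x lbb by (intro divide_pos_pos) auto
  have l1: "1 + \<eta>/2 \<le> \<eta>/2 * l" using l \<eta> by (simp add: field_simps)
  have "n / k \<le> (1 + \<eta>/2) * t"
  proof -
    have kl: "(2 - \<eta>/4) * l - 1 \<le> k" unfolding k by linarith
    have "0 \<le> l * (\<eta>/4 - \<eta>\<^sup>2/8)" using l0 \<eta> by (intro mult_nonneg_nonneg) (auto simp: power2_eq_square mult_le_one)
    moreover have "(1 + \<eta>/2) * ((2 - \<eta>/4) * l - 1)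
        = 2 * l + (\<eta>/2 * l - (1 + \<eta>/2)) + l * (\<eta>/4 - \<eta>\<^sup>2/8)"
      by (simp add: field_simps power2_eq_square)
    ultimately have "2 * l + (\<eta>/2 * l - (1 + \<eta>/2)) \<le> (1 + \<eta>/2) * ((2 - \<eta>/4) * l - 1)"
      by linarith
    with l1 have "2 * l \<le> (1 + \<eta>/2) * ((2 - \<eta>/4) * l - 1)" by linarith
    also have "\<dots> \<le> (1 + \<eta>/2) * k" using kl \<eta> by (intro mult_left_mono) auto
    finally have *: "2 * l \<le> (1 + \<eta>/2) * k" .
    then have "0 < real k" using l0 by (cases "k = 0") auto
    then have "n / k = n * (2 * l) / (k * (2 * l))" using l0 by simp
    also have "\<dots> \<le> n * ((1 + \<eta>/2) * k) / (k * (2 * l))"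
      using * l0 by (intro divide_right_mono mult_left_mono) auto
    also have "\<dots> = (1 + \<eta>/2) * t" using \<open>0 < real k\<close> by (simp add: t_def)
    finally show ?thesis .
  qed
  moreover have tlow: "n * p / (2 * L) \<le> t"
  proof -
    have "l \<le> L / p"
    proof -
      have "ln (n * p) \<le> L" using p1 p n0 by (simp add: L_def)
      then show ?thesis unfolding l_def using lbb p x by (intro frac_le) auto
    qed
    then have "n / (2 * (L / p)) \<le> t" unfolding t_def using l0 n0 L1 p by (intro divide_left_mono) auto
    then show ?thesis by simp
  qed
  \<comment> \<open>The available amount is \<open>\<eta> n p / (4 L)\<close>. The factor
    \<open>16 / \<eta>\<close> in \<open>m\<close> makes the main term half of it, and
    \<open>96 = 8 * 12\<close> in \<open>big\<close> lets the other half cover the remaining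
    \<open>12 L^2\<close>.\<close>
  moreover have "(2 * p * m + 6 * L + 3) * L + 1 \<le> \<eta>/2 * (n * p / (2 * L))"
  proof -
    have "2 * p * m \<le> 2 * p * (n / (16 / \<eta> * L\<^sup>2) + 1)" using m p unfolding L_def by (intro mult_left_mono) auto
    also have "\<dots> \<le> \<eta> * (n * p) / (8 * L\<^sup>2) + 2" using p1 L1 \<eta> by (simp add: field_simps)
    finally have "2 * p * m \<le> \<eta> * (n * p) / (8 * L\<^sup>2) + 2" .
    then have "(2 * p * m + 6 * L + 3) * L + 1 \<le> (\<eta> * (n * p) / (8 * L\<^sup>2) + 2 + 6 * L + 3) * L + 1"
      using L1 by (intro add_mono mult_right_mono) auto
    also have "\<dots> = \<eta> * (n * p) / (8 * L) + (6 * L\<^sup>2 + 5 * L + 1)"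
      using L1 by (simp add: field_simps power2_eq_square)
    also have "6 * L\<^sup>2 + 5 * L + 1 \<le> 12 * L\<^sup>2"
    proof -
      have "L \<le> L\<^sup>2" using L1 by (simp add: power2_eq_square)
      then show ?thesis using L1 by linarith
    qed
    also have "12 * L\<^sup>2 \<le> \<eta> * (n * p) / (8 * L)"
      using big L1 \<eta> by (simp add: L_def[symmetric] field_simps power2_eq_square power3_eq_cube)
    finally show ?thesis using L1 by (simp add: field_simps)
  qed
  moreover have "\<eta>/2 * (n * p / (2 * L)) \<le> \<eta>/2 * t" using tlow \<eta> by (intro mult_left_mono) auto
  ultimately show ?thesis unfolding t_def[symmetric] L_def by (simp add: algebra_simps)
qed

lemma prodE_compl:
  assumes "finite A"
  shows "prodE p A (\<lambda>T. of_bool (Q T)) = 1 - prodE p A (\<lambda>T. of_bool (\<not> Q T))"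
proof -
  have "prodE p A (\<lambda>T. of_bool (Q T)) + prodE p A (\<lambda>T. of_bool (\<not> Q T)) = prodE p A (\<lambda>_. 1)"
    unfolding prodE_add[symmetric] by (intro prodE_cong) auto
  then show ?thesis using prodE_const[OF assms, of p 1] by simp
qed

section \<open>Passage to the limit\<close>

text \<open>The assumed domination is cubed; the cube root \<open>c\<close> of \<open>1 / C\<close>
  serves as the constant of the little-o.\<close>

lemma p_cubed_lower_bound:
  fixes p :: "nat \<Rightarrow> real" and C :: real
  assumes p: "\<And>n. 0 \<le> p n"
    and o: "(\<lambda>n. ln (ln (real n)) powr (1/3) * (ln (real n))\<^sup>2 * real n powr (-1/3)) \<in> o(p)"
    and C: "0 < C"
  shows "eventually (\<lambda>n. C * ((ln n) ^ 6 * ln (ln n)) \<le> n * p n ^ 3) sequentially"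
proof -
  define c where "c = (1 / C) powr (1/3)"
  have c: "0 < c" "c ^ 3 = 1 / C" using C by (auto simp: c_def powr_power)
  have ev: "eventually (\<lambda>n. norm (ln (ln (real n)) powr (1/3) * (ln (real n))\<^sup>2 * real n powr (-1/3)) \<le> c * norm (p n)) sequentially"
    using landau_o.smallD[OF o c(1)] .
  have big: "eventually (\<lambda>n::nat. 0 < ln (ln (real n))) sequentially" by real_asymp
  show ?thesis
    using ev big eventually_gt_at_top[of 1]
  proof eventually_elim
    case (elim n)
    define f where "f = ln (ln (real n)) powr (1/3) * (ln (real n))\<^sup>2 * real n powr (-1/3)"
    have "f \<le> c * p n" using elim p[of n] by (simp add: f_def)
    moreover have "0 \<le> f" by (simp add: f_def)
    ultimately have "f ^ 3 \<le> (c * p n) ^ 3" by (intro power_mono)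
    moreover have "f ^ 3 = ln (ln n) * (ln n) ^ 6 / n"
      using elim by (simp add: f_def power_mult_distrib power_divide powr_power powr_minus_divide flip: power_mult)
    ultimately have "ln (ln n) * (ln n) ^ 6 / n \<le> p n ^ 3 / C" by (simp add: power_mult_distrib c)
    then show ?case using elim C by (simp add: field_simps)
  qed
qed

lemma p_lower_bound:
  fixes p :: "nat \<Rightarrow> real"
  assumes p: "\<And>n. 0 \<le> p n"
    and o: "(\<lambda>n. ln (ln (real n)) powr (1/3) * (ln (real n))\<^sup>2 * real n powr (-1/3)) \<in> o(p)"
  shows "eventually (\<lambda>n. real n powr (-1/3) \<le> p n) sequentially"
proof -
  have ev: "eventually (\<lambda>n. norm (ln (ln (real n)) powr (1/3) * (ln (real n))\<^sup>2 * real n powr (-1/3)) \<le> 1 * norm (p n)) sequentially"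
    using landau_o.smallD[OF o zero_less_one] .
  have big: "eventually (\<lambda>n::nat. 1 \<le> ln (ln (real n)) powr (1/3) * (ln (real n))\<^sup>2) sequentially" by real_asymp
  show ?thesis
    using ev big
  proof eventually_elim
    case (elim n)
    have "1 * real n powr (-1/3) \<le> ln (ln (real n)) powr (1/3) * (ln (real n))\<^sup>2 * real n powr (-1/3)"
      using elim by (intro mult_right_mono) auto
    also have "\<dots> \<le> p n" using elim p[of n] by simp
    finally show ?case by simp
  qed
qed

definition colouring_scale :: "nat \<Rightarrow> real \<Rightarrow> real" where
  "colouring_scale n p = n / (2 * (ln (n * p) / (- ln (1 - p))))"

text \<open>All inequalities are collected in one event, including positivity of the scale, so that
  both asymptotic equivalences follow from it deterministically.\<close>

lemma sandwich_probability:
  fixes p :: "nat \<Rightarrow> real" and \<epsilon> \<eta> :: real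
  assumes \<epsilon>: "0 < \<epsilon>" and p: "\<And>n. 0 \<le> p n" "\<And>n. p n \<le> 1 - \<epsilon>"
    and o: "(\<lambda>n. ln (ln (real n)) powr (1/3) * (ln (real n))\<^sup>2 * real n powr (-1/3)) \<in> o(p)"
    and \<eta>: "0 < \<eta>" "\<eta> < 1"
  shows "(\<lambda>n. measure_pmf.prob (Gnp n (p n))
      {E. 0 < colouring_scale n (p n)
        \<and> (1 - \<eta>) * colouring_scale n (p n) \<le> chromatic_number {1..n} E
        \<and> chromatic_number {1..n} E \<le> paintability {1..n} E
        \<and> paintability {1..n} E \<le> (1 + \<eta>) * colouring_scale n (p n)}) \<longlonglongrightarrow> 1"
proof -
  define K where "K = 16 / \<eta>"
  define \<delta> where "\<delta> = \<eta> / 4"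
  have K: "1 \<le> K" "0 < K" using \<eta> by (auto simp: K_def field_simps)
  have \<delta>: "0 < \<delta>" "\<delta> < 1" using \<eta> by (auto simp: \<delta>_def)
  \<comment> \<open>The error is free of \<open>p\<close>: \<open>ln (n p)\<close> is replaced by
    its lower bound \<open>2/3 * ln n\<close>, which leaves an explicit function of
    \<open>n\<close>.\<close>
  define err where "err = (\<lambda>n::nat. (2 / n + 1 / ln n) + exp (1 - 2 * ln \<epsilon> - \<eta>/2 * (2/3 * ln n)))"
  have err0: "err \<longlonglongrightarrow> 0" unfolding err_def using \<eta> by real_asymp
  have plow: "eventually (\<lambda>n. real n powr (-1/3) \<le> p n) sequentially" by (rule p_lower_bound[OF p(1) o])
  have pcub: "eventually (\<lambda>n. 1152 * K / \<epsilon>\<^sup>2 * ((ln n) ^ 6 * ln (ln n)) \<le> n * p n ^ 3) sequentially"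
    using K \<epsilon> by (intro p_cubed_lower_bound[OF p(1) o]) auto
  have n1: "eventually (\<lambda>n::nat. 1 < n) sequentially" by (rule eventually_gt_at_top)
  have L1: "eventually (\<lambda>n::nat. 1 \<le> ln (real n)) sequentially" by real_asymp
  have L2: "eventually (\<lambda>n::nat. 1 \<le> ln (ln (real n))) sequentially" by real_asymp
  have a1: "eventually (\<lambda>n::nat. 2 * ln n * real n powr (1/3) \<le> n / (K * (ln n)\<^sup>2)) sequentially"
    using K by real_asymp
  have a2: "eventually (\<lambda>n::nat. 4 * K / \<epsilon>\<^sup>2 * (ln n) ^ 4 * real n powr (-1/12) \<le> 1/2) sequentially"
    using K \<epsilon> by real_asymp
  have a3: "eventually (\<lambda>n::nat. 32 * K / \<epsilon> * (ln n) ^ 3 * real n powr (- \<delta>/3) \<le> 1/2) sequentially"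
    using K \<epsilon> \<delta> by real_asymp
  have a4: "eventually (\<lambda>n::nat. 1 + ln K \<le> ln (ln n)) sequentially" by real_asymp
  have a5: "eventually (\<lambda>n::nat. 16 * K * (ln n)\<^sup>2 * ln (ln n) \<le> real n powr (2/3)) sequentially"
    using K by real_asymp
  have a7: "eventually (\<lambda>n::nat. 96 / \<eta> * (ln n) ^ 3 \<le> real n powr (2/3)) sequentially"
    using \<eta> by real_asymp
  have a8: "eventually (\<lambda>n::nat. 3 / 2 \<le> ln (real n)) sequentially" by real_asymp
  have a9: "eventually (\<lambda>n::nat. (2 + \<eta>) / \<eta> * (- ln \<epsilon>) \<le> 2/3 * ln n) sequentially" by real_asymp
  have a10: "eventually (\<lambda>n::nat. 1 - 2 * ln \<epsilon> \<le> \<eta>/2 * (2/3 * ln n)) sequentially" using \<eta> by real_asymp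
  have lower: "eventually (\<lambda>n. 1 - err n \<le> measure_pmf.prob (Gnp n (p n))
      {E. 0 < colouring_scale n (p n)
        \<and> (1 - \<eta>) * colouring_scale n (p n) \<le> chromatic_number {1..n} E
        \<and> chromatic_number {1..n} E \<le> paintability {1..n} E
        \<and> paintability {1..n} E \<le> (1 + \<eta>) * colouring_scale n (p n)}) sequentially"
    using plow pcub n1 L1 L2 a1 a2 a3 a4 a5 a7 a8 a9 a10
  proof eventually_elim
    case (elim n)
    define q where "q = p n"
    define l where "l = ln (n * q) / (- ln (1 - q))"
    define t where "t = colouring_scale n q"
    define k where "k = nat \<lfloor>(2 - \<delta>) * l\<rfloor>"
    define m where "m = nat \<lceil>n / (K * (ln n)\<^sup>2)\<rceil>"
    have t_l: "t = n / (2 * l)" by (simp add: t_def colouring_scale_def l_def)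
    have n0: "0 < real n" using elim(3) by simp
    have q: "0 < q" "q \<le> 1 - \<epsilon>" using elim(1) n0 p(2)[of n]
      by (auto simp: q_def intro: less_le_trans[of _ "real n powr (-1/3)"])
    have q1: "q < 1" using q \<epsilon> by simp
    note lbb = neg_ln_one_minus_bounds[OF \<epsilon> q]
    have n23: "real n powr (2/3) \<le> real n * q"
      unfolding q_def by (rule two_thirds_powr_le[OF n0 elim(1)])
    have lnx: "2/3 * ln n \<le> ln (n * q)"
    proof -
      have "ln (real n powr (2/3)) \<le> ln (n * q)" using n23 n0 by (intro ln_mono) auto
      then show ?thesis using n0 by (simp add: ln_powr)
    qed
    then have x1: "1 \<le> ln (n * q)" using elim(12) by simp
    have l: "(2 + \<eta>) / \<eta> \<le> l"
    proof -
      have "(2 + \<eta>) / \<eta> * (- ln (1 - q)) \<le> (2 + \<eta>) / \<eta> * (- ln \<epsilon>)"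
        using lbb \<eta> by (intro mult_left_mono) auto
      also have "\<dots> \<le> ln (n * q)" using elim(13) lnx by linarith
      finally show ?thesis unfolding l_def by (simp only: pos_le_divide_eq[OF lbb(4)])
    qed
    have l3: "3 \<le> l"
    proof -
      have "3 \<le> (2 + \<eta>) / \<eta>" using \<eta> by (simp add: field_simps)
      then show ?thesis using l by linarith
    qed
    have t0: "0 < t" using l3 n0 by (simp add: t_l)
    have l2: "3 \<le> (2 - \<delta>) * l"
    proof -
      have "1 * 3 \<le> (2 - \<delta>) * l" using l3 \<delta> by (intro mult_mono) auto
      then show ?thesis by simp
    qed
    have k2: "2 \<le> k" using l2 unfolding k_def by linarith
    have kle: "k \<le> (2 - \<delta>) * l" using l2 unfolding k_def by linarith
    have m1: "n / (K * (ln n)\<^sup>2) \<le> m" unfolding m_def by (rule real_nat_ceiling_ge)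
    have m2: "m \<le> n / (K * (ln n)\<^sup>2) + 1"
    proof -
      have "0 \<le> n / (K * (ln n)\<^sup>2)" using K by simp
      then show ?thesis unfolding m_def by linarith
    qed
    have R: "real n / k + (2 * q * m + 6 * ln n + 3) * ln n + 1 \<le> (1 + \<eta>) * t"
      unfolding t_l l_def
    proof (rule paintability_bound_le[OF \<epsilon> q \<eta> _ elim(4) x1 l[unfolded l_def]
          k_def[unfolded l_def \<delta>_def] m2[unfolded K_def]])
      show "96 / \<eta> * (ln n) ^ 3 \<le> n * q" using elim(11) n23 by linarith
    qed (use elim(3) in auto)
    have up: "prodE q (pairs {1..n}) (\<lambda>E. of_bool (\<not> paintability {1..n} E \<le> (1 + \<eta>) * t)) \<le> 2 / n + 1 / ln n"
      by (rule paintability_upper_tail[OF \<epsilon> q elim(1)[folded q_def] _ \<delta> K(1) elim(4,5) m1 k2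
          kle[unfolded l_def] x1 elim(6-10) elim(2)[folded q_def] R]) (use elim(3) in auto)
    have "prodE q (pairs {1..n}) (\<lambda>E. of_bool (\<not> real n \<le> chromatic_number {1..n} E * ((2 + \<eta>) * l)))
       \<le> exp (1 - 2 * ln \<epsilon> - \<eta>/2 * ln (n * q))"
      unfolding l_def
    proof (rule chromatic_lower_tail[OF \<epsilon> q \<eta>(1) x1])
      have "\<eta>/2 * (2/3 * ln n) \<le> \<eta>/2 * ln (n * q)" using lnx \<eta> by (intro mult_left_mono) auto
      then show "1 - 2 * ln \<epsilon> \<le> \<eta>/2 * ln (n * q)" using elim(14) by linarith
    qed (use elim(3) in auto)
    also have "\<dots> \<le> exp (1 - 2 * ln \<epsilon> - \<eta>/2 * (2/3 * ln n))"
      using lnx \<eta> by (simp add: mult_left_mono)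
    finally have lo: "prodE q (pairs {1..n}) (\<lambda>E. of_bool (\<not> real n \<le> chromatic_number {1..n} E * ((2 + \<eta>) * l)))
       \<le> exp (1 - 2 * ln \<epsilon> - \<eta>/2 * (2/3 * ln n))" .
    define good where "good = (\<lambda>E. 0 < t \<and> (1 - \<eta>) * t \<le> chromatic_number {1..n} E
        \<and> chromatic_number {1..n} E \<le> paintability {1..n} E \<and> paintability {1..n} E \<le> (1 + \<eta>) * t)"
    have "prodE q (pairs {1..n}) (\<lambda>E. of_bool (\<not> good E)) \<le>
        prodE q (pairs {1..n}) (\<lambda>E. of_bool (\<not> paintability {1..n} E \<le> (1 + \<eta>) * t)
          + of_bool (\<not> real n \<le> chromatic_number {1..n} E * ((2 + \<eta>) * l)))"
    proof (intro prodE_mono)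
      fix E assume E: "E \<subseteq> pairs {1..n}"
      have "chromatic_number {1..n} E \<le> paintability {1..n} E"
        using E elim(3) by (intro chromatic_number_le_paintability) auto
      moreover have "(1 - \<eta>) * t \<le> chromatic_number {1..n} E"
        if "real n \<le> chromatic_number {1..n} E * ((2 + \<eta>) * l)"
      proof -
        have "(1 - \<eta>) * t * ((2 + \<eta>) * l) = n * ((1 - \<eta>) * (2 + \<eta>) / 2)"
          using l3 by (simp add: t_l)
        also have "\<dots> \<le> real n * 1"
        proof (rule mult_left_mono)
          have "(1 - \<eta>) * (2 + \<eta>) = 2 - \<eta> - \<eta>\<^sup>2" by (simp add: algebra_simps power2_eq_square)
          then show "(1 - \<eta>) * (2 + \<eta>) / 2 \<le> 1" using \<eta> zero_le_power2[of \<eta>] by linarith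
        qed simp
        also have "\<dots> \<le> chromatic_number {1..n} E * ((2 + \<eta>) * l)" using that by simp
        finally show ?thesis using l3 \<eta> by (simp add: mult_le_cancel_right_pos)
      qed
      ultimately show "of_bool (\<not> good E) \<le> (of_bool (\<not> paintability {1..n} E \<le> (1 + \<eta>) * t)
          + of_bool (\<not> real n \<le> chromatic_number {1..n} E * ((2 + \<eta>) * l)) :: real)"
        using t0 by (auto simp: good_def)
    qed (use q q1 in auto)
    also have "\<dots> \<le> err n" unfolding prodE_add err_def using up lo by (intro add_mono)
    finally have "1 - err n \<le> prodE q (pairs {1..n}) (\<lambda>E. of_bool (good E))"
      by (subst prodE_compl) (auto simp: finite_pairs)
    also have "\<dots> = measure_pmf.prob (Gnp n q) {E. good E}"
      using q q1 by (intro prob_Gnp[symmetric]) auto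
    finally show ?case unfolding good_def t_def q_def .
  qed
  show ?thesis
  proof (rule tendsto_sandwich)
    show "(\<lambda>n. 1 - err n) \<longlonglongrightarrow> 1" using tendsto_diff[OF tendsto_const err0, of 1] by simp
    show "(\<lambda>_::nat. 1::real) \<longlonglongrightarrow> 1" by simp
  qed (use lower in auto)
qed

lemma aas_mono:
  assumes "aas p Q" "eventually (\<lambda>n. \<forall>E. Q n E \<longrightarrow> Q' n E) sequentially"
  shows "aas p Q'"
  unfolding aas_def
proof (rule tendsto_sandwich)
  show "(\<lambda>n. measure_pmf.prob (Gnp n (p n)) {E. Q n E}) \<longlonglongrightarrow> 1"
    using assms(1) by (simp add: aas_def)
  show "eventually (\<lambda>n. measure_pmf.prob (Gnp n (p n)) {E. Q n E} \<le> measure_pmf.prob (Gnp n (p n)) {E. Q' n E}) sequentially"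
    using assms(2) by eventually_elim (auto intro!: measure_pmf.finite_measure_mono)
  show "(\<lambda>_::nat. 1::real) \<longlonglongrightarrow> 1" by simp
qed auto

theorem theorem1:
  fixes \<epsilon> :: real and p :: "nat \<Rightarrow> real"
  assumes "\<epsilon> > 0"
    and "\<And>n. 0 \<le> p n"
    and "(\<lambda>n. ln (ln (real n)) powr (1/3) * (ln (real n))\<^sup>2 * real n powr (-1/3)) \<in> o(p)"
    and "\<And>n. p n \<le> 1 - \<epsilon>"
  shows "aas_sim p
           (\<lambda>n E. real (paintability {1..n} E))
           (\<lambda>n E. real n / (2 * log (1 / (1 - p n)) (real n * p n)))
       \<and> aas_sim p
           (\<lambda>n E. real n / (2 * log (1 / (1 - p n)) (real n * p n)))
           (\<lambda>n E. real (chromatic_number {1..n} E))"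
proof -
  have scale: "real n / (2 * log (1 / (1 - p n)) (real n * p n)) = colouring_scale n (p n)" for n
  proof -
    have "1 - p n > 0" using assms(1) assms(4)[of n] by simp
    then show ?thesis by (simp add: colouring_scale_def log_def ln_div)
  qed
  have aas: "aas p (\<lambda>n E. 0 < colouring_scale n (p n)
        \<and> (1 - \<eta>) * colouring_scale n (p n) \<le> chromatic_number {1..n} E
        \<and> chromatic_number {1..n} E \<le> paintability {1..n} E
        \<and> paintability {1..n} E \<le> (1 + \<eta>) * colouring_scale n (p n))" if "0 < \<eta>" "\<eta> < 1" for \<eta>
    unfolding aas_def using assms that by (intro sandwich_probability[where \<epsilon> = \<epsilon>])
  \<comment> \<open>The cap 1/2 gives \<open>1 / (1 - \<eta>) \<le> 1 + 2 * \<eta>\<close>, and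
    \<delta>/2 then keeps the error \<open>2 * \<eta>\<close> of the inverted ratio within
    \<delta>.\<close>
  have close: "\<bar>P / t - 1\<bar> \<le> \<delta> \<and> \<bar>t / c - 1\<bar> \<le> \<delta>"
    if "0 < \<delta>" "\<eta> = min (\<delta>/2) (1/2)" "0 < t" "(1 - \<eta>) * t \<le> c" "c \<le> P" "P \<le> (1 + \<eta>) * t"
    for P c t \<delta> \<eta> :: real
  proof
    have \<eta>: "0 < \<eta>" "\<eta> \<le> 1/2" "2 * \<eta> \<le> \<delta>" using that by auto
    have "(1 - \<eta>) * t > 0" using \<eta> that by simp
    then have c: "0 < c" using that by linarith
    have "1 - \<eta> \<le> P / t" "P / t \<le> 1 + \<eta>" using that by (auto simp: pos_le_divide_eq pos_divide_le_eq)
    then show "\<bar>P / t - 1\<bar> \<le> \<delta>" using \<eta> by (simp add: abs_le_iff)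
    have "t \<le> (1 + 2 * \<eta>) * ((1 - \<eta>) * t)"
    proof -
      have "0 \<le> \<eta> * (1 - 2 * \<eta>) * t" using \<eta> that by simp
      then show ?thesis by (simp add: algebra_simps)
    qed
    also have "\<dots> \<le> (1 + 2 * \<eta>) * c" using that \<eta> by (intro mult_left_mono) auto
    finally have 1: "t / c \<le> 1 + 2 * \<eta>" using c by (simp add: pos_divide_le_eq)
    have "(1 - 2 * \<eta>) * c \<le> (1 - 2 * \<eta>) * ((1 + \<eta>) * t)" using that \<eta> by (intro mult_left_mono) auto
    also have "\<dots> \<le> 1 * t"
    proof -
      have "0 \<le> \<eta> * (1 + 2 * \<eta>) * t" using \<eta> that by simp
      then show ?thesis by (simp add: algebra_simps)
    qed
    finally have "1 - 2 * \<eta> \<le> t / c" using c by (simp add: pos_le_divide_eq)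
    with 1 show "\<bar>t / c - 1\<bar> \<le> \<delta>" using \<eta> by (simp add: abs_le_iff)
  qed
  show ?thesis
    unfolding aas_sim_def scale
  proof (intro conjI allI impI)
    fix \<delta> :: real assume \<delta>: "0 < \<delta>"
    define \<eta> where "\<eta> = min (\<delta>/2) (1/2)"
    have \<eta>: "0 < \<eta>" "\<eta> < 1" using \<delta> by (auto simp: \<eta>_def)
    show "aas p (\<lambda>n E. \<bar>real (paintability {1..n} E) / colouring_scale n (p n) - 1\<bar> \<le> \<delta>)"
      by (rule aas_mono[OF aas[OF \<eta>]])
        (intro always_eventually allI impI conjunct1[OF close[OF \<delta> \<eta>_def]], auto)
    show "aas p (\<lambda>n E. \<bar>colouring_scale n (p n) / real (chromatic_number {1..n} E) - 1\<bar> \<le> \<delta>)"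
      by (rule aas_mono[OF aas[OF \<eta>]])
        (intro always_eventually allI impI conjunct2[OF close[OF \<delta> \<eta>_def]], auto)
  qed
qed

end
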